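(* Let $\kappa>0$, let $n=d^\kappa$, and consider the limit $d\to\infty$. For each $d$ let $f=N(0,I)$ on $\mathbb{R}^d$, let $A\subset\mathbb{R}^d$ be measurable with $p=\mathbb{P}_f(X\in A)$, and let $g=N(0,\Sigma)$, $\ell=f/g$, and $X_1,\dots,X_n$ be i.i.d. with density $g$. Assume the following. (i) (Spiked covariance.) For each $d$, $\Sigma=\sum_{k=1}^r(\lambda_k-1)v_kv_k^\top+I$ for some $r\ge1$, $0<\lambda_1\le\lambda_2\le\dots\le\lambda_r$ and some orthonormal family $(v_1,\dots,v_r)$ in $\mathbb{R}^d$, with span $V=\mathrm{span}(v_1,\dots,v_r)$; moreover $\sup_d r<\infty$; $\lambda_1=\lambda_{\min}(\Sigma)$ is independent of $d$ and satisfies $0<\lambda_1\le1$; and $\sup_d\lambda_{\max}(\Sigma)<\infty$. (ii) (Finite intrinsic dimension.) For each $d$ there is a linear subspace $U\subset\mathbb{R}^d$ such that for all $x\in\mathbb{R}^d$, $x\in A\Leftrightarrow P_Ux\in A$; moreover $\sup_d\dim(U)<\infty$. (iii) (Maximal weight.) There exists $\gamma_*\ge0$ such that $$\frac1{n^\gamma}\max_{1\le i\le n}\mathbf{1}_A(X_i)\,\ell(X_i)\Rightarrow\begin{cases}0&\text{if }\gamma>\gamma_*,\\+\infty&\text{if }\gamma<\gamma_*.\end{cases}$$ (iv) $\inf_d p>0$. (v) Either $V\subset U$ (for all $d$) or $V\subset U_\perp$ (for all $d$). Let $\kappa_*=1/(1-\gamma_* )$. Then the following holds: - if $\kappa>\kappa_*$,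 then $\lVert\hat\Sigma_A-\Sigma_A\rVert_{\mathrm{op}}\Rightarrow0$; - if $\kappa<\kappa_*$, then $\lVert\hat\Sigma_A-\Sigma_A\rVert_{\mathrm{op}}\Rightarrow\infty$, and more precisely $\lambda_{\max}(\hat\Sigma_A)\Rightarrow\infty$ while $\sup_d\lambda_{\max}(\Sigma_A)<\infty$. Moreover, if $V\subset U_\perp$ then $\kappa_*=1/\lambda_1$, while if $V\subset U$ then $1\le\kappa_*\le1/\lambda_1$.
   Context: All quantities ($A$, $U$, $V$, $\Sigma$, $r$, $\lambda_k$, $v_k$, $p$, $n$, ...) implicitly depend on $d$, and limits are as $d\to\infty$. $N(\mu,\Sigma)$ denotes the Gaussian density with mean $\mu$ and covariance $\Sigma$; a subscript on $\mathbb{P}$ or $\mathbb{E}$ indicates the law of the random vector. $\mathbf{1}_A$ is the indicator function of $A$. $P_U$ is the orthogonal projection on $U$ and $U_\perp$ is the orthogonal complement of $U$. $\lambda_{\min},\lambda_{\max}$ are the smallest and largest eigenvalues of a symmetric matrix, and $\lVert M\rVert_{\mathrm{op}}=\sup_{\lVert x\rVert=1}|x^\top Mx|$ for symmetric $M$. $\Rightarrow$ denotes convergence in distribution as $d\to\infty$; $Z\Rightarrow+\infty$ means $\mathbb{P}(Z\le x)\to0$ for every $x\in\mathbb{R}$. $n=d^\kappa$ is understood as an integer (up to rounding). Define $$\mu_A=\mathbb{E}_f(Y\mid Y\in A),\qquad \Sigma_A=\mathbb{E}_f(YY^\top\mid Y\in A)-\mu_A\mu_A^\top,$$ $$\hat\Sigma_A=\frac1{np}\sum_{i=1}^n\ell(X_i)\,\mathbf{1}_A(X_i)\,X_iX_i^\top-\mu_A\mu_A^\top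 .$$ *)

theory Defs
  imports
    "HOL-Probability.Probability"
    "Jordan_Normal_Form.Spectral_Radius"
    "Jordan_Normal_Form.DL_Rank"
    "Jordan_Normal_Form.Gauss_Jordan_Elimination"
begin

unbundle no vec_syntax
no_notation inner (infixl \<open>\<bullet>\<close> 70)
hide_const (open) Finite_Cartesian_Product.vec Finite_Cartesian_Product.mat
hide_type (open) Finite_Cartesian_Product.vec

text \<open>Since the dimension d tends to infinity inside the statement, \<open>R^d\<close> is the carrier set
  \<open>carrier_vec d\<close> of vectors (and matrices) of Jordan_Normal_Form, indexed from 0 to d - 1.\<close>

subsection \<open>Linear algebra in \<open>R^d\<close>\<close>

definition vec_norm :: "real vec \<Rightarrow> real" where
  "vec_norm x = sqrt (x \<bullet> x)"

definition outer :: "nat \<Rightarrow> real vec \<Rightarrow> real vec \<Rightarrow> real mat" where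
  "outer d x y = mat d d (\<lambda>(i, j). x $ i * y $ j)"

abbreviation is_subspace :: "nat \<Rightarrow> real vec set \<Rightarrow> bool" where
  "is_subspace d U \<equiv> VectorSpace.subspace class_ring U (module_vec TYPE(real) d)"

definition subspace_dim :: "nat \<Rightarrow> real vec set \<Rightarrow> nat" where
  "subspace_dim d U = vectorspace.dim class_ring ((module_vec TYPE(real) d)\<lparr>carrier := U\<rparr>)"

definition vec_span :: "nat \<Rightarrow> real vec set \<Rightarrow> real vec set" where
  "vec_span d S = LinearCombinations.module.span class_ring (module_vec TYPE(real) d) S"

definition orth_compl :: "nat \<Rightarrow> real vec set \<Rightarrow> real vec set" where
  "orth_compl d U = {x \<in> carrier_vec d. \<forall>u \<in> U. x \<bullet> u = 0}"

definition orth_proj :: "nat \<Rightarrow> real vec set \<Rightarrow> real vec \<Rightarrow> real vec" where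
  "orth_proj d U x = (THE u. u \<in> U \<and> x - u \<in> orth_compl d U)"

definition lambda_max :: "real mat \<Rightarrow> real" where
  "lambda_max S = Max (spectrum S)"

definition lambda_min :: "real mat \<Rightarrow> real" where
  "lambda_min S = Min (spectrum S)"

text \<open>This is the operator norm for symmetric matrices only.\<close>

definition op_norm :: "nat \<Rightarrow> real mat \<Rightarrow> real" where
  "op_norm d S = (SUP x \<in> {x \<in> carrier_vec d. vec_norm x = 1}. \<bar>x \<bullet> (S *\<^sub>v x)\<bar>)"

definition spiked_cov :: "nat \<Rightarrow> nat \<Rightarrow> (nat \<Rightarrow> real) \<Rightarrow> (nat \<Rightarrow> real vec) \<Rightarrow> real mat" where
  "spiked_cov d r lam v =
     mat d d (\<lambda>(i, j). \<Sum>k = 1..r. (lam k - 1) * outer d (v k) (v k) $$ (i, j)) + 1\<^sub>m d"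

subsection \<open>Gaussian laws on \<open>R^d\<close>\<close>

text \<open>Borel sets and Lebesgue measure, transported along the identification of a vector with its
  coordinate function on \<open>{..<d}\<close>.\<close>

definition vec_borel :: "nat \<Rightarrow> real vec measure" where
  "vec_borel d =
     vimage_algebra (carrier_vec d) (\<lambda>x. \<lambda>i\<in>{..<d}. x $ i) (\<Pi>\<^sub>M i\<in>{..<d}. (borel :: real measure))"

definition vec_lborel :: "nat \<Rightarrow> real vec measure" where
  "vec_lborel d = distr (\<Pi>\<^sub>M i\<in>{..<d}. (lborel :: real measure)) (vec_borel d) (vec d)"

definition gauss_density :: "nat \<Rightarrow> real vec \<Rightarrow> real mat \<Rightarrow> real vec \<Rightarrow> real" where
  "gauss_density d \<mu> S x =
     exp (- ((x - \<mu>) \<bullet> (the (mat_inverse S) *\<^sub>v (x - \<mu>))) / 2) / sqrt ((2 * pi) ^ d * Determinant.det S)"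

definition gauss_law :: "nat \<Rightarrow> real vec \<Rightarrow> real mat \<Rightarrow> real vec measure" where
  "gauss_law d \<mu> S = density (vec_lborel d) (\<lambda>x. ennreal (gauss_density d \<mu> S x))"

abbreviation std_gauss :: "nat \<Rightarrow> real vec measure" where
  "std_gauss d \<equiv> gauss_law d (0\<^sub>v d) (1\<^sub>m d)"

text \<open>The likelihood ratio f/g of \<open>f = N(0, I)\<close> and \<open>g = N(0, S)\<close>.\<close>

definition lik_ratio :: "nat \<Rightarrow> real mat \<Rightarrow> real vec \<Rightarrow> real" where
  "lik_ratio d S x = gauss_density d (0\<^sub>v d) (1\<^sub>m d) x / gauss_density d (0\<^sub>v d) S x"

definition prob_A :: "nat \<Rightarrow> real vec set \<Rightarrow> real" where
  "prob_A d A = measure (std_gauss d) A"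

text \<open>\<open>uniform_measure (std_gauss d) A\<close> is the conditional law of Y given Y in A, for Y
  distributed according to f.\<close>

definition cond_mean :: "nat \<Rightarrow> real vec set \<Rightarrow> real vec" where
  "cond_mean d A = vec d (\<lambda>i. \<integral>y. y $ i \<partial>uniform_measure (std_gauss d) A)"

definition cond_cov :: "nat \<Rightarrow> real vec set \<Rightarrow> real mat" where
  "cond_cov d A =
     mat d d (\<lambda>(i, j). \<integral>y. outer d y y $$ (i, j) \<partial>uniform_measure (std_gauss d) A)
     - outer d (cond_mean d A) (cond_mean d A)"

text \<open>The weights are taken with respect to \<open>g = N(0, S)\<close>; \<open>x 1, \<dots>, x n\<close> is the sample.\<close>

definition emp_cov :: "nat \<Rightarrow> nat \<Rightarrow> real mat \<Rightarrow> real vec set \<Rightarrow> (nat \<Rightarrow> real vec) \<Rightarrow> real mat" where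
  "emp_cov d n S A x =
     mat d d (\<lambda>(i, j). 1 / (real n * prob_A d A) *
       (\<Sum>k = 1..n. lik_ratio d S (x k) * indicator A (x k) * outer d (x k) (x k) $$ (i, j)))
     - outer d (cond_mean d A) (cond_mean d A)"

subsection \<open>Modes of convergence\<close>

definition conv_distr_const ::
    "(nat \<Rightarrow> 'w measure) \<Rightarrow> (nat \<Rightarrow> 'w \<Rightarrow> real) \<Rightarrow> real \<Rightarrow> bool" where
  "conv_distr_const M Z c \<longleftrightarrow> weak_conv_m (\<lambda>d. distr (M d) borel (Z d)) (return borel c)"

definition conv_distr_infinity :: "(nat \<Rightarrow> 'w measure) \<Rightarrow> (nat \<Rightarrow> 'w \<Rightarrow> real) \<Rightarrow> bool" where
  "conv_distr_infinity M Z \<longleftrightarrow>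
     (\<forall>x. (\<lambda>d. measure (M d) {\<omega> \<in> space (M d). Z d \<omega> \<le> x}) \<longlonglongrightarrow> 0)"

end

theory Submission
  imports Defs
begin

text \<open>Write \<open>f = N(0, I)\<close>, \<open>g = N(0, S)\<close> and \<open>l = f / g\<close>. Everything
rests on the change of measure \<open>E_g [l h] = E_f [h]\<close>. The ratio depends on the spike coordinates only:
\<open>l y = D exp (W y / 2)\<close> with \<open>W y = \<Sum>k. (1 / lam k - 1) (v k \<bullet> y)\<^sup>2\<close>, and
since \<open>g\<close> has mass 1, the constant is the Gaussian integral \<open>D = E_f exp (- W / 2)\<close>. Rank
and eigenvalues being bounded, \<open>D\<close> and the moments \<open>E_f (l powr \<eta>)\<close> with
\<open>\<eta> \<ge> 0\<close> and \<open>\<eta> (1 / lam1 - 1) < 1\<close> are bounded uniformly in \<open>d\<close>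
(\<open>scale_upper\<close>, \<open>scale_lower\<close>, \<open>moment_lik_ratio\<close>). The Gaussian integrals come
from the Cameron-Martin formula: \<open>exp (a s\<^sup>2 / 2)\<close> is an average of exponentials that are linear in
\<open>s\<close>.

The exponent \<open>\<gamma>s\<close>. Bounded moments of \<open>l\<close> of all orders below
\<open>1 / (1 - lam1)\<close> under \<open>g\<close> give \<open>\<gamma>s \<le> 1 - lam1\<close> by a union bound
(\<open>gamma_upper\<close>). If \<open>V\<close> is orthogonal to \<open>U\<close>, the set \<open>A\<close> is
invariant under translations along \<open>v 1\<close>; moving a typical part of \<open>A\<close> by
\<open>T v 1\<close> bounds the tail of the weights from below at the matching rate, and independence of the sample
gives \<open>\<gamma>s \<ge> 1 - lam1\<close> (\<open>weighted_tail_lower\<close>, \<open>gamma_lower\<close>).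

Above the threshold, \<open>\<kappa> (1 - \<gamma>s) > 1\<close>. Choose \<open>\<gamma> > \<gamma>s\<close> with
\<open>\<kappa> (1 - \<gamma>) > 1\<close>. With high probability no weight exceeds
\<open>N = n powr \<gamma>\<close>, so the weights may be truncated at \<open>N\<close>, at the price of a small bias.
In a fixed direction the truncated weighted squares have exponential moments at scale \<open>1 / N\<close>: in the
second-order term \<open>l\<^sup>2 \<le> N l\<close>, and the remaining \<open>l\<close> is absorbed by the change of
measure (\<open>trunc_mgf\<close>). Hence a deviation has probability at most \<open>exp (- c n / N)\<close> with
\<open>n / N = d powr (\<kappa> (1 - \<gamma>))\<close>, up to constants. As the exponent of \<open>d\<close> exceeds
1, the bound survives a union over a crude grid of \<open>exp (O (d ln d))\<close> directions, on which the operator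
norm can be tested (\<open>quad_form_le_of_grid\<close>, \<open>error_norm_conv\<close>).

Below the threshold, \<open>\<kappa> (1 - \<gamma>s) < 1\<close>. Choose \<open>\<gamma> < \<gamma>s\<close> with
\<open>\<kappa> (1 - \<gamma>) < 1\<close>. Some weight exceeds \<open>n powr \<gamma>\<close>, and all sample points
have squared length at least \<open>d / 8\<close>, so the heaviest point alone contributes
\<open>n powr (\<gamma> - 1) d / 8\<close> to the empirical covariance in its own direction; this tends to infinity,
whereas the conditional mean and covariance stay bounded (\<open>emp_cov_large\<close>,
\<open>divergence\<close>).\<close>

(* the dot is the scalar product of vectors of the type used here, not the inner product of
   Euclidean spaces *)
unbundle no inner_syntax

section \<open>The standard Gaussian measure\<close>

lemma space_vec_borel [simp]: "space (vec_borel d) = carrier_vec d"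
  by (simp add: vec_borel_def)

lemma space_vec_lborel [simp]: "space (vec_lborel d) = carrier_vec d"
  by (simp add: vec_lborel_def)

lemma sets_vec_lborel [measurable_cong]: "sets (vec_lborel d) = sets (vec_borel d)"
  by (simp add: vec_lborel_def)

lemma space_gauss_law [simp]: "space (gauss_law d m S) = carrier_vec d"
  by (simp add: gauss_law_def)

lemma sets_gauss_law [measurable_cong]: "sets (gauss_law d m S) = sets (vec_borel d)"
  by (simp add: gauss_law_def sets_vec_lborel)

text \<open>The sigma-algebra on vectors is generated by the coordinates, so measurability into it is checked
coordinatewise.\<close>
lemma measurable_vec_borelI:
  assumes "\<And>\<omega>. \<omega> \<in> space N \<Longrightarrow> g \<omega> \<in> carrier_vec d"
    and "\<And>i. i < d \<Longrightarrow> (\<lambda>\<omega>. g \<omega> $ i) \<in> borel_measurable N"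
  shows "g \<in> N \<rightarrow>\<^sub>M vec_borel d"
  unfolding vec_borel_def
  by (rule measurable_vimage_algebra2) (use assms in \<open>auto intro!: measurable_restrict\<close>)

lemma measurable_vec_coord [measurable]:
  assumes "i < d"
  shows "(\<lambda>x. x $ i) \<in> borel_measurable (vec_borel d)"
proof -
  have "(\<lambda>x. \<lambda>i\<in>{..<d}. x $ i) \<in> vec_borel d \<rightarrow>\<^sub>M (\<Pi>\<^sub>M i\<in>{..<d}. (borel :: real measure))"
    unfolding vec_borel_def by (rule measurable_vimage_algebra1) (auto simp: space_PiM)
  from measurable_compose[OF this, of "\<lambda>x. x i" borel] assms show ?thesis by simp
qed

lemma scalar_prod_eq_sum: "y \<in> carrier_vec d \<Longrightarrow> x \<bullet> y = (\<Sum>i<d. x $ i * y $ i)"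
  by (auto simp: scalar_prod_def lessThan_atLeast0)

lemma measurable_scalar_prod [measurable]:
  "(\<lambda>y. u \<bullet> y) \<in> borel_measurable (vec_borel d)"
proof -
  have "(\<lambda>y. \<Sum>i<d. u $ i * y $ i) \<in> borel_measurable (vec_borel d)"
    by measurable
  then show ?thesis
    by (subst measurable_cong[where g = "\<lambda>y. \<Sum>i<d. u $ i * y $ i"]) (auto simp: scalar_prod_eq_sum)
qed

lemma measurable_scalar_prod_self [measurable]:
  "(\<lambda>y. y \<bullet> y) \<in> borel_measurable (vec_borel d)"
proof -
  have "(\<lambda>y. \<Sum>i<d. y $ i * y $ i) \<in> borel_measurable (vec_borel d)"
    by measurable
  then show ?thesis
    by (subst measurable_cong[where g = "\<lambda>y. \<Sum>i<d. y $ i * y $ i"]) (auto simp: scalar_prod_eq_sum)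
qed

lemma measurable_vec_add [measurable]:
  assumes "u \<in> carrier_vec d"
  shows "(\<lambda>y. y + u) \<in> vec_borel d \<rightarrow>\<^sub>M vec_borel d"
proof (rule measurable_vec_borelI)
  fix i assume i: "i < d"
  have "(\<lambda>y. y $ i + u $ i) \<in> borel_measurable (vec_borel d)"
    using i by measurable
  then show "(\<lambda>y. (y + u) $ i) \<in> borel_measurable (vec_borel d)"
    by (subst measurable_cong[where g = "\<lambda>y. y $ i + u $ i"]) (use assms i in auto)
qed (use assms in auto)

lemma measurable_vec_of_fun [measurable]:
  "vec d \<in> (\<Pi>\<^sub>M i\<in>{..<d}. (lborel :: real measure)) \<rightarrow>\<^sub>M vec_borel d"
proof (rule measurable_vec_borelI)
  fix i assume i: "i < d"
  have "(\<lambda>x. x i) \<in> borel_measurable (\<Pi>\<^sub>M i\<in>{..<d}. (lborel :: real measure))"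
    using measurable_component_singleton[of i "{..<d}" "\<lambda>_. lborel :: real measure"] i by simp
  then show "(\<lambda>x. vec d x $ i) \<in> borel_measurable (\<Pi>\<^sub>M i\<in>{..<d}. (lborel :: real measure))"
    using i by simp
qed auto

lemma nn_integral_vec_lborel:
  "F \<in> borel_measurable (vec_borel d) \<Longrightarrow>
     (\<integral>\<^sup>+y. F y \<partial>vec_lborel d) = (\<integral>\<^sup>+x. F (vec d x) \<partial>(\<Pi>\<^sub>M i\<in>{..<d}. (lborel :: real measure)))"
  unfolding vec_lborel_def by (subst nn_integral_distr) auto

text \<open>A product measure is determined by boxes, and on a box the claim is the translation invariance of Lebesgue
measure in each coordinate separately.\<close>
lemma PiM_lborel_translate:
  fixes u :: "'i \<Rightarrow> real"
  assumes "finite I"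
  shows "distr (PiM I (\<lambda>_. lborel)) (PiM I (\<lambda>_. lborel)) (\<lambda>x. \<lambda>i\<in>I. u i + x i)
       = PiM I (\<lambda>_. (lborel :: real measure))" (is "distr ?M ?M ?T = ?M")
proof -
  interpret product_sigma_finite "\<lambda>_::'i. (lborel :: real measure)"
    by (simp add: product_sigma_finite_def lborel.sigma_finite_measure_axioms)
  have T: "?T \<in> ?M \<rightarrow>\<^sub>M ?M"
    by (rule measurable_restrict) auto
  show ?thesis
  proof (rule PiM_eqI[OF assms])
    fix A :: "'i \<Rightarrow> real set" assume A: "\<And>i. i \<in> I \<Longrightarrow> A i \<in> sets lborel"
    have A': "i \<in> I \<Longrightarrow> (+) (u i) -` A i \<in> sets lborel" for i
      using measurable_sets[of "(+) (u i)" lborel lborel "A i"] A[of i] by auto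
    have "emeasure (distr ?M ?M ?T) (Pi\<^sub>E I A) = emeasure ?M (?T -` Pi\<^sub>E I A \<inter> space ?M)"
      using T A assms by (intro emeasure_distr sets_PiM_I_finite) auto
    also have "?T -` Pi\<^sub>E I A \<inter> space ?M = Pi\<^sub>E I (\<lambda>i. (+) (u i) -` A i)"
    proof (intro subset_antisym subsetI)
      fix x assume "x \<in> ?T -` Pi\<^sub>E I A \<inter> space ?M"
      then show "x \<in> Pi\<^sub>E I (\<lambda>i. (+) (u i) -` A i)"
        by (auto simp: space_PiM PiE_iff)
    next
      fix x assume "x \<in> Pi\<^sub>E I (\<lambda>i. (+) (u i) -` A i)"
      then show "x \<in> ?T -` Pi\<^sub>E I A \<inter> space ?M"
        by (auto simp: space_PiM PiE_iff)
    qed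
    also have "emeasure ?M \<dots> = (\<Prod>i\<in>I. emeasure lborel ((+) (u i) -` A i))"
      using A' assms by (intro emeasure_PiM) auto
    also have "\<dots> = (\<Prod>i\<in>I. emeasure lborel (A i))"
    proof (rule prod.cong[OF refl])
      fix i assume "i \<in> I"
      have "emeasure (distr lborel borel ((+) (u i))) (A i) = emeasure lborel ((+) (u i) -` A i)"
        using A[OF \<open>i \<in> I\<close>] by (subst emeasure_distr) auto
      then show "emeasure lborel ((+) (u i) -` A i) = emeasure lborel (A i)"
        by (simp add: lborel_distr_plus)
    qed
    finally show "emeasure (distr ?M ?M ?T) (Pi\<^sub>E I A) = (\<Prod>i\<in>I. emeasure lborel (A i))" .
  qed simp
qed

lemma nn_integral_vec_lborel_translate:
  assumes u: "u \<in> carrier_vec d" and F [measurable]: "F \<in> borel_measurable (vec_borel d)"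
  shows "(\<integral>\<^sup>+y. F (y + u) \<partial>vec_lborel d) = (\<integral>\<^sup>+y. F y \<partial>vec_lborel d)"
proof -
  let ?M = "\<Pi>\<^sub>M i\<in>{..<d}. (lborel :: real measure)"
  let ?T = "\<lambda>x. \<lambda>i\<in>{..<d}. u $ i + x i"
  have T: "?T \<in> ?M \<rightarrow>\<^sub>M ?M"
    by (rule measurable_restrict) auto
  have F': "(\<lambda>y. F (y + u)) \<in> borel_measurable (vec_borel d)"
    using u by measurable
  have "(\<integral>\<^sup>+y. F y \<partial>vec_lborel d) = (\<integral>\<^sup>+x. F (vec d x) \<partial>distr ?M ?M ?T)"
    by (simp add: nn_integral_vec_lborel PiM_lborel_translate)
  also have "\<dots> = (\<integral>\<^sup>+x. F (vec d (?T x)) \<partial>?M)"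
    using T by (intro nn_integral_distr) auto
  also have "\<dots> = (\<integral>\<^sup>+x. F (vec d x + u) \<partial>?M)"
    using u by (intro nn_integral_cong arg_cong[where f = F]) auto
  also have "\<dots> = (\<integral>\<^sup>+y. F (y + u) \<partial>vec_lborel d)"
    using F' by (simp add: nn_integral_vec_lborel)
  finally show ?thesis by simp
qed

lemma mat_inverse_one: "mat_inverse (1\<^sub>m d :: real mat) = Some (1\<^sub>m d)"
proof (cases "mat_inverse (1\<^sub>m d :: real mat)")
  case None
  have "(1\<^sub>m d :: real mat) \<in> Units (ring_mat TYPE(real) d ())"
    by (rule det_non_zero_imp_unit) auto
  with mat_inverse(1)[OF one_carrier_mat None, where b = "()"] show ?thesis by blast
next
  case (Some B)
  from mat_inverse(2)[OF one_carrier_mat Some] Some show ?thesis by auto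
qed

lemma gauss_density_std:
  assumes "x \<in> carrier_vec d"
  shows "gauss_density d (0\<^sub>v d) (1\<^sub>m d) x = exp (- (x \<bullet> x) / 2) / sqrt ((2 * pi) ^ d)"
proof -
  have "x - 0\<^sub>v d = x" using assms by auto
  then show ?thesis
    using assms by (simp add: gauss_density_def mat_inverse_one)
qed

lemma measurable_gauss_density_std [measurable]:
  "gauss_density d (0\<^sub>v d) (1\<^sub>m d) \<in> borel_measurable (vec_borel d)"
proof -
  have "(\<lambda>x. exp (- (x \<bullet> x) / 2) / sqrt ((2 * pi) ^ d)) \<in> borel_measurable (vec_borel d)"
    by measurable
  then show ?thesis
    by (subst measurable_cong[where g = "\<lambda>x. exp (- (x \<bullet> x) / 2) / sqrt ((2 * pi) ^ d)"])
       (auto simp: gauss_density_std)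
qed

lemma nn_integral_std_gauss:
  assumes [measurable]: "F \<in> borel_measurable (vec_borel d)"
  shows "(\<integral>\<^sup>+y. F y \<partial>std_gauss d) =
    (\<integral>\<^sup>+y. ennreal (exp (- (y \<bullet> y) / 2) / sqrt ((2 * pi) ^ d)) * F y \<partial>vec_lborel d)"
  unfolding gauss_law_def
  by (subst nn_integral_density) (auto intro!: nn_integral_cong simp: gauss_density_std)

text \<open>The density of \<open>N(0, I)\<close> is the product of the one-dimensional densities, so Fubini
factorises the integral.\<close>
lemma std_gauss_product:
  assumes h [measurable]: "\<And>i. i < d \<Longrightarrow> h i \<in> borel_measurable borel"
  shows "(\<integral>\<^sup>+y. (\<Prod>i<d. h i (y $ i)) \<partial>std_gauss d)
       = (\<Prod>i<d. \<integral>\<^sup>+t. ennreal (std_normal_density t) * h i t \<partial>lborel)"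
proof -
  interpret product_sigma_finite "\<lambda>_::nat. (lborel :: real measure)"
    by (simp add: product_sigma_finite_def lborel.sigma_finite_measure_axioms)
  let ?M = "\<Pi>\<^sub>M i\<in>{..<d}. (lborel :: real measure)"
  have [measurable]: "(\<lambda>y. \<Prod>i<d. h i (y $ i)) \<in> borel_measurable (vec_borel d)"
  proof (intro borel_measurable_prod_ennreal)
    fix i assume "i \<in> {..<d}"
    then have i: "i < d" by simp
    show "(\<lambda>y. h i (y $ i)) \<in> borel_measurable (vec_borel d)"
      by (rule measurable_compose[OF measurable_vec_coord[OF i] h[OF i]])
  qed
  have dens: "ennreal (exp (- (vec d x \<bullet> vec d x) / 2) / sqrt ((2 * pi) ^ d))
      = (\<Prod>i<d. ennreal (std_normal_density (x i)))" for x
  proof -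
    have "(\<Prod>i<d. std_normal_density (x i)) = exp (\<Sum>i<d. - (x i)\<^sup>2 / 2) / sqrt (2 * pi) ^ d"
      unfolding std_normal_density_def by (simp add: exp_sum prod_dividef)
    also have "(\<Sum>i<d. - (x i)\<^sup>2 / 2) = - (vec d x \<bullet> vec d x) / 2"
      by (simp add: scalar_prod_eq_sum[of _ d] power2_eq_square sum_negf sum_divide_distrib)
    finally have "(\<Prod>i<d. std_normal_density (x i)) = exp (- (vec d x \<bullet> vec d x) / 2) / sqrt ((2 * pi) ^ d)"
      by (simp add: real_sqrt_power[symmetric] power_mult_distrib real_sqrt_mult)
    then show ?thesis by (subst prod_ennreal) (auto)
  qed
  have "(\<integral>\<^sup>+y. (\<Prod>i<d. h i (y $ i)) \<partial>std_gauss d)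
      = (\<integral>\<^sup>+x. ennreal (exp (- (vec d x \<bullet> vec d x) / 2) / sqrt ((2 * pi) ^ d)) * (\<Prod>i<d. h i (vec d x $ i)) \<partial>?M)"
    by (subst nn_integral_std_gauss, measurable, subst nn_integral_vec_lborel, measurable)
  also have "\<dots> = (\<integral>\<^sup>+x. (\<Prod>i<d. ennreal (std_normal_density (x i)) * h i (x i)) \<partial>?M)"
    unfolding dens prod.distrib by simp
  also have "\<dots> = (\<Prod>i<d. \<integral>\<^sup>+t. ennreal (std_normal_density t) * h i t \<partial>lborel)"
    by (rule product_nn_integral_prod) auto
  finally show ?thesis .
qed

text \<open>Up to the factor \<open>1 / sqrt (1 - a)\<close>, the integrand is the density of
\<open>N(0, 1 / (1 - a))\<close>.\<close>
lemma nn_integral_std_normal_square: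
  assumes "a < 1"
  shows "(\<integral>\<^sup>+t. ennreal (std_normal_density t) * ennreal (exp (a / 2 * t\<^sup>2)) \<partial>lborel) = ennreal (1 / sqrt (1 - a))"
proof -
  define s where "s = 1 / sqrt (1 - a)"
  have s: "s > 0" "s\<^sup>2 = 1 / (1 - a)" using assms by (auto simp: s_def power_divide)
  have "(\<integral>\<^sup>+t. ennreal (std_normal_density t) * ennreal (exp (a / 2 * t\<^sup>2)) \<partial>lborel)
      = (\<integral>\<^sup>+t. ennreal s * ennreal (normal_density 0 s t) \<partial>lborel)"
  proof (intro nn_integral_cong)
    fix t :: real
    have "s * normal_density 0 s t = s / sqrt (2 * pi * s\<^sup>2) * exp (- t\<^sup>2 / (2 * s\<^sup>2))"
      by (simp add: normal_density_def)
    also have "s / sqrt (2 * pi * s\<^sup>2) = 1 / sqrt (2 * pi)"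
      using s(1) by (simp add: real_sqrt_mult)
    also have "- t\<^sup>2 / (2 * s\<^sup>2) = a / 2 * t\<^sup>2 - t\<^sup>2 / 2"
      unfolding s(2) by (simp add: field_simps)
    also have "a / 2 * t\<^sup>2 - t\<^sup>2 / 2 = - t\<^sup>2 / 2 + a / 2 * t\<^sup>2"
      by simp
    finally have "s * normal_density 0 s t = std_normal_density t * exp (a / 2 * t\<^sup>2)"
      by (simp only: std_normal_density_def exp_add mult.assoc)
    then show "ennreal (std_normal_density t) * ennreal (exp (a / 2 * t\<^sup>2)) = ennreal s * ennreal (normal_density 0 s t)"
      using s(1) by (simp add: ennreal_mult'[symmetric])
  qed
  also have "\<dots> = ennreal s"
    using prob_space.emeasure_space_1[OF prob_space_normal_density[OF s(1)], of 0]
    by (simp add: nn_integral_cmult emeasure_density)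
  finally show ?thesis by (simp add: s_def)
qed

lemma prob_space_std_gauss: "prob_space (std_gauss d)"
proof
  have "emeasure (std_gauss d) (space (std_gauss d)) = (\<integral>\<^sup>+y. (\<Prod>i<d. 1) \<partial>std_gauss d)"
    by simp
  also have "\<dots> = (\<Prod>i<d. \<integral>\<^sup>+t. ennreal (std_normal_density t) * 1 \<partial>lborel)"
    by (rule std_gauss_product) auto
  also have "\<dots> = 1"
    using nn_integral_std_normal_square[of 0] by simp
  finally show "emeasure (std_gauss d) (space (std_gauss d)) = 1" .
qed

lemma std_gauss_exp_norm:
  assumes "a < 1"
  shows "(\<integral>\<^sup>+y. ennreal (exp (a / 2 * (y \<bullet> y))) \<partial>std_gauss d) = ennreal ((1 / sqrt (1 - a)) ^ d)"
proof -
  have "(\<integral>\<^sup>+y. ennreal (exp (a / 2 * (y \<bullet> y))) \<partial>std_gauss d)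
      = (\<integral>\<^sup>+y. (\<Prod>i<d. ennreal (exp (a / 2 * (y $ i)\<^sup>2))) \<partial>std_gauss d)"
  proof (intro nn_integral_cong)
    fix y assume "y \<in> space (std_gauss d)"
    then have "a / 2 * (y \<bullet> y) = (\<Sum>i<d. a / 2 * (y $ i)\<^sup>2)"
      by (simp add: scalar_prod_eq_sum[of _ d] sum_distrib_left power2_eq_square)
    then show "ennreal (exp (a / 2 * (y \<bullet> y))) = (\<Prod>i<d. ennreal (exp (a / 2 * (y $ i)\<^sup>2)))"
      by (simp only: exp_sum finite_lessThan prod_ennreal exp_ge_zero)
  qed
  also have "\<dots> = (\<Prod>i<d. \<integral>\<^sup>+t. ennreal (std_normal_density t) * ennreal (exp (a / 2 * t\<^sup>2)) \<partial>lborel)"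
    by (rule std_gauss_product) auto
  also have "\<dots> = ennreal (1 / sqrt (1 - a)) ^ d"
    using assms by (subst nn_integral_std_normal_square) auto
  finally show ?thesis by (simp add: ennreal_power assms less_imp_le)
qed

text \<open>Translating Lebesgue measure by \<open>u\<close> moves the Gaussian density to
\<open>\<phi> (y - u) = \<phi> y * exp (u \<bullet> y - (u \<bullet> u) / 2)\<close>. All information on the joint law
of several linear functionals of a Gaussian vector is extracted from this formula.\<close>
lemma cameron_martin:
  assumes u: "u \<in> carrier_vec d" and F [measurable]: "F \<in> borel_measurable (vec_borel d)"
  shows "(\<integral>\<^sup>+y. F (y + u) \<partial>std_gauss d)
       = (\<integral>\<^sup>+y. ennreal (exp (u \<bullet> y - (u \<bullet> u) / 2)) * F y \<partial>std_gauss d)"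
proof -
  let ?\<phi> = "\<lambda>y. exp (- (y \<bullet> y) / 2) / sqrt ((2 * pi) ^ d)"
  have sq: "(y + u) \<bullet> (y + u) = y \<bullet> y + 2 * (u \<bullet> y) + u \<bullet> u" if y: "y \<in> carrier_vec d" for y
  proof -
    have "(y + u) \<bullet> (y + u) = (y + u) \<bullet> y + (y + u) \<bullet> u"
      using y u by (intro scalar_prod_add_distrib[of _ d]) auto
    also have "(y + u) \<bullet> y = y \<bullet> y + u \<bullet> y"
      using y u by (intro add_scalar_prod_distrib[of _ d]) auto
    also have "(y + u) \<bullet> u = y \<bullet> u + u \<bullet> u"
      using y u by (intro add_scalar_prod_distrib[of _ d]) auto
    also have "y \<bullet> u = u \<bullet> y"
      using y u by (intro comm_scalar_prod[of _ d]) auto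
    finally show ?thesis by simp
  qed
  have [measurable]: "(\<lambda>y. F (y + u)) \<in> borel_measurable (vec_borel d)"
    using u by measurable
  have "(\<integral>\<^sup>+y. F (y + u) \<partial>std_gauss d) = (\<integral>\<^sup>+y. ennreal (?\<phi> y) * F (y + u) \<partial>vec_lborel d)"
    by (subst nn_integral_std_gauss) auto
  also have "\<dots> = (\<integral>\<^sup>+y. ennreal (exp (u \<bullet> (y + u) - (u \<bullet> u) / 2)) * (ennreal (?\<phi> (y + u)) * F (y + u)) \<partial>vec_lborel d)"
  proof (intro nn_integral_cong)
    fix y assume "y \<in> space (vec_lborel d)"
    then have y: "y \<in> carrier_vec d" by simp
    have "- (y \<bullet> y) / 2 = (u \<bullet> (y + u) - (u \<bullet> u) / 2) + - ((y + u) \<bullet> (y + u)) / 2"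
      unfolding sq[OF y] scalar_prod_add_distrib[OF u y u] by (simp add: field_simps)
    then have "?\<phi> y = exp (u \<bullet> (y + u) - (u \<bullet> u) / 2) * ?\<phi> (y + u)"
      by (simp only: exp_add times_divide_eq_right)
    then show "ennreal (?\<phi> y) * F (y + u) =
       ennreal (exp (u \<bullet> (y + u) - (u \<bullet> u) / 2)) * (ennreal (?\<phi> (y + u)) * F (y + u))"
      by (simp only: mult.assoc[symmetric] ennreal_mult'[symmetric] exp_ge_zero)
  qed
  also have "\<dots> = (\<integral>\<^sup>+y. ennreal (exp (u \<bullet> y - (u \<bullet> u) / 2)) * (ennreal (?\<phi> y) * F y) \<partial>vec_lborel d)"
    by (rule nn_integral_vec_lborel_translate[OF u]) measurable
  also have "\<dots> = (\<integral>\<^sup>+y. ennreal (exp (u \<bullet> y - (u \<bullet> u) / 2)) * F y \<partial>std_gauss d)"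
    by (subst nn_integral_std_gauss) (auto intro!: nn_integral_cong simp: mult_ac)
  finally show ?thesis .
qed


section \<open>Exponential moments of squares\<close>

lemma nn_integral_std_normal_linear:
  "(\<integral>\<^sup>+t. ennreal (std_normal_density t) * ennreal (exp (b * t)) \<partial>lborel) = ennreal (exp (b\<^sup>2 / 2))"
proof -
  have "(\<integral>\<^sup>+t. ennreal (std_normal_density t) * ennreal (exp (b * t)) \<partial>lborel)
      = (\<integral>\<^sup>+t. ennreal (exp (b\<^sup>2 / 2)) * ennreal (normal_density b 1 t) \<partial>lborel)"
  proof (intro nn_integral_cong)
    fix t :: real
    have "- t\<^sup>2 / 2 + b * t = - (t - b)\<^sup>2 / 2 + b\<^sup>2 / 2"
      by (simp add: power2_eq_square field_simps)
    then have "exp (- t\<^sup>2 / 2) * exp (b * t) = exp (- (t - b)\<^sup>2 / 2) * exp (b\<^sup>2 / 2)"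
      by (simp only: exp_add[symmetric])
    then have "std_normal_density t * exp (b * t) = exp (b\<^sup>2 / 2) * normal_density b 1 t"
      unfolding std_normal_density_def normal_density_def by simp
    then show "ennreal (std_normal_density t) * ennreal (exp (b * t))
        = ennreal (exp (b\<^sup>2 / 2)) * ennreal (normal_density b 1 t)"
      by (simp add: ennreal_mult'[symmetric])
  qed
  also have "\<dots> = ennreal (exp (b\<^sup>2 / 2))"
    using prob_space.emeasure_space_1[OF prob_space_normal_density[of 1 b]]
    by (simp add: nn_integral_cmult emeasure_density)
  finally show ?thesis .
qed

text \<open>Since \<open>exp (a s\<^sup>2 / 2)\<close> is the mean of \<open>exp (sqrt a s \<xi>)\<close> over a
standard normal \<open>\<xi>\<close>, the square in the exponent can be linearised. For fixed \<open>\<xi>\<close> the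
linear exponential is a Cameron-Martin factor for a translation along \<open>u\<close>, which \<open>H\<close> does
not see; what remains is a one-dimensional integral over \<open>\<xi>\<close>.\<close>
lemma std_gauss_exp_square_step:
  assumes u: "u \<in> carrier_vec d" and H [measurable]: "H \<in> borel_measurable (vec_borel d)"
    and inv: "\<And>t y. y \<in> carrier_vec d \<Longrightarrow> H (y + t \<cdot>\<^sub>v u) = H y"
    and a: "0 \<le> a" "a * (u \<bullet> u) < 1"
  shows "(\<integral>\<^sup>+y. H y * ennreal (exp (a / 2 * (u \<bullet> y)\<^sup>2)) \<partial>std_gauss d)
       = ennreal (1 / sqrt (1 - a * (u \<bullet> u))) * (\<integral>\<^sup>+y. H y \<partial>std_gauss d)"
proof -
  interpret G: prob_space "std_gauss d" by (rule prob_space_std_gauss)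
  interpret pair_sigma_finite "std_gauss d" lborel
    by (simp add: pair_sigma_finite_def lborel.sigma_finite_measure_axioms G.sigma_finite_measure_axioms)
  have tilt: "(\<integral>\<^sup>+y. H y * ennreal (exp (sqrt a * (u \<bullet> y) * t)) \<partial>std_gauss d)
      = ennreal (exp (a * (u \<bullet> u) / 2 * t\<^sup>2)) * (\<integral>\<^sup>+y. H y \<partial>std_gauss d)" for t
  proof -
    define w where "w = (sqrt a * t) \<cdot>\<^sub>v u"
    have w: "w \<in> carrier_vec d" using u by (simp add: w_def)
    have wy: "w \<bullet> y = sqrt a * (u \<bullet> y) * t" if "y \<in> carrier_vec d" for y
      using that u by (simp add: w_def)
    have ww: "w \<bullet> w = a * (u \<bullet> u) * t\<^sup>2"
      using u a by (simp add: w_def power2_eq_square algebra_simps)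
    have "(\<integral>\<^sup>+y. H y * ennreal (exp (sqrt a * (u \<bullet> y) * t)) \<partial>std_gauss d)
        = (\<integral>\<^sup>+y. ennreal (exp (w \<bullet> w / 2)) * (ennreal (exp (w \<bullet> y - w \<bullet> w / 2)) * H y) \<partial>std_gauss d)"
    proof (intro nn_integral_cong)
      fix y assume "y \<in> space (std_gauss d)"
      then have "exp (sqrt a * (u \<bullet> y) * t) = exp (w \<bullet> w / 2) * exp (w \<bullet> y - w \<bullet> w / 2)"
        using wy[of y] by (simp add: exp_add[symmetric])
      then show "H y * ennreal (exp (sqrt a * (u \<bullet> y) * t))
          = ennreal (exp (w \<bullet> w / 2)) * (ennreal (exp (w \<bullet> y - w \<bullet> w / 2)) * H y)"
        by (simp add: ennreal_mult' mult_ac)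
    qed
    also have "\<dots> = ennreal (exp (w \<bullet> w / 2)) * (\<integral>\<^sup>+y. ennreal (exp (w \<bullet> y - w \<bullet> w / 2)) * H y \<partial>std_gauss d)"
      by (intro nn_integral_cmult) measurable
    also have "(\<integral>\<^sup>+y. ennreal (exp (w \<bullet> y - w \<bullet> w / 2)) * H y \<partial>std_gauss d) = (\<integral>\<^sup>+y. H (y + w) \<partial>std_gauss d)"
      using cameron_martin[OF w H] by simp
    also have "\<dots> = (\<integral>\<^sup>+y. H y \<partial>std_gauss d)"
      by (intro nn_integral_cong) (simp add: w_def inv)
    finally show ?thesis unfolding ww by (simp add: field_simps)
  qed
  have "(\<integral>\<^sup>+y. H y * ennreal (exp (a / 2 * (u \<bullet> y)\<^sup>2)) \<partial>std_gauss d)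
      = (\<integral>\<^sup>+y. \<integral>\<^sup>+t. H y * (ennreal (std_normal_density t) * ennreal (exp (sqrt a * (u \<bullet> y) * t))) \<partial>lborel \<partial>std_gauss d)"
  proof (intro nn_integral_cong)
    fix y
    have "(\<integral>\<^sup>+t. H y * (ennreal (std_normal_density t) * ennreal (exp (sqrt a * (u \<bullet> y) * t))) \<partial>lborel)
        = H y * ennreal (exp ((sqrt a * (u \<bullet> y))\<^sup>2 / 2))"
      by (subst nn_integral_cmult) (auto simp: nn_integral_std_normal_linear)
    then show "H y * ennreal (exp (a / 2 * (u \<bullet> y)\<^sup>2))
       = (\<integral>\<^sup>+t. H y * (ennreal (std_normal_density t) * ennreal (exp (sqrt a * (u \<bullet> y) * t))) \<partial>lborel)"
      using a by (simp add: power_mult_distrib)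
  qed
  also have "\<dots> = (\<integral>\<^sup>+t. \<integral>\<^sup>+y. H y * (ennreal (std_normal_density t) * ennreal (exp (sqrt a * (u \<bullet> y) * t))) \<partial>std_gauss d \<partial>lborel)"
    by (rule Fubini'[symmetric]) measurable
  also have "\<dots> = (\<integral>\<^sup>+t. (ennreal (std_normal_density t) * ennreal (exp (a * (u \<bullet> u) / 2 * t\<^sup>2))) * (\<integral>\<^sup>+y. H y \<partial>std_gauss d) \<partial>lborel)"
  proof (intro nn_integral_cong)
    fix t :: real
    have "(\<integral>\<^sup>+y. H y * (ennreal (std_normal_density t) * ennreal (exp (sqrt a * (u \<bullet> y) * t))) \<partial>std_gauss d)
        = (\<integral>\<^sup>+y. ennreal (std_normal_density t) * (H y * ennreal (exp (sqrt a * (u \<bullet> y) * t))) \<partial>std_gauss d)"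
      by (simp add: mult_ac)
    also have "\<dots> = ennreal (std_normal_density t) * (\<integral>\<^sup>+y. H y * ennreal (exp (sqrt a * (u \<bullet> y) * t)) \<partial>std_gauss d)"
      by (intro nn_integral_cmult) measurable
    finally show "(\<integral>\<^sup>+y. H y * (ennreal (std_normal_density t) * ennreal (exp (sqrt a * (u \<bullet> y) * t))) \<partial>std_gauss d)
       = (ennreal (std_normal_density t) * ennreal (exp (a * (u \<bullet> u) / 2 * t\<^sup>2))) * (\<integral>\<^sup>+y. H y \<partial>std_gauss d)"
      unfolding tilt by (simp add: mult.assoc)
  qed
  also have "\<dots> = ennreal (1 / sqrt (1 - a * (u \<bullet> u))) * (\<integral>\<^sup>+y. H y \<partial>std_gauss d)"
    using a nn_integral_std_normal_square[of "a * (u \<bullet> u)"] by (subst nn_integral_multc) auto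
  finally show ?thesis .
qed

lemma std_gauss_exp_square:
  assumes u: "u \<in> carrier_vec d" and a: "0 \<le> a" "a * (u \<bullet> u) < 1"
  shows "(\<integral>\<^sup>+y. ennreal (exp (a / 2 * (u \<bullet> y)\<^sup>2)) \<partial>std_gauss d) = ennreal (1 / sqrt (1 - a * (u \<bullet> u)))"
proof -
  interpret G: prob_space "std_gauss d" by (rule prob_space_std_gauss)
  show ?thesis
    using std_gauss_exp_square_step[OF u, of "\<lambda>_. 1" a] a G.emeasure_space_1 by simp
qed

text \<open>Functionals orthogonal to \<open>v m\<close> are invariant under translations along \<open>v m\<close>, so
the directions can be integrated out one at a time.\<close>
lemma std_gauss_exp_orthonormal:
  assumes "finite K" and v: "\<And>k. k \<in> K \<Longrightarrow> v k \<in> carrier_vec d"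
    and on: "\<And>j k. j \<in> K \<Longrightarrow> k \<in> K \<Longrightarrow> v j \<bullet> v k = (if j = k then 1 else 0)"
    and a: "0 \<le> a" "a < 1"
  shows "(\<integral>\<^sup>+y. ennreal (exp (a / 2 * (\<Sum>k\<in>K. (v k \<bullet> y)\<^sup>2))) \<partial>std_gauss d)
       = ennreal ((1 / sqrt (1 - a)) ^ card K)"
  using assms(1) v on
proof (induction K)
  case empty
  interpret G: prob_space "std_gauss d" by (rule prob_space_std_gauss)
  show ?case using G.emeasure_space_1 by simp
next
  case (insert m K)
  have m: "v m \<in> carrier_vec d" "v m \<bullet> v m = 1" using insert.prems by auto
  let ?H = "\<lambda>y. ennreal (exp (a / 2 * (\<Sum>k\<in>K. (v k \<bullet> y)\<^sup>2)))"
  have inv: "?H (y + t \<cdot>\<^sub>v v m) = ?H y" if y: "y \<in> carrier_vec d" for y t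
  proof -
    have "v k \<bullet> (y + t \<cdot>\<^sub>v v m) = v k \<bullet> y" if "k \<in> K" for k
    proof -
      have "v k \<in> carrier_vec d" "v k \<bullet> v m = 0" using insert.prems insert.hyps that by auto
      then show ?thesis
        using y m(1) by (simp add: scalar_prod_add_distrib[of _ d])
    qed
    then show ?thesis by simp
  qed
  have "(\<integral>\<^sup>+y. ennreal (exp (a / 2 * (\<Sum>k\<in>insert m K. (v k \<bullet> y)\<^sup>2))) \<partial>std_gauss d)
      = (\<integral>\<^sup>+y. ?H y * ennreal (exp (a / 2 * (v m \<bullet> y)\<^sup>2)) \<partial>std_gauss d)"
    using insert.hyps
    by (intro nn_integral_cong) (simp add: ennreal_mult'[symmetric] exp_add[symmetric] algebra_simps)
  also have "\<dots> = ennreal (1 / sqrt (1 - a)) * (\<integral>\<^sup>+y. ?H y \<partial>std_gauss d)"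
    using std_gauss_exp_square_step[OF m(1), of ?H a] inv a m(2) by simp
  also have "(\<integral>\<^sup>+y. ?H y \<partial>std_gauss d) = ennreal ((1 / sqrt (1 - a)) ^ card K)"
    using insert.prems by (intro insert.IH) auto
  also have "ennreal (1 / sqrt (1 - a)) * ennreal ((1 / sqrt (1 - a)) ^ card K)
      = ennreal ((1 / sqrt (1 - a)) ^ card (insert m K))"
    using insert.hyps a by (simp add: ennreal_mult'[symmetric])
  finally show ?case .
qed


section \<open>Gaussian laws with spiked covariance\<close>

lemma quad_form_eq_sum:
  fixes M :: "real mat"
  assumes "M \<in> carrier_mat d d" "x \<in> carrier_vec d" "y \<in> carrier_vec d"
  shows "x \<bullet> (M *\<^sub>v y) = (\<Sum>i<d. \<Sum>j<d. M $$ (i, j) * (x $ i * y $ j))"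
proof -
  have "x \<bullet> (M *\<^sub>v y) = (\<Sum>i<d. x $ i * (M *\<^sub>v y) $ i)"
    using assms by (intro scalar_prod_eq_sum) auto
  also have "\<dots> = (\<Sum>i<d. \<Sum>j<d. M $$ (i, j) * (x $ i * y $ j))"
  proof (intro sum.cong refl)
    fix i assume "i \<in> {..<d}"
    then have "(M *\<^sub>v y) $ i = (\<Sum>j<d. M $$ (i, j) * y $ j)"
      using assms by (simp add: scalar_prod_eq_sum[of _ d])
    then show "x $ i * (M *\<^sub>v y) $ i = (\<Sum>j<d. M $$ (i, j) * (x $ i * y $ j))"
      by (simp only: sum_distrib_left) (intro sum.cong refl, simp add: algebra_simps)
  qed
  finally show ?thesis .
qed

text \<open>The bounds \<open>R\<close> on the rank and \<open>lam1\<close>, \<open>L\<close> on the eigenvalues are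
parameters, because every constant derived below has to depend on them alone and not on \<open>d\<close>. That the
density of \<open>N(0, S)\<close> has total mass 1 is part of the assumptions; it replaces all computation of the
determinant of \<open>S\<close>.\<close>
locale spiked =
  fixes d r R :: nat and lam :: "nat \<Rightarrow> real" and v :: "nat \<Rightarrow> real Matrix.vec"
    and S :: "real mat" and lam1 L :: real
  assumes S_def: "S = spiked_cov d r lam v"
    and rank: "1 \<le> r" "r \<le> R"
    and v_carrier: "\<And>k. k \<in> {1..r} \<Longrightarrow> v k \<in> carrier_vec d"
    and orthonormal: "\<And>j k. j \<in> {1..r} \<Longrightarrow> k \<in> {1..r} \<Longrightarrow> v j \<bullet> v k = (if j = k then 1 else 0)"
    and lam_lower: "\<And>k. k \<in> {1..r} \<Longrightarrow> lam1 \<le> lam k"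
    and lam_upper: "\<And>k. k \<in> {1..r} \<Longrightarrow> lam k \<le> L"
    and lam_first: "lam 1 = lam1"
    and lam1: "0 < lam1" "lam1 \<le> 1"
    and L: "1 \<le> L"
    and normalized: "(\<integral>\<^sup>+x. ennreal (gauss_density d (0\<^sub>v d) S x) \<partial>vec_lborel d) = 1"
begin

lemma S_carrier: "S \<in> carrier_mat d d"
  by (simp add: S_def spiked_cov_def)

lemma lam_pos: "k \<in> {1..r} \<Longrightarrow> 0 < lam k"
  using lam_lower[of k] lam1 by linarith

lemma cov_form:
  assumes z: "z \<in> carrier_vec d" and y: "y \<in> carrier_vec d"
  shows "z \<bullet> (S *\<^sub>v y) = z \<bullet> y + (\<Sum>k=1..r. (lam k - 1) * ((v k \<bullet> z) * (v k \<bullet> y)))"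
proof -
  have "z \<bullet> (S *\<^sub>v y) = (\<Sum>i<d. \<Sum>j<d. S $$ (i, j) * (z $ i * y $ j))"
    by (rule quad_form_eq_sum[OF S_carrier z y])
  also have "\<dots> = (\<Sum>i<d. \<Sum>j<d. (\<Sum>k=1..r. (lam k - 1) * ((v k $ i * z $ i) * (v k $ j * y $ j)))
      + (if i = j then z $ i * y $ j else 0))"
    by (intro sum.cong refl)
      (auto simp: S_def spiked_cov_def outer_def one_mat_def sum_distrib_right sum_distrib_left distrib_right
        intro!: sum.cong)
  also have "\<dots> = (\<Sum>i<d. \<Sum>j<d. \<Sum>k=1..r. (lam k - 1) * ((v k $ i * z $ i) * (v k $ j * y $ j)))
      + (\<Sum>i<d. z $ i * y $ i)"
    by (simp add: sum.distrib)
  also have "(\<Sum>i<d. \<Sum>j<d. \<Sum>k=1..r. (lam k - 1) * ((v k $ i * z $ i) * (v k $ j * y $ j)))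
      = (\<Sum>k=1..r. \<Sum>i<d. \<Sum>j<d. (lam k - 1) * ((v k $ i * z $ i) * (v k $ j * y $ j)))"
    by (subst (2) sum.swap, subst sum.swap) (rule refl)
  also have "\<dots> = (\<Sum>k=1..r. (lam k - 1) * ((v k \<bullet> z) * (v k \<bullet> y)))"
    unfolding scalar_prod_eq_sum[OF z] scalar_prod_eq_sum[OF y]
    by (intro sum.cong refl) (simp only: sum_product, simp only: sum_distrib_left)
  also have "(\<Sum>i<d. z $ i * y $ i) = z \<bullet> y"
    by (simp add: scalar_prod_eq_sum[OF y])
  finally show ?thesis by simp
qed

lemma spike_cov:
  assumes k: "k \<in> {1..r}" and y: "y \<in> carrier_vec d"
  shows "v k \<bullet> (S *\<^sub>v y) = lam k * (v k \<bullet> y)"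
proof -
  have "v k \<bullet> (S *\<^sub>v y) = v k \<bullet> y + (\<Sum>j=1..r. (lam j - 1) * ((v j \<bullet> v k) * (v j \<bullet> y)))"
    by (rule cov_form[OF v_carrier[OF k] y])
  also have "(\<Sum>j=1..r. (lam j - 1) * ((v j \<bullet> v k) * (v j \<bullet> y)))
      = (\<Sum>j=1..r. if j = k then (lam j - 1) * (v j \<bullet> y) else 0)"
    using k by (intro sum.cong refl) (auto simp: orthonormal)
  also have "\<dots> = (lam k - 1) * (v k \<bullet> y)" using k by simp
  finally show ?thesis by (simp add: algebra_simps)
qed

text \<open>For a nonpositive determinant the formula for the density gives nonpositive values (division by zero
yields 0), which contradicts total mass 1.\<close>
lemma det_pos: "0 < Determinant.det S"
proof (rule ccontr)
  assume "\<not> 0 < Determinant.det S"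
  then have "sqrt ((2 * pi) ^ d * Determinant.det S) \<le> 0"
    by (simp add: mult_nonneg_nonpos)
  then have "gauss_density d (0\<^sub>v d) S x \<le> 0" for x
    unfolding gauss_density_def by (intro divide_nonneg_nonpos) auto
  then have "(\<integral>\<^sup>+x. ennreal (gauss_density d (0\<^sub>v d) S x) \<partial>vec_lborel d) = 0"
    by (simp add: ennreal_neg)
  with normalized show False by simp
qed

text \<open>With \<open>x = S y\<close> the left-hand side is \<open>x \<bullet> y\<close>. Pairing
\<open>x = S y\<close> with \<open>v k\<close> and with \<open>x\<close> expresses it through the numbers
\<open>v k \<bullet> x\<close>.\<close>
lemma inverse_form:
  assumes x: "x \<in> carrier_vec d"
  shows "x \<bullet> (the (mat_inverse S) *\<^sub>v x) = x \<bullet> x + (\<Sum>k=1..r. (1 / lam k - 1) * (v k \<bullet> x)\<^sup>2)"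
proof -
  have "S \<in> Units (ring_mat TYPE(real) d ())"
    using det_pos by (intro det_non_zero_imp_unit S_carrier) auto
  then obtain Q where Q: "mat_inverse S = Some Q"
    using mat_inverse(1)[OF S_carrier, where b = "()"] by (cases "mat_inverse S") auto
  have Q': "S * Q = 1\<^sub>m d" "Q \<in> carrier_mat d d" using mat_inverse(2)[OF S_carrier Q] by auto
  define y where "y = Q *\<^sub>v x"
  have y: "y \<in> carrier_vec d" using Q' x by (simp add: y_def)
  have Sy: "S *\<^sub>v y = x"
    using Q' x assoc_mult_mat_vec[OF S_carrier Q'(2) x] by (simp add: y_def)
  have vx: "v k \<bullet> x = lam k * (v k \<bullet> y)" if "k \<in> {1..r}" for k
    using spike_cov[OF that y] by (simp add: Sy)
  have "x \<bullet> x = x \<bullet> y + (\<Sum>k=1..r. (lam k - 1) * ((v k \<bullet> x) * (v k \<bullet> y)))"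
    using cov_form[OF x y] by (simp add: Sy)
  also have "(\<Sum>k=1..r. (lam k - 1) * ((v k \<bullet> x) * (v k \<bullet> y))) = (\<Sum>k=1..r. - ((1 / lam k - 1) * (v k \<bullet> x)\<^sup>2))"
  proof (intro sum.cong refl)
    fix k assume k: "k \<in> {1..r}"
    show "(lam k - 1) * ((v k \<bullet> x) * (v k \<bullet> y)) = - ((1 / lam k - 1) * (v k \<bullet> x)\<^sup>2)"
      using lam_pos[OF k] unfolding vx[OF k] by (simp add: field_simps power2_eq_square)
  qed
  finally show ?thesis by (simp add: Q y_def sum_negf)
qed

text \<open>The constant factor of the likelihood ratio.\<close>
definition scale :: real where "scale = sqrt (Determinant.det S)"

text \<open>The quadratic form of \<open>S^-1 - I\<close>, which is twice the exponent of the likelihood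
ratio.\<close>
definition spike_form :: "real Matrix.vec \<Rightarrow> real" where
  "spike_form y = (\<Sum>k=1..r. (1 / lam k - 1) * (v k \<bullet> y)\<^sup>2)"

lemma scale_pos: "0 < scale"
  using det_pos by (simp add: scale_def)

lemma gauss_density_spiked:
  assumes y: "y \<in> carrier_vec d"
  shows "gauss_density d (0\<^sub>v d) S y
       = exp (- (y \<bullet> y) / 2) / sqrt ((2 * pi) ^ d) * (exp (- spike_form y / 2) / scale)"
proof -
  have y0: "y - 0\<^sub>v d = y" using y by auto
  have "gauss_density d (0\<^sub>v d) S y = exp (- (y \<bullet> y) / 2 + - spike_form y / 2) / (sqrt ((2 * pi) ^ d) * scale)"
    unfolding gauss_density_def y0 inverse_form[OF y] spike_form_def[symmetric]
    by (simp only: scale_def real_sqrt_mult) (simp add: field_simps)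
  then show ?thesis by (simp only: exp_add times_divide_times_eq)
qed

lemma lik_ratio_eq:
  assumes y: "y \<in> carrier_vec d"
  shows "lik_ratio d S y = scale * exp (spike_form y / 2)"
  using scale_pos unfolding lik_ratio_def gauss_density_spiked[OF y] gauss_density_std[OF y]
  by (simp add: exp_minus field_simps)

lemma lik_ratio_pos: "y \<in> carrier_vec d \<Longrightarrow> 0 < lik_ratio d S y"
  using scale_pos by (simp add: lik_ratio_eq)

lemma measurable_spike_form [measurable]: "spike_form \<in> borel_measurable (vec_borel d)"
  unfolding spike_form_def by measurable

lemma measurable_lik_ratio [measurable]: "lik_ratio d S \<in> borel_measurable (vec_borel d)"
proof -
  have "(\<lambda>y. scale * exp (spike_form y / 2)) \<in> borel_measurable (vec_borel d)" by measurable
  then show ?thesis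
    by (subst measurable_cong[where g = "\<lambda>y. scale * exp (spike_form y / 2)"]) (auto simp: lik_ratio_eq)
qed

text \<open>The law \<open>N(0, S)\<close> has density \<open>1 / lik_ratio\<close> with respect to
\<open>N(0, I)\<close>: everything about the sample is an integral against the standard Gaussian measure.\<close>
lemma nn_integral_change_of_law:
  assumes F [measurable]: "F \<in> borel_measurable (vec_borel d)"
  shows "(\<integral>\<^sup>+y. ennreal (gauss_density d (0\<^sub>v d) S y) * F y \<partial>vec_lborel d)
       = (\<integral>\<^sup>+y. ennreal (1 / lik_ratio d S y) * F y \<partial>std_gauss d)"
proof -
  have "(\<integral>\<^sup>+y. ennreal (gauss_density d (0\<^sub>v d) S y) * F y \<partial>vec_lborel d)
      = (\<integral>\<^sup>+y. ennreal (exp (- (y \<bullet> y) / 2) / sqrt ((2 * pi) ^ d)) * (ennreal (1 / lik_ratio d S y) * F y) \<partial>vec_lborel d)"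
  proof (intro nn_integral_cong)
    fix y assume "y \<in> space (vec_lborel d)"
    then have y: "y \<in> carrier_vec d" by simp
    have "gauss_density d (0\<^sub>v d) S y = exp (- (y \<bullet> y) / 2) / sqrt ((2 * pi) ^ d) * (1 / lik_ratio d S y)"
      unfolding gauss_density_spiked[OF y] lik_ratio_eq[OF y] using scale_pos
      by (simp add: exp_minus field_simps)
    then show "ennreal (gauss_density d (0\<^sub>v d) S y) * F y
      = ennreal (exp (- (y \<bullet> y) / 2) / sqrt ((2 * pi) ^ d)) * (ennreal (1 / lik_ratio d S y) * F y)"
      using lik_ratio_pos[OF y] by (simp only: mult.assoc[symmetric] ennreal_mult' divide_nonneg_nonneg
        exp_ge_zero real_sqrt_ge_zero zero_le_power pi_ge_zero mult_nonneg_nonneg)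
  qed
  also have "\<dots> = (\<integral>\<^sup>+y. ennreal (1 / lik_ratio d S y) * F y \<partial>std_gauss d)"
    by (subst nn_integral_std_gauss) measurable
  finally show ?thesis .
qed

lemma nn_integral_inverse_lik_ratio: "(\<integral>\<^sup>+y. ennreal (1 / lik_ratio d S y) \<partial>std_gauss d) = 1"
  using nn_integral_change_of_law[of "\<lambda>_. 1"] normalized by simp

end

section \<open>Rayleigh quotients\<close>

definition symmetric_mat :: "nat \<Rightarrow> real mat \<Rightarrow> bool" where
  "symmetric_mat d M \<longleftrightarrow> M \<in> carrier_mat d d \<and> (\<forall>i<d. \<forall>j<d. M $$ (i, j) = M $$ (j, i))"

lemma symmetric_mat_carrier: "symmetric_mat d M \<Longrightarrow> M \<in> carrier_mat d d"
  by (simp add: symmetric_mat_def)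

lemma symmetric_mat_form:
  assumes "symmetric_mat d M" "x \<in> carrier_vec d" "y \<in> carrier_vec d"
  shows "x \<bullet> (M *\<^sub>v y) = y \<bullet> (M *\<^sub>v x)"
proof -
  have M: "M \<in> carrier_mat d d" using assms(1) by (rule symmetric_mat_carrier)
  have "x \<bullet> (M *\<^sub>v y) = (\<Sum>j<d. \<Sum>i<d. M $$ (i, j) * (x $ i * y $ j))"
    unfolding quad_form_eq_sum[OF M assms(2,3)] by (rule sum.swap)
  also have "\<dots> = y \<bullet> (M *\<^sub>v x)"
    unfolding quad_form_eq_sum[OF M assms(3,2)]
    using assms(1) by (intro sum.cong refl) (auto simp: symmetric_mat_def)
  finally show ?thesis .
qed

lemma symmetric_mat_form_add:
  assumes S: "symmetric_mat d M" and x: "x \<in> carrier_vec d" and y: "y \<in> carrier_vec d"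
  shows "(x + t \<cdot>\<^sub>v y) \<bullet> (M *\<^sub>v (x + t \<cdot>\<^sub>v y))
       = x \<bullet> (M *\<^sub>v x) + 2 * t * (y \<bullet> (M *\<^sub>v x)) + t\<^sup>2 * (y \<bullet> (M *\<^sub>v y))"
proof -
  have M: "M \<in> carrier_mat d d" using S by (rule symmetric_mat_carrier)
  have "(x + t \<cdot>\<^sub>v y) \<bullet> (M *\<^sub>v (x + t \<cdot>\<^sub>v y))
      = x \<bullet> (M *\<^sub>v x) + t * (x \<bullet> (M *\<^sub>v y)) + t * (y \<bullet> (M *\<^sub>v x)) + t * t * (y \<bullet> (M *\<^sub>v y))"
    using M x y
    by (simp add: mult_add_distrib_mat_vec[of _ d d] mult_mat_vec[of _ d d]
        scalar_prod_add_distrib[of _ d] add_scalar_prod_distrib[of _ d] algebra_simps)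
  then show ?thesis
    by (simp add: symmetric_mat_form[OF S x y] power2_eq_square)
qed

lemma scalar_prod_self_eq_0_iff:
  assumes "(x :: real Matrix.vec) \<in> carrier_vec d"
  shows "x \<bullet> x = 0 \<longleftrightarrow> x = 0\<^sub>v d"
proof
  assume "x \<bullet> x = 0"
  then have "(\<Sum>i<d. (x $ i)\<^sup>2) = 0"
    using assms by (simp add: scalar_prod_eq_sum[of _ d] power2_eq_square)
  then show "x = 0\<^sub>v d"
    using assms by (subst (asm) sum_nonneg_eq_0_iff) auto
qed (use assms in auto)

lemma scalar_prod_self_nonneg: "0 \<le> x \<bullet> (x :: real Matrix.vec)"
  by (simp add: scalar_prod_def sum_nonneg)

lemma vec_norm_eq_1_iff: "vec_norm x = 1 \<longleftrightarrow> x \<bullet> x = 1"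
  by (simp add: vec_norm_def)

lemma normalize_vec:
  assumes "(x :: real Matrix.vec) \<in> carrier_vec d" "x \<noteq> 0\<^sub>v d"
  obtains y where "y \<in> carrier_vec d" "y \<bullet> y = 1" "x = sqrt (x \<bullet> x) \<cdot>\<^sub>v y"
proof -
  define s where "s = sqrt (x \<bullet> x)"
  have pos: "x \<bullet> x > 0"
    using assms scalar_prod_self_eq_0_iff[of x d] scalar_prod_self_nonneg[of x] by linarith
  then have s: "s > 0" "s * s = x \<bullet> x" by (auto simp: s_def)
  show ?thesis
  proof (rule that[of "(1 / s) \<cdot>\<^sub>v x"])
    show "((1 / s) \<cdot>\<^sub>v x) \<bullet> ((1 / s) \<cdot>\<^sub>v x) = 1"
      using assms(1) s pos by (simp add: field_simps)
    show "x = sqrt (x \<bullet> x) \<cdot>\<^sub>v ((1 / s) \<cdot>\<^sub>v x)"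
      using assms(1) s(1) by (simp add: s_def[symmetric] smult_smult_assoc)
  qed (use assms in auto)
qed

lemma quad_form_smult:
  fixes M :: "real mat"
  assumes "M \<in> carrier_mat d d" "y \<in> carrier_vec d"
  shows "(s \<cdot>\<^sub>v y) \<bullet> (M *\<^sub>v (s \<cdot>\<^sub>v y)) = s\<^sup>2 * (y \<bullet> (M *\<^sub>v y))"
  using assms by (simp add: mult_mat_vec[of _ d d] power2_eq_square)

lemma quad_form_le_normalized:
  fixes M :: "real mat"
  assumes M: "M \<in> carrier_mat d d" and x: "x \<in> carrier_vec d"
    and le: "\<And>y. y \<in> carrier_vec d \<Longrightarrow> y \<bullet> y = 1 \<Longrightarrow> y \<bullet> (M *\<^sub>v y) \<le> c"
  shows "x \<bullet> (M *\<^sub>v x) \<le> c * (x \<bullet> x)"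
proof (cases "x = 0\<^sub>v d")
  case True
  then show ?thesis using M by auto
next
  case False
  from normalize_vec[OF x False] obtain y
    where y: "y \<in> carrier_vec d" "y \<bullet> y = 1" "x = sqrt (x \<bullet> x) \<cdot>\<^sub>v y" .
  have "x \<bullet> (M *\<^sub>v x) = (x \<bullet> x) * (y \<bullet> (M *\<^sub>v y))"
    using quad_form_smult[OF M y(1), of "sqrt (x \<bullet> x)"] y(3) scalar_prod_self_nonneg[of x] by simp
  also have "\<dots> \<le> (x \<bullet> x) * c"
    using le[OF y(1,2)] scalar_prod_self_nonneg[of x] by (intro mult_left_mono)
  finally show ?thesis by (simp add: mult.commute)
qed

text \<open>Vectors are identified with functions on the naturals vanishing from \<open>d\<close> on. The unit sphere
is then a closed subset of a product of compact intervals, hence compact in the product topology, in which the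
quadratic form is continuous.\<close>
lemma rayleigh_max_attained:
  assumes d: "d \<ge> 1" and M: "M \<in> carrier_mat d d"
  obtains x where "x \<in> carrier_vec d" "x \<bullet> x = 1"
    "\<And>z. z \<in> carrier_vec d \<Longrightarrow> z \<bullet> ((M :: real mat) *\<^sub>v z) \<le> (x \<bullet> (M *\<^sub>v x)) * (z \<bullet> z)"
proof -
  define B :: "nat \<Rightarrow> real set" where "B i = (if i < d then {-1..1} else {0})" for i
  define q where "q w = (\<Sum>i<d. \<Sum>j<d. M $$ (i, j) * (w i * w j))" for w :: "nat \<Rightarrow> real"
  define K where "K = Pi\<^sub>E UNIV B \<inter> {w. (\<Sum>i<d. w i * w i) = 1}"
  have "compactin (product_topology (\<lambda>i::nat. euclidean :: real topology) UNIV) (Pi\<^sub>E UNIV B)"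
    by (subst compactin_PiE) (auto simp: B_def)
  then have "compact (Pi\<^sub>E UNIV B)"
    by (simp add: euclidean_product_topology)
  moreover have "closed {w :: nat \<Rightarrow> real. (\<Sum>i<d. w i * w i) = 1}"
    by (intro closed_Collect_eq continuous_intros continuous_on_product_coordinates)
  ultimately have K: "compact K"
    unfolding K_def by (rule compact_Int_closed)
  have ne: "K \<noteq> {}"
  proof -
    have "(\<lambda>i. if i = 0 then 1 else 0) \<in> K"
      using d by (auto simp: K_def B_def if_distrib[of "\<lambda>x. x * _"] cong: if_cong)
    then show ?thesis by blast
  qed
  have "continuous_on UNIV q"
    unfolding q_def by (intro continuous_intros continuous_on_product_coordinates)
  then have "continuous_on K q"
    by (rule continuous_on_subset) simp
  from continuous_attains_sup[OF K ne this] obtain w where w: "w \<in> K" "\<And>u. u \<in> K \<Longrightarrow> q u \<le> q w"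
    by blast
  show ?thesis
  proof (rule that[of "vec d w"])
    show "vec d w \<bullet> vec d w = 1" using w(1) by (simp add: K_def scalar_prod_eq_sum[of _ d])
    fix z :: "real Matrix.vec" assume z: "z \<in> carrier_vec d"
    show "z \<bullet> (M *\<^sub>v z) \<le> (vec d w \<bullet> (M *\<^sub>v vec d w)) * (z \<bullet> z)"
    proof (rule quad_form_le_normalized[OF M z])
      fix y :: "real Matrix.vec" assume y: "y \<in> carrier_vec d" "y \<bullet> y = 1"
      define u where "u = (\<lambda>i. if i < d then y $ i else 0)"
      have sum1: "(\<Sum>i<d. y $ i * y $ i) = 1" using y by (simp add: scalar_prod_eq_sum[of _ d])
      have "\<bar>y $ i\<bar> \<le> 1" if "i < d" for i
      proof -
        have "y $ i * y $ i \<le> (\<Sum>i<d. y $ i * y $ i)"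
          by (rule member_le_sum) (use that in auto)
        then have "\<bar>y $ i\<bar> ^ 2 \<le> 1 ^ 2" using sum1 by (simp add: power2_eq_square)
        then show ?thesis by (rule power2_le_imp_le) simp
      qed
      then have "u \<in> K" using sum1 by (auto simp: K_def B_def u_def abs_le_iff)
      from w(2)[OF this] show "y \<bullet> (M *\<^sub>v y) \<le> vec d w \<bullet> (M *\<^sub>v vec d w)"
        using M y by (simp add: quad_form_eq_sum[of _ d] q_def u_def)
    qed
  qed simp
qed

lemma linear_coeff_zero:
  fixes b c :: real
  assumes "\<And>t. 2 * t * b + t\<^sup>2 * c \<le> 0"
  shows "b = 0"
proof (rule ccontr)
  assume b: "b \<noteq> 0"
  define t where "t = b / (\<bar>c\<bar> + 1)"
  have tb: "b = t * (\<bar>c\<bar> + 1)" "t \<noteq> 0" using b by (auto simp: t_def add_nonneg_eq_0_iff)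
  have "2 * t * b + t\<^sup>2 * c = t\<^sup>2 * (2 * \<bar>c\<bar> + 2 + c)"
    unfolding tb(1) by (simp add: power2_eq_square algebra_simps)
  moreover have "t\<^sup>2 * (2 * \<bar>c\<bar> + 2 + c) > 0"
    using tb(2) by (intro mult_pos_pos) (auto simp: abs_if)
  ultimately show False using assms[of t] by linarith
qed

text \<open>At a maximiser \<open>x\<close> of the quadratic form on the sphere, the first variation in every
direction \<open>y\<close> vanishes, which says that \<open>M x - l x\<close> is orthogonal to every
\<open>y\<close>.\<close>
lemma rayleigh_eigenvalue:
  assumes d: "d \<ge> 1" and S: "symmetric_mat d M"
  obtains l where "eigenvalue M l" "\<And>z. z \<in> carrier_vec d \<Longrightarrow> z \<bullet> (M *\<^sub>v z) \<le> l * (z \<bullet> z)"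
proof -
  have M: "M \<in> carrier_mat d d" using S by (rule symmetric_mat_carrier)
  from rayleigh_max_attained[OF d M] obtain x where x: "x \<in> carrier_vec d" "x \<bullet> x = 1"
    and max: "\<And>z. z \<in> carrier_vec d \<Longrightarrow> z \<bullet> (M *\<^sub>v z) \<le> (x \<bullet> (M *\<^sub>v x)) * (z \<bullet> z)" by metis
  define l where "l = x \<bullet> (M *\<^sub>v x)"
  have crit: "y \<bullet> (M *\<^sub>v x) = l * (y \<bullet> x)" if y: "y \<in> carrier_vec d" for y
  proof -
    have "2 * t * (y \<bullet> (M *\<^sub>v x) - l * (y \<bullet> x)) + t\<^sup>2 * (y \<bullet> (M *\<^sub>v y) - l * (y \<bullet> y)) \<le> 0" for t
    proof -
      have id: "symmetric_mat d (1\<^sub>m d)" by (auto simp: symmetric_mat_def)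
      have "(x + t \<cdot>\<^sub>v y) \<bullet> (M *\<^sub>v (x + t \<cdot>\<^sub>v y)) \<le> l * ((x + t \<cdot>\<^sub>v y) \<bullet> (x + t \<cdot>\<^sub>v y))"
        unfolding l_def using x(1) y by (intro max) auto
      moreover have "(x + t \<cdot>\<^sub>v y) \<bullet> (x + t \<cdot>\<^sub>v y) = 1 + 2 * t * (y \<bullet> x) + t\<^sup>2 * (y \<bullet> y)"
        using symmetric_mat_form_add[OF id x(1) y, of t] x y by simp
      ultimately show ?thesis
        unfolding symmetric_mat_form_add[OF S x(1) y] l_def[symmetric] by (simp add: algebra_simps)
    qed
    from linear_coeff_zero[OF this] show ?thesis by simp
  qed
  have "(M *\<^sub>v x - l \<cdot>\<^sub>v x) \<bullet> (M *\<^sub>v x - l \<cdot>\<^sub>v x) = 0"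
  proof -
    let ?y = "M *\<^sub>v x - l \<cdot>\<^sub>v x"
    have y: "?y \<in> carrier_vec d" and Mx: "M *\<^sub>v x \<in> carrier_vec d" using M x by auto
    have "?y \<bullet> ?y = ?y \<bullet> (M *\<^sub>v x) - ?y \<bullet> (l \<cdot>\<^sub>v x)"
      using y Mx x by (intro scalar_prod_minus_distrib[of _ d]) auto
    then show ?thesis using crit[OF y] y x by simp
  qed
  then have "M *\<^sub>v x - l \<cdot>\<^sub>v x = 0\<^sub>v d"
    using M x by (subst (asm) scalar_prod_self_eq_0_iff[of _ d]) auto
  then have "M *\<^sub>v x = l \<cdot>\<^sub>v x"
    using M x by (metis eq_iff_diff_eq_0 index_minus_vec(1) index_zero_vec(1) carrier_vecD dim_mult_mat_vec
        eq_vecI index_smult_vec(2) carrier_matD(1))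
  moreover have "x \<noteq> 0\<^sub>v d" using x by auto
  ultimately have "eigenvalue M l"
    unfolding eigenvalue_def eigenvector_def using M x by auto
  then show ?thesis using that max l_def by blast
qed

lemma lambda_max_ge:
  assumes d: "d \<ge> 1" and S: "symmetric_mat d M" and z: "z \<in> carrier_vec d"
  shows "z \<bullet> (M *\<^sub>v z) \<le> lambda_max M * (z \<bullet> z)"
proof -
  from rayleigh_eigenvalue[OF d S] obtain l where l: "eigenvalue M l"
    "\<And>z. z \<in> carrier_vec d \<Longrightarrow> z \<bullet> (M *\<^sub>v z) \<le> l * (z \<bullet> z)" by metis
  have "l \<le> lambda_max M"
    unfolding lambda_max_def using l(1) card_finite_spectrum(1)[OF symmetric_mat_carrier[OF S]]
    by (intro Max_ge) (auto simp: spectrum_def)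
  then show ?thesis
    using l(2)[OF z] mult_right_mono[OF _ scalar_prod_self_nonneg[of z], of l "lambda_max M"] by linarith
qed

lemma lambda_max_le:
  assumes d: "d \<ge> 1" and S: "symmetric_mat d M"
    and le: "\<And>z. z \<in> carrier_vec d \<Longrightarrow> z \<bullet> z = 1 \<Longrightarrow> z \<bullet> (M *\<^sub>v z) \<le> c"
  shows "lambda_max M \<le> c"
proof -
  have M: "M \<in> carrier_mat d d" using S by (rule symmetric_mat_carrier)
  from rayleigh_eigenvalue[OF d S] have "spectrum M \<noteq> {}" by (auto simp: spectrum_def)
  then have "lambda_max M \<in> spectrum M"
    unfolding lambda_max_def using card_finite_spectrum(1)[OF M] by (intro Max_in)
  then obtain z where z: "z \<in> carrier_vec d" "z \<noteq> 0\<^sub>v d" "M *\<^sub>v z = lambda_max M \<cdot>\<^sub>v z"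
    unfolding spectrum_def eigenvalue_def eigenvector_def using M by auto
  have "lambda_max M * (z \<bullet> z) \<le> c * (z \<bullet> z)"
    using quad_form_le_normalized[OF M z(1) le] z by simp
  moreover have "z \<bullet> z > 0"
    using z scalar_prod_self_eq_0_iff[of z d] scalar_prod_self_nonneg[of z] by linarith
  ultimately show ?thesis by simp
qed

section \<open>The operator norm\<close>

lemma unit_vec_coord_le:
  assumes "x \<in> carrier_vec d" "x \<bullet> x \<le> (1 :: real)" "i < d"
  shows "\<bar>x $ i\<bar> \<le> 1"
proof -
  have "x $ i * x $ i \<le> (\<Sum>i<d. x $ i * x $ i)"
    by (rule member_le_sum) (use assms in auto)
  then have "\<bar>x $ i\<bar> ^ 2 \<le> 1 ^ 2"
    using assms by (simp add: power2_eq_square scalar_prod_eq_sum[of _ d])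
  then show ?thesis by (rule power2_le_imp_le) simp
qed

lemma quad_form_bdd:
  fixes M :: "real mat"
  assumes "M \<in> carrier_mat d d" "x \<in> carrier_vec d" "x \<bullet> x \<le> 1"
  shows "\<bar>x \<bullet> (M *\<^sub>v x)\<bar> \<le> (\<Sum>i<d. \<Sum>j<d. \<bar>M $$ (i, j)\<bar>)"
proof -
  have "\<bar>x \<bullet> (M *\<^sub>v x)\<bar> \<le> (\<Sum>i<d. \<Sum>j<d. \<bar>M $$ (i, j) * (x $ i * x $ j)\<bar>)"
    unfolding quad_form_eq_sum[OF assms(1,2,2)]
    by (rule order_trans[OF sum_abs sum_mono[OF sum_abs]])
  also have "\<dots> \<le> (\<Sum>i<d. \<Sum>j<d. \<bar>M $$ (i, j)\<bar> * 1)"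
  proof (intro sum_mono)
    fix i j assume ij: "i \<in> {..<d}" "j \<in> {..<d}"
    have "\<bar>x $ i\<bar> * \<bar>x $ j\<bar> \<le> 1 * 1"
      using ij unit_vec_coord_le[OF assms(2,3)] by (intro mult_mono) auto
    then show "\<bar>M $$ (i, j) * (x $ i * x $ j)\<bar> \<le> \<bar>M $$ (i, j)\<bar> * 1"
      unfolding abs_mult by (intro mult_left_mono) auto
  qed
  finally show ?thesis by simp
qed

lemma op_norm_ge:
  assumes M: "M \<in> carrier_mat d d" and x: "x \<in> carrier_vec d" "x \<bullet> x = 1"
  shows "\<bar>x \<bullet> (M *\<^sub>v x)\<bar> \<le> op_norm d M"
  unfolding op_norm_def
proof (rule cSUP_upper)
  show "bdd_above ((\<lambda>x. \<bar>x \<bullet> (M *\<^sub>v x)\<bar>) ` {x \<in> carrier_vec d. vec_norm x = 1})"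
    using quad_form_bdd[OF M] by (intro bdd_aboveI2[where M = "\<Sum>i<d. \<Sum>j<d. \<bar>M $$ (i, j)\<bar>"]) (simp add: vec_norm_eq_1_iff)
qed (use x in \<open>simp add: vec_norm_eq_1_iff\<close>)

lemma unit_vec_exists: "d \<ge> 1 \<Longrightarrow> \<exists>x \<in> carrier_vec d. x \<bullet> x = (1 :: real)"
  by (intro bexI[of _ "unit_vec d 0"]) auto

lemma op_norm_le:
  assumes d: "d \<ge> 1"
    and le: "\<And>x. x \<in> carrier_vec d \<Longrightarrow> x \<bullet> x = 1 \<Longrightarrow> \<bar>x \<bullet> (M *\<^sub>v x)\<bar> \<le> t"
  shows "op_norm d M \<le> t"
  unfolding op_norm_def using unit_vec_exists[OF d] le
  by (intro cSUP_least) (auto simp: vec_norm_eq_1_iff)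

lemma op_norm_nonneg:
  assumes d: "d \<ge> 1" and M: "M \<in> carrier_mat d d"
  shows "0 \<le> op_norm d M"
  using unit_vec_exists[OF d] op_norm_ge[OF M] by (meson abs_ge_zero order_trans)

text \<open>Countably many test vectors suffice by density and homogeneity; this is what makes the operator norm of a
random matrix measurable.\<close>
lemma op_norm_le_iff_rational:
  assumes d: "d \<ge> 1" and M: "M \<in> carrier_mat d d"
  shows "op_norm d M \<le> t \<longleftrightarrow> 0 \<le> t \<and> (\<forall>q \<in> Pi\<^sub>E {..<d} (\<lambda>_. \<rat>). \<bar>vec d q \<bullet> (M *\<^sub>v vec d q)\<bar> \<le> t * (vec d q \<bullet> vec d q))"
proof safe
  assume t: "op_norm d M \<le> t"
  then show "0 \<le> t" using op_norm_nonneg[OF d M] by linarith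
  fix q :: "nat \<Rightarrow> real"
  have y: "vec d q \<in> carrier_vec d" by simp
  have "vec d q \<bullet> (M *\<^sub>v vec d q) \<le> t * (vec d q \<bullet> vec d q)"
  proof (rule quad_form_le_normalized[OF M y])
    fix y :: "real Matrix.vec" assume "y \<in> carrier_vec d" "y \<bullet> y = 1"
    from op_norm_ge[OF M this] t show "y \<bullet> (M *\<^sub>v y) \<le> t" by linarith
  qed
  moreover have "vec d q \<bullet> ((- M) *\<^sub>v vec d q) \<le> t * (vec d q \<bullet> vec d q)"
  proof (rule quad_form_le_normalized[OF _ y])
    fix y :: "real Matrix.vec" assume y: "y \<in> carrier_vec d" "y \<bullet> y = 1"
    from op_norm_ge[OF M this] t show "y \<bullet> ((- M) *\<^sub>v y) \<le> t"
      using M y by simp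
  qed (use M in auto)
  ultimately show "\<bar>vec d q \<bullet> (M *\<^sub>v vec d q)\<bar> \<le> t * (vec d q \<bullet> vec d q)"
    using M by (simp add: abs_le_iff)
next
  assume t: "0 \<le> t" and q: "\<forall>q \<in> Pi\<^sub>E {..<d} (\<lambda>_. \<rat>). \<bar>vec d q \<bullet> (M *\<^sub>v vec d q)\<bar> \<le> t * (vec d q \<bullet> vec d q)"
  show "op_norm d M \<le> t"
  proof (rule op_norm_le[OF d])
    fix x :: "real Matrix.vec" assume x: "x \<in> carrier_vec d" "x \<bullet> x = 1"
    have "\<exists>z. z \<in> \<rat> \<and> x $ i < z \<and> z < x $ i + inverse (real (Suc m))" for i m
      using Rats_dense_in_real[of "x $ i" "x $ i + inverse (real (Suc m))"] by auto
    then obtain z where z: "\<And>i m. z i m \<in> \<rat>" "\<And>i m. x $ i < z i m"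
      "\<And>i m. z i m < x $ i + inverse (real (Suc m))" by metis
    have lim: "(\<lambda>m. z i m) \<longlonglongrightarrow> x $ i" for i
    proof (rule tendsto_sandwich[where f = "\<lambda>_. x $ i" and h = "\<lambda>m. x $ i + inverse (real (Suc m))"])
      show "(\<lambda>m. x $ i + inverse (real (Suc m))) \<longlonglongrightarrow> x $ i"
        using tendsto_add[OF tendsto_const LIMSEQ_inverse_real_of_nat] by simp
      show "eventually (\<lambda>m. x $ i \<le> z i m) sequentially" "eventually (\<lambda>m. z i m \<le> x $ i + inverse (real (Suc m))) sequentially"
        using z(2,3) by (auto intro!: always_eventually less_imp_le simp del: of_nat_Suc)
    qed simp
    have le: "\<bar>\<Sum>i<d. \<Sum>j<d. M $$ (i, j) * (z i m * z j m)\<bar> \<le> t * (\<Sum>i<d. z i m * z i m)" for m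
    proof -
      have "(\<lambda>i\<in>{..<d}. z i m) \<in> Pi\<^sub>E {..<d} (\<lambda>_. \<rat>)" using z by auto
      from q[rule_format, OF this] show ?thesis
        unfolding quad_form_eq_sum[OF M vec_carrier vec_carrier] scalar_prod_eq_sum[OF vec_carrier]
        by simp
    qed
    have "(\<lambda>m. \<bar>\<Sum>i<d. \<Sum>j<d. M $$ (i, j) * (z i m * z j m)\<bar>) \<longlonglongrightarrow> \<bar>\<Sum>i<d. \<Sum>j<d. M $$ (i, j) * (x $ i * x $ j)\<bar>"
      "(\<lambda>m. t * (\<Sum>i<d. z i m * z i m)) \<longlonglongrightarrow> t * (\<Sum>i<d. x $ i * x $ i)"
      by (intro tendsto_intros lim)+
    from LIMSEQ_le[OF this] have "\<bar>\<Sum>i<d. \<Sum>j<d. M $$ (i, j) * (x $ i * x $ j)\<bar> \<le> t * (\<Sum>i<d. x $ i * x $ i)"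
      using le by blast
    then show "\<bar>x \<bullet> (M *\<^sub>v x)\<bar> \<le> t"
      using x(2) unfolding quad_form_eq_sum[OF M x(1,1)] scalar_prod_eq_sum[OF x(1)] by simp
  qed
qed

lemma borel_measurable_op_norm:
  assumes d: "d \<ge> 1" and M: "\<And>\<omega>. \<omega> \<in> space N \<Longrightarrow> M \<omega> \<in> carrier_mat d d"
    and ent [measurable]: "\<And>i j. i < d \<Longrightarrow> j < d \<Longrightarrow> (\<lambda>\<omega>. M \<omega> $$ (i, j)) \<in> borel_measurable N"
  shows "(\<lambda>\<omega>. op_norm d (M \<omega>)) \<in> borel_measurable N"
proof (rule borel_measurable_iff_le[THEN iffD2], rule allI)
  fix t :: real
  have cnt: "countable (Pi\<^sub>E {..<d} (\<lambda>_. \<rat> :: real set))"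
    by (intro countable_PiE) (auto simp: countable_rat)
  have pred_q: "Measurable.pred N (\<lambda>\<omega>. \<bar>\<Sum>i<d. \<Sum>j<d. M \<omega> $$ (i, j) * (q i * q j)\<bar> \<le> t * (vec d q \<bullet> vec d q))"
    for q :: "nat \<Rightarrow> real"
  proof -
    have [measurable]: "(\<lambda>\<omega>. \<Sum>i<d. \<Sum>j<d. M \<omega> $$ (i, j) * (q i * q j)) \<in> borel_measurable N"
      by (intro borel_measurable_sum borel_measurable_times ent) auto
    show ?thesis by measurable
  qed
  let ?Q = "Pi\<^sub>E {..<d} (\<lambda>_. \<rat> :: real set)"
  have ne: "?Q \<noteq> {}" by (auto simp: PiE_eq_empty_iff)
  have range: "range (from_nat_into ?Q) = ?Q"
    by (rule range_from_nat_into[OF ne cnt])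
  have "Measurable.pred N (\<lambda>\<omega>. 0 \<le> t \<and> (\<forall>m. \<bar>\<Sum>i<d. \<Sum>j<d. M \<omega> $$ (i, j) *
      (from_nat_into ?Q m i * from_nat_into ?Q m j)\<bar> \<le> t * (vec d (from_nat_into ?Q m) \<bullet> vec d (from_nat_into ?Q m))))"
    by (intro pred_intros_logic pred_intros_countable pred_q) auto
  then have "{\<omega> \<in> space N. 0 \<le> t \<and> (\<forall>m. \<bar>\<Sum>i<d. \<Sum>j<d. M \<omega> $$ (i, j) *
      (from_nat_into ?Q m i * from_nat_into ?Q m j)\<bar> \<le> t * (vec d (from_nat_into ?Q m) \<bullet> vec d (from_nat_into ?Q m)))} \<in> sets N"
    by (simp add: pred_def)
  also have "{\<omega> \<in> space N. 0 \<le> t \<and> (\<forall>m. \<bar>\<Sum>i<d. \<Sum>j<d. M \<omega> $$ (i, j) *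
      (from_nat_into ?Q m i * from_nat_into ?Q m j)\<bar> \<le> t * (vec d (from_nat_into ?Q m) \<bullet> vec d (from_nat_into ?Q m)))}
      = {\<omega> \<in> space N. op_norm d (M \<omega>) \<le> t}"
  proof (rule Collect_cong, rule conj_cong[OF refl])
    fix \<omega> assume "\<omega> \<in> space N"
    then have M\<omega>: "M \<omega> \<in> carrier_mat d d" by (rule M)
    have all: "(\<forall>m. P (from_nat_into ?Q m)) \<longleftrightarrow> (\<forall>q\<in>?Q. P q)" for P
      using range by (metis rangeI imageE)
    show "(0 \<le> t \<and> (\<forall>m. \<bar>\<Sum>i<d. \<Sum>j<d. M \<omega> $$ (i, j) *
      (from_nat_into ?Q m i * from_nat_into ?Q m j)\<bar> \<le> t * (vec d (from_nat_into ?Q m) \<bullet> vec d (from_nat_into ?Q m))))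
      \<longleftrightarrow> op_norm d (M \<omega>) \<le> t"
      unfolding op_norm_le_iff_rational[OF d M\<omega>] quad_form_eq_sum[OF M\<omega> vec_carrier vec_carrier]
        all[of "\<lambda>q. \<bar>\<Sum>i<d. \<Sum>j<d. M \<omega> $$ (i, j) * (q i * q j)\<bar> \<le> t * (vec d q \<bullet> vec d q)"] by simp
  qed
  finally show "{\<omega> \<in> space N. op_norm d (M \<omega>) \<le> t} \<in> sets N" .
qed


section \<open>Testing on a grid\<close>

text \<open>Test vectors with coordinates in the multiples of \<open>1 / d\<^sup>2\<close>. The grid is much larger
than an optimal net of the ball, which has exponentially many points in \<open>d\<close>, but it is trivial to count,
and the tail bounds it is combined with decay like \<open>exp (- c d powr \<delta>)\<close> with
\<open>\<delta> > 1\<close>. The bound 2 on the squared length leaves room for sums of two coordinate vectors.\<close>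
definition grid :: "nat \<Rightarrow> real Matrix.vec set" where
  "grid d = {y \<in> carrier_vec d.
     (\<forall>i<d. \<exists>k::int. \<bar>k\<bar> \<le> int (d\<^sup>2) \<and> y $ i = real_of_int k / real (d\<^sup>2)) \<and> y \<bullet> y \<le> 2}"

lemma grid_subset:
  "grid d \<subseteq> (\<lambda>f. vec d (\<lambda>i. real_of_int (f i) / real (d\<^sup>2))) ` Pi\<^sub>E {..<d} (\<lambda>_. {- int (d\<^sup>2)..int (d\<^sup>2)})"
proof
  fix y assume "y \<in> grid d"
  then have y: "y \<in> carrier_vec d"
    and "\<forall>i<d. \<exists>k::int. \<bar>k\<bar> \<le> int (d\<^sup>2) \<and> y $ i = real_of_int k / real (d\<^sup>2)"
    by (auto simp: grid_def)
  then obtain k :: "nat \<Rightarrow> int" where k: "\<And>i. i < d \<Longrightarrow> \<bar>k i\<bar> \<le> int (d\<^sup>2) \<and> y $ i = real_of_int (k i) / real (d\<^sup>2)"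
    by metis
  have "y = vec d (\<lambda>i. real_of_int (restrict k {..<d} i) / real (d\<^sup>2))"
    using y k by (intro eq_vecI) auto
  moreover have "restrict k {..<d} \<in> Pi\<^sub>E {..<d} (\<lambda>_. {- int (d\<^sup>2)..int (d\<^sup>2)})"
    using k by (auto simp: abs_le_iff minus_le_iff)
  ultimately show "y \<in> (\<lambda>f. vec d (\<lambda>i. real_of_int (f i) / real (d\<^sup>2))) ` Pi\<^sub>E {..<d} (\<lambda>_. {- int (d\<^sup>2)..int (d\<^sup>2)})"
    by blast
qed

lemma finite_grid: "finite (grid d)"
  by (rule finite_subset[OF grid_subset]) (intro finite_imageI finite_PiE, auto)

lemma card_grid: "card (grid d) \<le> (2 * d\<^sup>2 + 1) ^ d"
proof -
  have fin: "finite (Pi\<^sub>E {..<d} (\<lambda>_. {- int (d\<^sup>2)..int (d\<^sup>2)}))"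
    by (intro finite_PiE) auto
  have "card (grid d) \<le> card (Pi\<^sub>E {..<d} (\<lambda>_. {- int (d\<^sup>2)..int (d\<^sup>2)}))"
    by (rule surj_card_le[OF fin grid_subset])
  also have "\<dots> = (2 * d\<^sup>2 + 1) ^ d"
    by (simp add: card_PiE nat_add_distrib nat_mult_distrib nat_power_eq)
  finally show ?thesis .
qed

text \<open>Coordinates are rounded towards zero, so that the squared length does not increase.\<close>
lemma grid_round:
  assumes d: "d \<ge> 1" and x: "x \<in> carrier_vec d" "x \<bullet> x \<le> (1 :: real)"
  obtains y where "y \<in> grid d" "\<And>i. i < d \<Longrightarrow> \<bar>x $ i - y $ i\<bar> \<le> 1 / real (d\<^sup>2)"
    "\<And>i. i < d \<Longrightarrow> \<bar>y $ i\<bar> \<le> 1"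
proof -
  define m where "m = real (d\<^sup>2)"
  have m: "m > 0" using d by (simp add: m_def)
  define k where "k i = (if x $ i \<ge> 0 then \<lfloor>x $ i * m\<rfloor> else \<lceil>x $ i * m\<rceil>)" for i
  have k: "\<bar>real_of_int (k i)\<bar> \<le> \<bar>x $ i\<bar> * m" "\<bar>x $ i * m - real_of_int (k i)\<bar> \<le> 1" for i
  proof -
    show "\<bar>real_of_int (k i)\<bar> \<le> \<bar>x $ i\<bar> * m"
    proof (cases "x $ i \<ge> 0")
      case True
      then have "0 \<le> \<lfloor>x $ i * m\<rfloor>" using m by simp
      then show ?thesis using True by (simp add: k_def)
    next
      case False
      then have "x $ i * m \<le> 0" using m by (simp add: mult_nonpos_nonneg)
      then have "\<lceil>x $ i * m\<rceil> \<le> 0" by simp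
      then have "\<bar>real_of_int (k i)\<bar> = - real_of_int \<lceil>x $ i * m\<rceil>" using False by (simp add: k_def)
      also have "\<dots> \<le> \<bar>x $ i\<bar> * m" using False by simp
      finally show ?thesis .
    qed
    show "\<bar>x $ i * m - real_of_int (k i)\<bar> \<le> 1"
      unfolding k_def by (cases "x $ i \<ge> 0"; simp; linarith)
  qed
  define y where "y = vec d (\<lambda>i. real_of_int (k i) / m)"
  have y: "y \<in> carrier_vec d" by (simp add: y_def)
  have yx: "\<bar>y $ i\<bar> \<le> \<bar>x $ i\<bar>" if "i < d" for i
    using k(1)[of i] m that by (simp add: y_def abs_divide pos_divide_le_eq)
  have x1: "\<bar>x $ i\<bar> \<le> 1" if "i < d" for i
    using unit_vec_coord_le[OF x that] .
  have "y \<bullet> y \<le> x \<bullet> x"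
    unfolding scalar_prod_eq_sum[OF y] scalar_prod_eq_sum[OF x(1)] power2_eq_square[symmetric]
    using yx by (intro sum_mono) (simp add: abs_le_square_iff)
  moreover have "\<exists>k::int. \<bar>k\<bar> \<le> int (d\<^sup>2) \<and> y $ i = real_of_int k / real (d\<^sup>2)" if i: "i < d" for i
  proof (intro exI[of _ "k i"] conjI)
    have "\<bar>real_of_int (k i)\<bar> \<le> 1 * m"
      using k(1)[of i] mult_right_mono[OF x1[OF i], of m] m by linarith
    then show "\<bar>k i\<bar> \<le> int (d\<^sup>2)" unfolding m_def by linarith
    show "y $ i = real_of_int (k i) / real (d\<^sup>2)" using i by (simp add: y_def m_def)
  qed
  ultimately have "y \<in> grid d" using x y by (auto simp: grid_def)
  moreover have "\<bar>x $ i - y $ i\<bar> \<le> 1 / real (d\<^sup>2)" if "i < d" for i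
  proof -
    have "x $ i - y $ i = (x $ i * m - real_of_int (k i)) / m"
      using m that by (simp add: y_def diff_divide_distrib)
    then show ?thesis using divide_right_mono[OF k(2)[of i], of m] m unfolding m_def[symmetric] by simp
  qed
  moreover have "\<bar>y $ i\<bar> \<le> 1" if "i < d" for i using yx[OF that] x1[OF that] by linarith
  ultimately show ?thesis by (rule that)
qed

lemma integral_vec_in_grid:
  assumes d: "d \<ge> 1" and y: "y \<in> carrier_vec d" "\<And>i. i < d \<Longrightarrow> y $ i \<in> {0, 1}" "y \<bullet> y \<le> 2"
  shows "y \<in> grid d"
proof -
  have "\<exists>k::int. \<bar>k\<bar> \<le> int (d\<^sup>2) \<and> y $ i = real_of_int k / real (d\<^sup>2)" if "i < d" for i
    using y(2)[OF that] d by (intro exI[of _ "if y $ i = 0 then 0 else int (d\<^sup>2)"]) auto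
  then show ?thesis using y by (simp add: grid_def)
qed

text \<open>Polarisation: coordinate vectors and sums of two of them belong to the grid.\<close>
lemma grid_entry_bound:
  assumes d: "d \<ge> 1" and S: "symmetric_mat d M"
    and le: "\<And>y. y \<in> grid d \<Longrightarrow> \<bar>y \<bullet> (M *\<^sub>v y)\<bar> \<le> t"
    and ij: "i < d" "j < d"
  shows "\<bar>M $$ (i, j)\<bar> \<le> 3 / 2 * t"
proof -
  have M: "M \<in> carrier_mat d d" using S by (rule symmetric_mat_carrier)
  have unit: "unit_vec d k \<bullet> (M *\<^sub>v unit_vec d l) = M $$ (k, l)" if "k < d" "l < d" for k l
    using M that by (simp add: quad_form_eq_sum[of _ d] unit_vec_def if_distrib[of "\<lambda>x. _ * (x * _)"]
      if_distrib[of "\<lambda>x. _ * x"] cong: if_cong)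
  have e: "unit_vec d k \<in> grid d" if "k < d" for k
    using d that by (intro integral_vec_in_grid) auto
  have diag: "\<bar>M $$ (k, k)\<bar> \<le> t" if "k < d" for k
    using le[OF e[OF that]] unit[OF that that] by simp
  show ?thesis
  proof (cases "i = j")
    case True
    then show ?thesis using diag[OF ij(1)] by simp
  next
    case False
    have "unit_vec d i + 1 \<cdot>\<^sub>v unit_vec d j \<in> grid d"
      using d ij False by (intro integral_vec_in_grid)
        (auto simp: scalar_prod_add_distrib[of _ d] add_scalar_prod_distrib[of _ d])
    from le[OF this] have "\<bar>M $$ (i, i) + 2 * M $$ (j, i) + M $$ (j, j)\<bar> \<le> t"
      using symmetric_mat_form_add[OF S, of "unit_vec d i" "unit_vec d j" 1] ij by (simp add: unit)
    moreover have "M $$ (j, i) = M $$ (i, j)" using S ij by (simp add: symmetric_mat_def)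
    ultimately show ?thesis using diag[OF ij(1)] diag[OF ij(2)] by linarith
  qed
qed

text \<open>Rounding \<open>x\<close> to the grid changes each product of two coordinates by at most
\<open>2 / d\<^sup>2\<close>, and each of the \<open>d\<^sup>2\<close> entries of \<open>M\<close> is at most
\<open>3 t / 2\<close>; the total change is at most \<open>3 t\<close>.\<close>
lemma quad_form_le_of_grid:
  assumes d: "d \<ge> 1" and S: "symmetric_mat d M"
    and le: "\<And>y. y \<in> grid d \<Longrightarrow> \<bar>y \<bullet> (M *\<^sub>v y)\<bar> \<le> t"
    and x: "x \<in> carrier_vec d" "x \<bullet> x = 1"
  shows "\<bar>x \<bullet> (M *\<^sub>v x)\<bar> \<le> 4 * t"
proof -
  have M: "M \<in> carrier_mat d d" using S by (rule symmetric_mat_carrier)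
  from grid_round[OF d x(1)] x(2) obtain y where y: "y \<in> grid d"
    "\<And>i. i < d \<Longrightarrow> \<bar>x $ i - y $ i\<bar> \<le> 1 / real (d\<^sup>2)" "\<And>i. i < d \<Longrightarrow> \<bar>y $ i\<bar> \<le> 1" by auto
  have yc: "y \<in> carrier_vec d" using y(1) by (simp add: grid_def)
  have x1: "\<bar>x $ i\<bar> \<le> 1" if "i < d" for i
    using unit_vec_coord_le[OF x(1) _ that] x(2) by simp
  have "\<bar>x \<bullet> (M *\<^sub>v x) - y \<bullet> (M *\<^sub>v y)\<bar> = \<bar>\<Sum>i<d. \<Sum>j<d. M $$ (i, j) * (x $ i * x $ j - y $ i * y $ j)\<bar>"
    unfolding quad_form_eq_sum[OF M x(1,1)] quad_form_eq_sum[OF M yc yc]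
    by (simp add: sum_subtractf[symmetric] right_diff_distrib)
  also have "\<dots> \<le> (\<Sum>i<d. \<Sum>j<d. \<bar>M $$ (i, j) * (x $ i * x $ j - y $ i * y $ j)\<bar>)"
    by (rule order_trans[OF sum_abs sum_mono[OF sum_abs]])
  also have "\<dots> \<le> (\<Sum>i<d. \<Sum>j<d. 3 / 2 * t * (2 / real (d\<^sup>2)))"
  proof (intro sum_mono)
    fix i j assume "i \<in> {..<d}" "j \<in> {..<d}"
    then have ij: "i < d" "j < d" by auto
    have "x $ i * x $ j - y $ i * y $ j = (x $ i - y $ i) * x $ j + y $ i * (x $ j - y $ j)"
      by (simp add: algebra_simps)
    also have "\<bar>\<dots>\<bar> \<le> \<bar>x $ i - y $ i\<bar> * \<bar>x $ j\<bar> + \<bar>y $ i\<bar> * \<bar>x $ j - y $ j\<bar>"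
      by (simp add: abs_mult[symmetric])
    also have "\<dots> \<le> 1 / real (d\<^sup>2) * 1 + 1 * (1 / real (d\<^sup>2))"
      using y(2,3) x1 ij by (intro add_mono mult_mono) auto
    finally have "\<bar>x $ i * x $ j - y $ i * y $ j\<bar> \<le> 2 / real (d\<^sup>2)" by simp
    then show "\<bar>M $$ (i, j) * (x $ i * x $ j - y $ i * y $ j)\<bar> \<le> 3 / 2 * t * (2 / real (d\<^sup>2))"
      unfolding abs_mult using grid_entry_bound[OF d S le ij] by (intro mult_mono) auto
  qed
  also have "\<dots> = 3 * t" using d by (simp add: power2_eq_square)
  finally show ?thesis using le[OF y(1)] by linarith
qed

section \<open>Chernoff bounds\<close>

lemma exp_le_quadratic:
  fixes u :: real assumes "0 \<le> u"
  shows "exp u \<le> 1 + u + u\<^sup>2 * exp u"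
proof -
  have e: "1 - u \<le> exp (- u)" using exp_ge_add_one_self[of "- u"] by simp
  have "(1 - u) * exp u \<le> exp (- u) * exp u"
    by (rule mult_right_mono[OF e]) simp
  then have 1: "exp u - 1 \<le> u * exp u" by (simp add: exp_minus algebra_simps)
  have "exp u - 1 - u \<le> u * (exp u - 1)" using 1 by (simp add: algebra_simps)
  also have "\<dots> \<le> u * (u * exp u)" by (rule mult_left_mono[OF 1 assms])
  finally show ?thesis by (simp add: power2_eq_square)
qed

lemma exp_minus_le_quadratic:
  fixes u :: real assumes "0 \<le> u"
  shows "exp (- u) + u \<le> 1 + u\<^sup>2"
proof -
  have "u * (1 - u) \<le> u * exp (- u)"
    using exp_ge_add_one_self[of "- u"] assms by (intro mult_left_mono) auto
  moreover have "(1 + u) * exp (- u) \<le> exp u * exp (- u)"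
    by (rule mult_right_mono) (auto simp: exp_ge_add_one_self)
  then have "(1 + u) * exp (- u) \<le> 1" by (simp add: exp_minus)
  ultimately show ?thesis by (simp add: power2_eq_square algebra_simps)
qed

context prob_space
begin

text \<open>Markov's inequality for \<open>exp (s * sum)\<close>, whose mean factorises by independence and is at most
\<open>(1 + c) ^ n \<le> exp (n c)\<close>.\<close>
lemma chernoff_one_sided:
  fixes Z :: "nat \<Rightarrow> 'a \<Rightarrow> real"
  assumes indep: "indep_vars (\<lambda>_. borel) Z {1..n}"
    and mgf: "\<And>i. i \<in> {1..n} \<Longrightarrow> (\<integral>\<^sup>+\<omega>. ennreal (exp (s * Z i \<omega>)) \<partial>M) \<le> ennreal (1 + c)"
  shows "emeasure M {\<omega> \<in> space M. a \<le> s * (\<Sum>i=1..n. Z i \<omega>)} \<le> ennreal (exp (- a + real n * c))"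
proof -
  have [measurable]: "i \<in> {1..n} \<Longrightarrow> Z i \<in> borel_measurable M" for i
    using indep by (auto simp: indep_vars_def)
  have sum_meas: "(\<lambda>\<omega>. \<Sum>i=1..n. Z i \<omega>) \<in> borel_measurable M"
    by (intro borel_measurable_sum) auto
  have indep': "indep_vars (\<lambda>_. borel) (\<lambda>i \<omega>. ennreal (exp (s * Z i \<omega>))) {1..n}"
    by (rule indep_vars_compose2[OF indep]) measurable
  have "emeasure M {\<omega> \<in> space M. a \<le> s * (\<Sum>i=1..n. Z i \<omega>)}
      \<le> ennreal (exp (- a)) * (\<integral>\<^sup>+\<omega>. ennreal (exp (s * (\<Sum>i=1..n. Z i \<omega>))) * indicator (space M) \<omega> \<partial>M)"
  proof (rule order_trans[OF _ nn_integral_Markov_inequality])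
    have "1 \<le> ennreal (exp (- a)) * ennreal (exp (s * x))" if "a \<le> s * x" for x
      using that by (simp add: ennreal_mult'[symmetric] exp_add[symmetric] ennreal_ge_1)
    then show "emeasure M {\<omega> \<in> space M. a \<le> s * (\<Sum>i=1..n. Z i \<omega>)}
      \<le> emeasure M {\<omega> \<in> space M. 1 \<le> ennreal (exp (- a)) * ennreal (exp (s * (\<Sum>i=1..n. Z i \<omega>)))}"
      using sum_meas by (intro emeasure_mono) (auto, measurable)
  qed (use sum_meas in measurable)
  also have "(\<integral>\<^sup>+\<omega>. ennreal (exp (s * (\<Sum>i=1..n. Z i \<omega>))) * indicator (space M) \<omega> \<partial>M)
      = (\<integral>\<^sup>+\<omega>. (\<Prod>i=1..n. ennreal (exp (s * Z i \<omega>))) \<partial>M)"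
    by (intro nn_integral_cong) (simp add: prod_ennreal exp_sum sum_distrib_left)
  also have "\<dots> = (\<Prod>i=1..n. \<integral>\<^sup>+\<omega>. ennreal (exp (s * Z i \<omega>)) \<partial>M)"
    by (rule indep_vars_nn_integral[OF _ indep']) auto
  also have "\<dots> \<le> (\<Prod>i=1..n. ennreal (exp c))"
    by (intro prod_mono_ennreal order_trans[OF mgf] ennreal_leI exp_ge_add_one_self)
  also have "\<dots> = ennreal (exp (real n * c))"
    by (simp add: ennreal_power exp_of_nat_mult)
  finally have "emeasure M {\<omega> \<in> space M. a \<le> s * (\<Sum>i=1..n. Z i \<omega>)} \<le> ennreal (exp (- a)) * ennreal (exp (real n * c))"
    by (simp add: mult_left_mono)
  then show ?thesis by (simp only: exp_add ennreal_mult'[symmetric] exp_ge_zero)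
qed

lemma chernoff_two_sided:
  fixes Z :: "nat \<Rightarrow> 'a \<Rightarrow> real"
  assumes indep: "indep_vars (\<lambda>_. borel) Z {1..n}" and s: "s > 0"
    and up: "\<And>i. i \<in> {1..n} \<Longrightarrow> (\<integral>\<^sup>+\<omega>. ennreal (exp (s * Z i \<omega>)) \<partial>M) \<le> ennreal (1 + (s * m + B))"
    and lo: "\<And>i. i \<in> {1..n} \<Longrightarrow> (\<integral>\<^sup>+\<omega>. ennreal (exp (- s * Z i \<omega>)) \<partial>M) \<le> ennreal (1 + (- s * m + B))"
  shows "measure M {\<omega> \<in> space M. real n * t \<le> \<bar>(\<Sum>i=1..n. Z i \<omega>) - real n * m\<bar>} \<le> 2 * exp (- real n * (s * t - B))"
proof -
  have [measurable]: "i \<in> {1..n} \<Longrightarrow> Z i \<in> borel_measurable M" for i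
    using indep by (auto simp: indep_vars_def)
  have [measurable]: "(\<lambda>\<omega>. \<Sum>i=1..n. Z i \<omega>) \<in> borel_measurable M"
    by (intro borel_measurable_sum) auto
  let ?U = "{\<omega> \<in> space M. s * real n * (m + t) \<le> s * (\<Sum>i=1..n. Z i \<omega>)}"
  let ?L = "{\<omega> \<in> space M. - s * real n * (m - t) \<le> - s * (\<Sum>i=1..n. Z i \<omega>)}"
  have "emeasure M ?U \<le> ennreal (exp (- (s * real n * (m + t)) + real n * (s * m + B)))"
    by (rule chernoff_one_sided[OF indep up])
  then have U: "measure M ?U \<le> exp (- real n * (s * t - B))"
    by (simp add: emeasure_eq_measure algebra_simps)
  have "emeasure M ?L \<le> ennreal (exp (- (- s * real n * (m - t)) + real n * (- s * m + B)))"
    by (rule chernoff_one_sided[OF indep lo])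
  then have L: "measure M ?L \<le> exp (- real n * (s * t - B))"
    by (simp add: emeasure_eq_measure algebra_simps)
  have "{\<omega> \<in> space M. real n * t \<le> \<bar>(\<Sum>i=1..n. Z i \<omega>) - real n * m\<bar>} \<subseteq> ?U \<union> ?L"
  proof (intro subsetI)
    fix \<omega> assume "\<omega> \<in> {\<omega> \<in> space M. real n * t \<le> \<bar>(\<Sum>i=1..n. Z i \<omega>) - real n * m\<bar>}"
    then have \<omega>: "\<omega> \<in> space M" and "real n * (m + t) \<le> (\<Sum>i=1..n. Z i \<omega>) \<or> (\<Sum>i=1..n. Z i \<omega>) \<le> real n * (m - t)"
      by (auto simp: abs_if algebra_simps split: if_splits)
    then have "s * (real n * (m + t)) \<le> s * (\<Sum>i=1..n. Z i \<omega>) \<or> s * (\<Sum>i=1..n. Z i \<omega>) \<le> s * (real n * (m - t))"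
      using s by simp
    then show "\<omega> \<in> ?U \<union> ?L" using \<omega> by (simp add: mult.assoc)
  qed
  then have "measure M {\<omega> \<in> space M. real n * t \<le> \<bar>(\<Sum>i=1..n. Z i \<omega>) - real n * m\<bar>} \<le> measure M (?U \<union> ?L)"
    by (intro finite_measure_mono) measurable
  also have "\<dots> \<le> measure M ?U + measure M ?L"
    by (intro measure_Un_le) measurable
  finally show ?thesis using U L by simp
qed

end


section \<open>Dimension-free bounds for the likelihood ratio\<close>

text \<open>Expand the squared length of the difference between \<open>y\<close> and its projection
\<open>\<Sum>k\<in>K. (v k \<bullet> y) v k\<close>.\<close>
lemma bessel:
  assumes "finite K" and v: "\<And>k. k \<in> K \<Longrightarrow> v k \<in> carrier_vec d"
    and on: "\<And>j k. j \<in> K \<Longrightarrow> k \<in> K \<Longrightarrow> v j \<bullet> v k = (if j = k then 1 else 0)"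
    and y: "y \<in> carrier_vec d"
  shows "(\<Sum>k\<in>K. (v k \<bullet> y)\<^sup>2) \<le> y \<bullet> (y :: real Matrix.vec)"
proof -
  (* coordinates of the projection of y *)
  define c where "c i = (\<Sum>k\<in>K. (v k \<bullet> y) * v k $ i)" for i
  have yc: "(\<Sum>i<d. y $ i * c i) = (\<Sum>k\<in>K. (v k \<bullet> y)\<^sup>2)"
  proof -
    have "(\<Sum>i<d. y $ i * c i) = (\<Sum>i<d. \<Sum>k\<in>K. (v k \<bullet> y) * (v k $ i * y $ i))"
      unfolding c_def sum_distrib_left by (intro sum.cong refl) (simp add: algebra_simps)
    also have "\<dots> = (\<Sum>k\<in>K. \<Sum>i<d. (v k \<bullet> y) * (v k $ i * y $ i))" by (rule sum.swap)
    also have "\<dots> = (\<Sum>k\<in>K. (v k \<bullet> y)\<^sup>2)"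
      by (simp add: sum_distrib_left[symmetric] scalar_prod_eq_sum[OF y] power2_eq_square)
    finally show ?thesis .
  qed
  have vc: "(\<Sum>i<d. v k $ i * c i) = v k \<bullet> y" if k: "k \<in> K" for k
  proof -
    have "(\<Sum>i<d. v k $ i * c i) = (\<Sum>i<d. \<Sum>j\<in>K. (v j \<bullet> y) * (v k $ i * v j $ i))"
      unfolding c_def sum_distrib_left by (intro sum.cong refl) (simp add: algebra_simps)
    also have "\<dots> = (\<Sum>j\<in>K. \<Sum>i<d. (v j \<bullet> y) * (v k $ i * v j $ i))" by (rule sum.swap)
    also have "\<dots> = (\<Sum>j\<in>K. (v j \<bullet> y) * (v k \<bullet> v j))"
      by (intro sum.cong refl) (simp add: sum_distrib_left[symmetric] scalar_prod_eq_sum[OF v])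
    also have "\<dots> = (\<Sum>j\<in>K. if j = k then v j \<bullet> y else 0)"
      using k by (intro sum.cong refl) (auto simp: on)
    finally show ?thesis using k assms(1) by simp
  qed
  have cc: "(\<Sum>i<d. c i * c i) = (\<Sum>k\<in>K. (v k \<bullet> y)\<^sup>2)"
  proof -
    have "(\<Sum>i<d. c i * c i) = (\<Sum>i<d. \<Sum>k\<in>K. (v k \<bullet> y) * (v k $ i * c i))"
      by (intro sum.cong refl, subst (1) c_def) (simp add: sum_distrib_right mult.assoc)
    also have "\<dots> = (\<Sum>k\<in>K. \<Sum>i<d. (v k \<bullet> y) * (v k $ i * c i))" by (rule sum.swap)
    also have "\<dots> = (\<Sum>k\<in>K. (v k \<bullet> y)\<^sup>2)"
      by (intro sum.cong refl) (simp add: sum_distrib_left[symmetric] vc power2_eq_square)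
    finally show ?thesis .
  qed
  have "0 \<le> (\<Sum>i<d. (y $ i - c i)\<^sup>2)" by (intro sum_nonneg) simp
  also have "\<dots> = (\<Sum>i<d. y $ i * y $ i + c i * c i - 2 * (y $ i * c i))"
    by (intro sum.cong refl) (simp add: power2_eq_square algebra_simps)
  also have "\<dots> = y \<bullet> y + (\<Sum>k\<in>K. (v k \<bullet> y)\<^sup>2) - 2 * (\<Sum>k\<in>K. (v k \<bullet> y)\<^sup>2)"
    by (simp add: sum.distrib sum_subtractf sum_distrib_left[symmetric] cc yc scalar_prod_eq_sum[OF y])
  finally show ?thesis by simp
qed

lemma nn_integral_ennreal_mult_left:
  assumes "F \<in> borel_measurable M" "0 \<le> c" "(\<integral>\<^sup>+y. ennreal (F y) \<partial>M) \<le> ennreal b"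
  shows "(\<integral>\<^sup>+y. ennreal (c * F y) \<partial>M) \<le> ennreal (c * b)"
proof -
  have "(\<integral>\<^sup>+y. ennreal (c * F y) \<partial>M) = ennreal c * (\<integral>\<^sup>+y. ennreal (F y) \<partial>M)"
    using assms(1,2) by (simp add: ennreal_mult' nn_integral_cmult)
  also have "\<dots> \<le> ennreal c * ennreal b" by (rule mult_left_mono[OF assms(3)]) simp
  finally show ?thesis using assms(2) by (simp add: ennreal_mult')
qed

lemma std_gauss_exp_square_le:
  assumes "u \<in> carrier_vec d" "u \<bullet> u \<le> 2"
  shows "(\<integral>\<^sup>+y. ennreal (exp ((u \<bullet> y)\<^sup>2 / 8)) \<partial>std_gauss d) \<le> ennreal 2"
proof -
  have "(\<integral>\<^sup>+y. ennreal (exp ((1 / 4) / 2 * (u \<bullet> y)\<^sup>2)) \<partial>std_gauss d) = ennreal (1 / sqrt (1 - 1 / 4 * (u \<bullet> u)))"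
    using assms by (intro std_gauss_exp_square) auto
  also have "\<dots> \<le> ennreal 2"
  proof (rule ennreal_leI)
    have "sqrt (1 / 4) \<le> sqrt (1 - 1 / 4 * (u \<bullet> u))" using assms(2) by (intro real_sqrt_le_mono) auto
    then have "1 / 2 \<le> sqrt (1 - 1 / 4 * (u \<bullet> u))" by (simp add: real_sqrt_divide)
    with assms(2) have "1 / sqrt (1 - 1 / 4 * (u \<bullet> u)) \<le> 1 / (1 / 2)"
      by (intro divide_left_mono mult_pos_pos) auto
    then show "1 / sqrt (1 - 1 / 4 * (u \<bullet> u)) \<le> 2" by simp
  qed
  finally show ?thesis by simp
qed

text \<open>The weight \<open>exp ((u \<bullet> y)\<^sup>2 / 16)\<close> is the room needed for the remainder of a
second-order expansion of an exponential moment.\<close>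
lemma std_gauss_fourth_moment:
  assumes "u \<in> carrier_vec d" "u \<bullet> u \<le> 2"
  shows "(\<integral>\<^sup>+y. ennreal (((u \<bullet> y)\<^sup>2)\<^sup>2 * exp ((u \<bullet> y)\<^sup>2 / 16)) \<partial>std_gauss d) \<le> ennreal 1024"
proof -
  have bound: "x\<^sup>2 * exp (x / 16) \<le> 512 * exp (x / 8)" if "0 \<le> x" for x :: real
  proof -
    have "1 + x / 16 + (x / 16)\<^sup>2 / 2 \<le> exp (x / 16)"
      using exp_lower_Taylor_quadratic[of "x / 16"] that by simp
    then have "x\<^sup>2 \<le> 512 * exp (x / 16)" using that by (simp add: power2_eq_square)
    then have "x\<^sup>2 * exp (x / 16) \<le> 512 * exp (x / 16) * exp (x / 16)" by (intro mult_right_mono) auto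
    also have "\<dots> = 512 * exp (x / 8)" by (simp add: exp_add[symmetric])
    finally show ?thesis .
  qed
  have "(\<integral>\<^sup>+y. ennreal (((u \<bullet> y)\<^sup>2)\<^sup>2 * exp ((u \<bullet> y)\<^sup>2 / 16)) \<partial>std_gauss d)
      \<le> (\<integral>\<^sup>+y. ennreal (512 * exp ((u \<bullet> y)\<^sup>2 / 8)) \<partial>std_gauss d)"
    by (intro nn_integral_mono ennreal_leI bound zero_le_power2)
  also have "\<dots> \<le> ennreal (512 * 2)"
    by (rule nn_integral_ennreal_mult_left[OF _ _ std_gauss_exp_square_le[OF assms]]) auto
  finally show ?thesis by simp
qed

lemma sets_std_gauss_Collect:
  assumes "{y \<in> space (vec_borel d). P y} \<in> sets (vec_borel d)"
  shows "{y \<in> carrier_vec d. P y} \<in> sets (std_gauss d)"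
  using assms by (simp add: sets_gauss_law)

context spiked
begin

lemma inverse_lam_le: "k \<in> {1..r} \<Longrightarrow> 1 / lam k - 1 \<le> 1 / lam1 - 1"
  using lam_lower lam1 by (intro diff_right_mono divide_left_mono mult_pos_pos lam_pos) auto

text \<open>Evaluate the quadratic form of \<open>S\<close> at \<open>v k\<close>.\<close>
lemma lam_le_lambda_max:
  assumes d: "d \<ge> 1" and k: "k \<in> {1..r}"
  shows "lam k \<le> lambda_max S"
proof -
  have "symmetric_mat d S"
    unfolding symmetric_mat_def using S_carrier
    by (auto simp: S_def spiked_cov_def outer_def mult_ac)
  from lambda_max_ge[OF d this v_carrier[OF k]] show ?thesis
    unfolding spike_cov[OF k v_carrier[OF k]] by (simp add: orthonormal[OF k k])
qed

definition spike_sq :: "real Matrix.vec \<Rightarrow> real" where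
  "spike_sq y = (\<Sum>k=1..r. (v k \<bullet> y)\<^sup>2)"

lemma spike_sq_nonneg: "0 \<le> spike_sq y"
  by (simp add: spike_sq_def sum_nonneg)

lemma measurable_spike_sq [measurable]: "spike_sq \<in> borel_measurable (vec_borel d)"
  unfolding spike_sq_def by measurable

lemma spike_sq_le: "y \<in> carrier_vec d \<Longrightarrow> spike_sq y \<le> y \<bullet> y"
  unfolding spike_sq_def by (rule bessel) (auto simp: v_carrier orthonormal)

lemma spike_form_upper: "spike_form y \<le> (1 / lam1 - 1) * spike_sq y"
  unfolding spike_form_def spike_sq_def sum_distrib_left
  by (intro sum_mono mult_right_mono inverse_lam_le) auto

lemma spike_form_lower: "- (1 - 1 / L) * spike_sq y \<le> spike_form y"
  unfolding spike_form_def spike_sq_def sum_distrib_left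
proof (intro sum_mono mult_right_mono)
  fix k assume k: "k \<in> {1..r}"
  then have "1 / L \<le> 1 / lam k" using lam_upper[OF k] L by (intro divide_left_mono mult_pos_pos lam_pos) auto
  then show "- (1 - 1 / L) \<le> 1 / lam k - 1" by simp
qed simp

lemma exp_spike_sq:
  assumes "0 \<le> a" "a < 1"
  shows "(\<integral>\<^sup>+y. ennreal (exp (a / 2 * spike_sq y)) \<partial>std_gauss d) \<le> ennreal ((1 / sqrt (1 - a)) ^ R)"
proof -
  have "(\<integral>\<^sup>+y. ennreal (exp (a / 2 * spike_sq y)) \<partial>std_gauss d) = ennreal ((1 / sqrt (1 - a)) ^ card {1..r})"
    unfolding spike_sq_def using assms v_carrier orthonormal by (intro std_gauss_exp_orthonormal) auto
  also have "\<dots> \<le> ennreal ((1 / sqrt (1 - a)) ^ R)"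
    using assms rank by (intro ennreal_leI power_increasing) (auto simp: le_divide_eq)
  finally show ?thesis .
qed

lemma spike_sq_tail:
  "emeasure (std_gauss d) {y \<in> carrier_vec d. b \<le> spike_sq y} \<le> ennreal (exp (- b / 4) * sqrt 2 ^ R)"
proof -
  have "emeasure (std_gauss d) {y \<in> carrier_vec d. b \<le> spike_sq y}
      = (\<integral>\<^sup>+y. indicator {y \<in> carrier_vec d. b \<le> spike_sq y} y \<partial>std_gauss d)"
    by (rule nn_integral_indicator[OF sets_std_gauss_Collect, symmetric]) measurable
  also have "\<dots> \<le> (\<integral>\<^sup>+y. ennreal (exp (- b / 4) * exp ((1 / 2) / 2 * spike_sq y)) \<partial>std_gauss d)"
    by (intro nn_integral_mono) (auto simp: indicator_def exp_add[symmetric] ennreal_ge_1)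
  also have "\<dots> \<le> ennreal (exp (- b / 4) * (1 / sqrt (1 - 1 / 2)) ^ R)"
    by (rule nn_integral_ennreal_mult_left[OF _ _ exp_spike_sq]) auto
  also have "1 / sqrt (1 - 1 / 2 :: real) = sqrt 2" by (simp add: real_sqrt_divide)
  finally show ?thesis .
qed

text \<open>Bounds on the normalising constant that depend on the rank and eigenvalue bounds only.\<close>
definition scale_ub :: real where "scale_ub = sqrt L ^ R"
definition scale_lb :: real where "scale_lb = exp (- (1 / lam1 - 1) * (2 * real R + 2)) / 2"

lemma scale_lb_pos: "0 < scale_lb"
  by (simp add: scale_lb_def)

lemma scale_ub_pos: "0 < scale_ub"
  using L by (simp add: scale_ub_def)

text \<open>Total mass 1 of \<open>N(0, S)\<close> determines the normalising constant as a Gaussian integral, which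
can be bounded from both sides.\<close>
lemma scale_eq: "(\<integral>\<^sup>+y. ennreal (exp (- spike_form y / 2)) \<partial>std_gauss d) = ennreal scale"
proof -
  have "(\<integral>\<^sup>+y. ennreal (exp (- spike_form y / 2)) \<partial>std_gauss d)
      = (\<integral>\<^sup>+y. ennreal scale * ennreal (1 / lik_ratio d S y) \<partial>std_gauss d)"
    using scale_pos
    by (intro nn_integral_cong) (simp add: lik_ratio_eq ennreal_mult'[symmetric] exp_minus field_simps)
  also have "\<dots> = ennreal scale"
    by (subst nn_integral_cmult) (auto simp: nn_integral_inverse_lik_ratio)
  finally show ?thesis .
qed

lemma scale_upper: "scale \<le> scale_ub"
proof -
  have "ennreal scale \<le> (\<integral>\<^sup>+y. ennreal (exp ((1 - 1 / L) / 2 * spike_sq y)) \<partial>std_gauss d)"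
    unfolding scale_eq[symmetric]
  proof (intro nn_integral_mono ennreal_leI)
    fix y show "exp (- spike_form y / 2) \<le> exp ((1 - 1 / L) / 2 * spike_sq y)"
      using spike_form_lower[of y] by (simp add: field_simps)
  qed
  also have "\<dots> \<le> ennreal ((1 / sqrt (1 - (1 - 1 / L))) ^ R)"
    using L by (intro exp_spike_sq) auto
  also have "(1 / sqrt (1 - (1 - 1 / L))) ^ R = scale_ub"
    using L by (simp add: scale_ub_def real_sqrt_divide)
  finally show ?thesis using scale_ub_pos by simp
qed

text \<open>With probability at least 1/2 the spike coordinates are bounded by a constant depending on
\<open>R\<close>, and there \<open>exp (- spike_form / 2)\<close> is bounded below.\<close>
lemma scale_lower: "scale_lb \<le> scale"
proof -
  interpret G: prob_space "std_gauss d" by (rule prob_space_std_gauss)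
  (* large enough for sqrt 2 ^ R * exp (- b / 4) \<le> 1 / 2 *)
  define b where "b = 4 * real R + 4"
  let ?T = "{y \<in> carrier_vec d. b \<le> spike_sq y}"
  have T: "?T \<in> sets (std_gauss d)" by (rule sets_std_gauss_Collect) measurable
  have "exp (- b / 4) * sqrt 2 ^ R \<le> 1 / 2"
  proof -
    have "sqrt 2 \<le> (2::real)" using real_sqrt_le_mono[of 2 "4::real"] by simp
    also have "(2::real) \<le> exp 1" using exp_ge_add_one_self[of 1] by simp
    finally have "sqrt 2 ^ R \<le> exp 1 ^ R" by (intro power_mono) auto
    also have "exp 1 ^ R = exp (real R)" by (simp add: exp_of_nat_mult[symmetric])
    finally have "exp (- b / 4) * sqrt 2 ^ R \<le> exp (- b / 4) * exp (real R)" by (intro mult_left_mono) auto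
    also have "\<dots> = exp (- 1)" by (simp add: exp_add[symmetric] b_def field_simps)
    also have "\<dots> \<le> 1 / 2" using exp_ge_add_one_self[of 1] by (simp add: exp_minus field_simps)
    finally show ?thesis .
  qed
  then have "emeasure (std_gauss d) ?T \<le> ennreal (1 / 2)"
    by (intro order_trans[OF spike_sq_tail] ennreal_leI)
  then have "G.prob ?T \<le> 1 / 2"
    unfolding G.emeasure_eq_measure by (subst (asm) ennreal_le_iff) auto
  then have half: "1 / 2 \<le> G.prob (carrier_vec d - ?T)"
    using G.prob_compl[OF T] by simp
  have "ennreal (exp (- (1 / lam1 - 1) * (b / 2)) * (1 / 2))
      \<le> ennreal (exp (- (1 / lam1 - 1) * (b / 2))) * emeasure (std_gauss d) (carrier_vec d - ?T)"
    using half by (simp only: G.emeasure_eq_measure ennreal_mult'[symmetric] exp_ge_zero) (intro ennreal_leI mult_left_mono, auto)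
  also have "\<dots> = (\<integral>\<^sup>+y. ennreal (exp (- (1 / lam1 - 1) * (b / 2))) * indicator (carrier_vec d - ?T) y \<partial>std_gauss d)"
    using sets.compl_sets[OF T] by (subst nn_integral_cmult_indicator) auto
  also have "\<dots> \<le> (\<integral>\<^sup>+y. ennreal (exp (- spike_form y / 2)) \<partial>std_gauss d)"
  proof (intro nn_integral_mono)
    fix y
    show "ennreal (exp (- (1 / lam1 - 1) * (b / 2))) * indicator (carrier_vec d - ?T) y \<le> ennreal (exp (- spike_form y / 2))"
    proof (cases "y \<in> carrier_vec d - ?T")
      case True
      have "spike_form y \<le> (1 / lam1 - 1) * b"
      proof (rule order_trans[OF spike_form_upper mult_left_mono])
        show "spike_sq y \<le> b" using True by auto
        show "0 \<le> 1 / lam1 - 1" using lam1 by simp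
      qed
      then have "exp (- (1 / lam1 - 1) * (b / 2)) \<le> exp (- spike_form y / 2)" by (simp add: field_simps)
      with True show ?thesis by (simp only: indicator_simps mult_1_right) (rule ennreal_leI)
    qed simp
  qed
  finally have "exp (- (1 / lam1 - 1) * (b / 2)) * (1 / 2) \<le> scale"
    unfolding scale_eq using scale_pos by (simp del: mult_minus_left)
  moreover have "b / 2 = 2 * real R + 2" by (simp add: b_def)
  ultimately show ?thesis by (simp add: scale_lb_def)
qed

definition moment_bound :: "real \<Rightarrow> real" where
  "moment_bound \<eta> = scale_ub powr \<eta> * (1 / sqrt (1 - \<eta> * (1 / lam1 - 1))) ^ R"

text \<open>The exponent of \<open>lik_ratio powr \<eta>\<close> is at most \<open>\<eta> (1 / lam1 - 1) / 2\<close>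
times the sum of squares of the spike coordinates, and the exponential moment of that sum is finite when the
coefficient is below 1/2. This range of \<open>\<eta>\<close> is where the critical exponent \<open>1 - lam1\<close>
comes from.\<close>
lemma moment_lik_ratio:
  assumes \<eta>: "0 \<le> \<eta>" "\<eta> * (1 / lam1 - 1) < 1"
  shows "(\<integral>\<^sup>+y. ennreal (lik_ratio d S y powr \<eta>) \<partial>std_gauss d) \<le> ennreal (moment_bound \<eta>)"
proof -
  have "(\<integral>\<^sup>+y. ennreal (lik_ratio d S y powr \<eta>) \<partial>std_gauss d)
      \<le> (\<integral>\<^sup>+y. ennreal (scale_ub powr \<eta> * exp (\<eta> * (1 / lam1 - 1) / 2 * spike_sq y)) \<partial>std_gauss d)"
  proof (intro nn_integral_mono ennreal_leI)
    fix y assume "y \<in> space (std_gauss d)"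
    then have "lik_ratio d S y powr \<eta> = scale powr \<eta> * exp (\<eta> * spike_form y / 2)"
      using scale_pos by (simp add: lik_ratio_eq powr_mult exp_powr_real mult.commute)
    also have "\<dots> \<le> scale_ub powr \<eta> * exp (\<eta> * (1 / lam1 - 1) / 2 * spike_sq y)"
    proof (intro mult_mono powr_mono2 \<eta> scale_upper)
      have "\<eta> * spike_form y \<le> \<eta> * ((1 / lam1 - 1) * spike_sq y)"
        by (intro mult_left_mono spike_form_upper \<eta>)
      then show "exp (\<eta> * spike_form y / 2) \<le> exp (\<eta> * (1 / lam1 - 1) / 2 * spike_sq y)"
        by (simp add: mult.assoc)
    qed (use scale_pos in auto)
    finally show "lik_ratio d S y powr \<eta> \<le> scale_ub powr \<eta> * exp (\<eta> * (1 / lam1 - 1) / 2 * spike_sq y)" .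
  qed
  also have "\<dots> \<le> ennreal (scale_ub powr \<eta> * (1 / sqrt (1 - \<eta> * (1 / lam1 - 1))) ^ R)"
    using \<eta> lam1 by (intro nn_integral_ennreal_mult_left exp_spike_sq) auto
  finally show ?thesis by (simp add: moment_bound_def)
qed

end


context spiked
begin

context
  fixes M :: "'w measure" and X :: "'w \<Rightarrow> real Matrix.vec"
  assumes prob: "prob_space M"
    and dist: "distributed M (vec_lborel d) X (\<lambda>x. ennreal (gauss_density d (0\<^sub>v d) S x))"
begin

lemma sample_measurable: "X \<in> M \<rightarrow>\<^sub>M vec_borel d"
  using distributed_measurable[OF dist] by (simp cong: measurable_cong_sets add: sets_vec_lborel)

lemma sample_carrier: "\<omega> \<in> space M \<Longrightarrow> X \<omega> \<in> carrier_vec d"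
  using measurable_space[OF sample_measurable] by simp

lemma sample_law:
  assumes F [measurable]: "F \<in> borel_measurable (vec_borel d)"
  shows "(\<integral>\<^sup>+\<omega>. F (X \<omega>) \<partial>M) = (\<integral>\<^sup>+y. ennreal (1 / lik_ratio d S y) * F y \<partial>std_gauss d)"
proof -
  have "(\<integral>\<^sup>+\<omega>. F (X \<omega>) \<partial>M) = (\<integral>\<^sup>+y. ennreal (gauss_density d (0\<^sub>v d) S y) * F y \<partial>vec_lborel d)"
    by (rule distributed_nn_integral[OF dist, symmetric]) (simp cong: measurable_cong_sets add: sets_vec_lborel F)
  then show ?thesis by (simp add: nn_integral_change_of_law)
qed

text \<open>The identity behind importance sampling: a factor of the likelihood ratio turns the law of the sample into
the standard Gaussian law.\<close>
lemma sample_law_weighted: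
  assumes F [measurable]: "F \<in> borel_measurable (vec_borel d)"
  shows "(\<integral>\<^sup>+\<omega>. ennreal (lik_ratio d S (X \<omega>)) * F (X \<omega>) \<partial>M) = (\<integral>\<^sup>+y. F y \<partial>std_gauss d)"
proof -
  have "(\<integral>\<^sup>+\<omega>. ennreal (lik_ratio d S (X \<omega>)) * F (X \<omega>) \<partial>M)
      = (\<integral>\<^sup>+y. ennreal (1 / lik_ratio d S y) * (ennreal (lik_ratio d S y) * F y) \<partial>std_gauss d)"
    by (rule sample_law) measurable
  also have "\<dots> = (\<integral>\<^sup>+y. F y \<partial>std_gauss d)"
  proof (intro nn_integral_cong)
    fix y assume "y \<in> space (std_gauss d)"
    then have l: "0 < lik_ratio d S y" by (simp add: lik_ratio_pos)
    then show "ennreal (1 / lik_ratio d S y) * (ennreal (lik_ratio d S y) * F y) = F y"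
      by (simp add: mult.assoc[symmetric] ennreal_mult'[symmetric])
  qed
  finally show ?thesis .
qed

text \<open>Markov's inequality for the moment of order \<open>1 + \<eta>\<close>; one factor of the likelihood ratio
is absorbed by the change of measure.\<close>
lemma sample_tail:
  assumes N: "0 < N" and \<eta>: "0 \<le> \<eta>" "\<eta> * (1 / lam1 - 1) < 1"
  shows "measure M {\<omega> \<in> space M. N \<le> lik_ratio d S (X \<omega>)} \<le> N powr - (1 + \<eta>) * moment_bound \<eta>"
proof -
  interpret prob_space M by (rule prob)
  note [measurable] = sample_measurable
  have "emeasure M {\<omega> \<in> space M. N \<le> lik_ratio d S (X \<omega>)} = (\<integral>\<^sup>+\<omega>. indicator {\<omega> \<in> space M. N \<le> lik_ratio d S (X \<omega>)} \<omega> \<partial>M)"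
    by (rule nn_integral_indicator[symmetric]) measurable
  also have "\<dots> \<le> (\<integral>\<^sup>+\<omega>. ennreal (lik_ratio d S (X \<omega>)) * ennreal (N powr - (1 + \<eta>) * lik_ratio d S (X \<omega>) powr \<eta>) \<partial>M)"
  proof (intro nn_integral_mono)
    fix \<omega> assume \<omega>: "\<omega> \<in> space M"
    then have l: "0 < lik_ratio d S (X \<omega>)" by (simp add: lik_ratio_pos sample_carrier)
    show "indicator {\<omega> \<in> space M. N \<le> lik_ratio d S (X \<omega>)} \<omega>
      \<le> ennreal (lik_ratio d S (X \<omega>)) * ennreal (N powr - (1 + \<eta>) * lik_ratio d S (X \<omega>) powr \<eta>)"
    proof (cases "N \<le> lik_ratio d S (X \<omega>)")
      case True
      have "1 = N powr (1 + \<eta>) * N powr - (1 + \<eta>)" using N by (simp add: powr_add[symmetric])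
      also have "\<dots> \<le> lik_ratio d S (X \<omega>) powr (1 + \<eta>) * N powr - (1 + \<eta>)"
        using True N \<eta> by (intro mult_right_mono powr_mono2) auto
      also have "\<dots> = lik_ratio d S (X \<omega>) * (N powr - (1 + \<eta>) * lik_ratio d S (X \<omega>) powr \<eta>)"
        using l by (simp add: powr_add)
      finally show ?thesis using l True \<omega> by (simp add: ennreal_mult'[symmetric] ennreal_ge_1)
    qed simp
  qed
  also have "\<dots> = (\<integral>\<^sup>+y. ennreal (N powr - (1 + \<eta>) * lik_ratio d S y powr \<eta>) \<partial>std_gauss d)"
    by (rule sample_law_weighted) measurable
  also have "\<dots> \<le> ennreal (N powr - (1 + \<eta>) * moment_bound \<eta>)"
    by (rule nn_integral_ennreal_mult_left[OF _ _ moment_lik_ratio[OF \<eta>]]) auto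
  finally show ?thesis
    using scale_ub_pos \<eta> by (simp add: emeasure_eq_measure moment_bound_def)
qed

text \<open>Since \<open>1 / lik_ratio\<close> is at most a constant times \<open>exp ((y \<bullet> y) / 2)\<close> by
Bessel's inequality, the Laplace transform of the squared length at \<open>2\<close> is at most a constant times
\<open>E exp (- 3 (y \<bullet> y) / 2) = (1 / 2) ^ d\<close> under the standard Gaussian measure.\<close>
lemma sample_norm_small:
  "measure M {\<omega> \<in> space M. X \<omega> \<bullet> X \<omega> \<le> real d / 8} \<le> (3 / 4) ^ d / scale_lb"
proof -
  interpret prob_space M by (rule prob)
  note [measurable] = sample_measurable
  have "emeasure M {\<omega> \<in> space M. X \<omega> \<bullet> X \<omega> \<le> real d / 8} = (\<integral>\<^sup>+\<omega>. indicator {y \<in> carrier_vec d. y \<bullet> y \<le> real d / 8} (X \<omega>) \<partial>M)"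
  proof -
    have "emeasure M {\<omega> \<in> space M. X \<omega> \<bullet> X \<omega> \<le> real d / 8} = (\<integral>\<^sup>+\<omega>. indicator {\<omega> \<in> space M. X \<omega> \<bullet> X \<omega> \<le> real d / 8} \<omega> \<partial>M)"
      by (rule nn_integral_indicator[symmetric]) measurable
    also have "\<dots> = (\<integral>\<^sup>+\<omega>. indicator {y \<in> carrier_vec d. y \<bullet> y \<le> real d / 8} (X \<omega>) \<partial>M)"
      by (intro nn_integral_cong) (auto simp: indicator_def sample_carrier)
    finally show ?thesis .
  qed
  also have "\<dots> = (\<integral>\<^sup>+y. ennreal (1 / lik_ratio d S y) * indicator {y \<in> carrier_vec d. y \<bullet> y \<le> real d / 8} y \<partial>std_gauss d)"
  proof (rule sample_law)
    have "{y \<in> space (vec_borel d). y \<bullet> y \<le> real d / 8} \<in> sets (vec_borel d)" by measurable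
    then show "indicator {y \<in> carrier_vec d. y \<bullet> y \<le> real d / 8} \<in> borel_measurable (vec_borel d)"
      by (simp add: borel_measurable_indicator)
  qed
  also have "\<dots> \<le> (\<integral>\<^sup>+y. ennreal (exp (real d / 4) / scale_lb * exp (- 3 / 2 * (y \<bullet> y))) \<partial>std_gauss d)"
  proof (intro nn_integral_mono)
    fix y assume "y \<in> space (std_gauss d)"
    then have y: "y \<in> carrier_vec d" by simp
    show "ennreal (1 / lik_ratio d S y) * indicator {y \<in> carrier_vec d. y \<bullet> y \<le> real d / 8} y
      \<le> ennreal (exp (real d / 4) / scale_lb * exp (- 3 / 2 * (y \<bullet> y)))"
    proof (cases "y \<bullet> y \<le> real d / 8")
      case True
      have "- spike_form y \<le> (1 - 1 / L) * spike_sq y" using spike_form_lower[of y] unfolding mult_minus_left by linarith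
      also have "\<dots> \<le> 1 * (y \<bullet> y)"
        using L by (intro mult_mono spike_sq_le y spike_sq_nonneg) auto
      finally have "- spike_form y / 2 \<le> real d / 4 + - 3 / 2 * (y \<bullet> y)" using True by simp
      then have "exp (- spike_form y / 2) \<le> exp (real d / 4) * exp (- 3 / 2 * (y \<bullet> y))"
        by (simp only: exp_add[symmetric] exp_le_cancel_iff)
      moreover have "1 / scale \<le> 1 / scale_lb"
        using scale_lower scale_lb_pos by (intro divide_left_mono mult_pos_pos scale_pos) auto
      ultimately have "1 / scale * exp (- spike_form y / 2) \<le> 1 / scale_lb * (exp (real d / 4) * exp (- 3 / 2 * (y \<bullet> y)))"
        using scale_lb_pos by (intro mult_mono) auto
      moreover have "1 / lik_ratio d S y = 1 / scale * exp (- spike_form y / 2)"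
        by (simp add: lik_ratio_eq[OF y] exp_minus field_simps)
      ultimately have "1 / lik_ratio d S y \<le> exp (real d / 4) / scale_lb * exp (- 3 / 2 * (y \<bullet> y))"
        by simp
      then show ?thesis using y True by (simp only: indicator_simps mem_Collect_eq) (simp, rule ennreal_leI, simp)
    qed simp
  qed
  also have "\<dots> \<le> ennreal (exp (real d / 4) / scale_lb * (1 / sqrt (1 - - 3)) ^ d)"
  proof (rule nn_integral_ennreal_mult_left)
    show "(\<integral>\<^sup>+y. ennreal (exp (- 3 / 2 * (y \<bullet> y))) \<partial>std_gauss d) \<le> ennreal ((1 / sqrt (1 - - 3)) ^ d)"
      using std_gauss_exp_norm[of "-3" d] by simp
  qed (use scale_lb_pos in auto)
  also have "\<dots> \<le> ennreal ((3 / 4) ^ d / scale_lb)"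
  proof (rule ennreal_leI)
    have "exp (1 / 4 :: real) \<le> 3 / 2"
      using exp_bound[of "1 / 4 :: real"] by (simp add: power2_eq_square)
    then have "exp (1 / 4 :: real) ^ d * (1 / 2) ^ d \<le> (3 / 2) ^ d * (1 / 2) ^ d" by (intro mult_right_mono power_mono) auto
    then have "exp (real d / 4) * (1 / 2) ^ d \<le> (3 / 4) ^ d"
      by (simp add: exp_of_nat_mult[symmetric] power_mult_distrib[symmetric])
    then show "exp (real d / 4) / scale_lb * (1 / sqrt (1 - - 3)) ^ d \<le> (3 / 4) ^ d / scale_lb"
      using scale_lb_pos by (simp add: divide_right_mono)
  qed
  finally show ?thesis using scale_lb_pos by (simp add: emeasure_eq_measure)
qed

end

end

section \<open>Conditional and empirical covariance\<close>

lemma std_gauss_second_moment: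
  assumes "u \<in> carrier_vec d" "u \<bullet> u \<le> 2"
  shows "(\<integral>\<^sup>+y. ennreal ((u \<bullet> y)\<^sup>2) \<partial>std_gauss d) \<le> ennreal 16"
proof -
  have bound: "x \<le> 8 * exp (x / 8)" for x :: real
    using exp_ge_add_one_self[of "x / 8"] by linarith
  have "(\<integral>\<^sup>+y. ennreal ((u \<bullet> y)\<^sup>2) \<partial>std_gauss d) \<le> (\<integral>\<^sup>+y. ennreal (8 * exp ((u \<bullet> y)\<^sup>2 / 8)) \<partial>std_gauss d)"
    by (intro nn_integral_mono ennreal_leI bound)
  also have "\<dots> \<le> ennreal (8 * 2)"
    by (rule nn_integral_ennreal_mult_left[OF _ _ std_gauss_exp_square_le[OF assms]]) auto
  finally show ?thesis by simp
qed

lemma integrable_square: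
  assumes "u \<in> carrier_vec d" "u \<bullet> u \<le> 2"
  shows "integrable (std_gauss d) (\<lambda>y. (u \<bullet> y)\<^sup>2)"
proof (rule integrableI_nonneg)
  show "(\<integral>\<^sup>+y. ennreal ((u \<bullet> y)\<^sup>2) \<partial>std_gauss d) < \<infinity>"
    using std_gauss_second_moment[OF assms] by (rule order.strict_trans1) simp
qed auto

lemma integral_square_le:
  assumes "u \<in> carrier_vec d" "u \<bullet> u \<le> 2"
  shows "(\<integral>y. (u \<bullet> y)\<^sup>2 \<partial>std_gauss d) \<le> 16"
proof -
  have "(\<integral>\<^sup>+y. ennreal ((u \<bullet> y)\<^sup>2) \<partial>std_gauss d) = ennreal (\<integral>y. (u \<bullet> y)\<^sup>2 \<partial>std_gauss d)"
    by (rule nn_integral_eq_integral[OF integrable_square[OF assms]]) auto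
  with std_gauss_second_moment[OF assms] have "ennreal (\<integral>y. (u \<bullet> y)\<^sup>2 \<partial>std_gauss d) \<le> ennreal 16"
    by (simp only:)
  then show ?thesis by (subst (asm) ennreal_le_iff) auto
qed

lemma integrable_square_on:
  assumes "u \<in> carrier_vec d" "u \<bullet> u \<le> 2" and B: "B \<in> sets (vec_borel d)"
  shows "integrable (std_gauss d) (\<lambda>y. indicator B y * (u \<bullet> y)\<^sup>2)"
  using integrable_mult_indicator[OF _ integrable_square[OF assms(1,2)], of B] B
  by (simp add: sets_gauss_law)

lemma nn_integral_square_on:
  assumes "u \<in> carrier_vec d" "u \<bullet> u \<le> 2" and B: "B \<in> sets (vec_borel d)"
  shows "(\<integral>\<^sup>+y. ennreal (indicator B y * (u \<bullet> y)\<^sup>2) \<partial>std_gauss d) = ennreal (\<integral>y. indicator B y * (u \<bullet> y)\<^sup>2 \<partial>std_gauss d)"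
  by (rule nn_integral_eq_integral[OF integrable_square_on[OF assms]]) auto

lemma integral_square_on_le:
  assumes "u \<in> carrier_vec d" "u \<bullet> u \<le> 2" and B: "B \<in> sets (vec_borel d)"
  shows "(\<integral>y. indicator B y * (u \<bullet> y)\<^sup>2 \<partial>std_gauss d) \<le> 16"
proof -
  have "(\<integral>y. indicator B y * (u \<bullet> y)\<^sup>2 \<partial>std_gauss d) \<le> (\<integral>y. (u \<bullet> y)\<^sup>2 \<partial>std_gauss d)"
    by (intro integral_mono integrable_square_on integrable_square assms) (auto simp: indicator_def)
  then show ?thesis using integral_square_le[OF assms(1,2)] by linarith
qed

lemma std_gauss_coord_square: "i < d \<Longrightarrow> integrable (std_gauss d) (\<lambda>y. (y $ i)\<^sup>2)"
  using integrable_square[of "unit_vec d i" d]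
  by (subst Bochner_Integration.integrable_cong[OF refl, where g = "\<lambda>y. (unit_vec d i \<bullet> y)\<^sup>2"]) auto

lemma abs_le_one_plus_square: "\<bar>x\<bar> \<le> 1 + x\<^sup>2" for x :: real
proof -
  have "0 \<le> (\<bar>x\<bar> - 1)\<^sup>2" by simp
  then have "2 * \<bar>x\<bar> \<le> 1 + x\<^sup>2" by (simp add: power2_diff)
  then show ?thesis by linarith
qed

lemma integrable_coord:
  assumes "i < d"
  shows "integrable (std_gauss d) (\<lambda>y. y $ i)"
proof (rule Bochner_Integration.integrable_bound)
  interpret G: prob_space "std_gauss d" by (rule prob_space_std_gauss)
  show "integrable (std_gauss d) (\<lambda>y. 1 + (y $ i)\<^sup>2)"
    using std_gauss_coord_square[OF assms] by (intro Bochner_Integration.integrable_add) auto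
  show "AE y in std_gauss d. norm (y $ i) \<le> norm (1 + (y $ i)\<^sup>2)"
    by (intro always_eventually allI) (simp add: abs_le_one_plus_square)
qed (use assms in measurable)

lemma integrable_coord_mult:
  assumes "i < d" "j < d"
  shows "integrable (std_gauss d) (\<lambda>y. y $ i * y $ j)"
proof (rule Bochner_Integration.integrable_bound)
  show "integrable (std_gauss d) (\<lambda>y. (y $ i)\<^sup>2 + (y $ j)\<^sup>2)"
    using std_gauss_coord_square assms by (intro Bochner_Integration.integrable_add) auto
  have "\<bar>a * b\<bar> \<le> a\<^sup>2 + b\<^sup>2" for a b :: real
  proof -
    have "0 \<le> (\<bar>a\<bar> - \<bar>b\<bar>)\<^sup>2" by simp
    then have "2 * (\<bar>a\<bar> * \<bar>b\<bar>) \<le> a\<^sup>2 + b\<^sup>2" by (simp add: power2_diff)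
    moreover have "0 \<le> \<bar>a\<bar> * \<bar>b\<bar>" by simp
    ultimately show ?thesis unfolding abs_mult by linarith
  qed
  then show "AE y in std_gauss d. norm (y $ i * y $ j) \<le> norm ((y $ i)\<^sup>2 + (y $ j)\<^sup>2)"
    by (intro always_eventually allI) (simp add: abs_of_nonneg add_nonneg_nonneg)
qed (use assms in measurable)

locale conditioning =
  fixes d :: nat and A :: "real Matrix.vec set"
  assumes A_sets: "A \<in> sets (vec_borel d)" and p_pos: "0 < prob_A d A"
begin

lemma A_carrier: "A \<subseteq> carrier_vec d"
  using sets.sets_into_space[OF A_sets] by simp

lemma integral_conditional:
  fixes F :: "real Matrix.vec \<Rightarrow> real"
  assumes [measurable]: "F \<in> borel_measurable (vec_borel d)"
  shows "(\<integral>y. F y \<partial>uniform_measure (std_gauss d) A) = (\<integral>y. indicator A y * F y \<partial>std_gauss d) / prob_A d A"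
proof -
  interpret G: prob_space "std_gauss d" by (rule prob_space_std_gauss)
  have [measurable]: "A \<in> sets (std_gauss d)" using A_sets by (simp add: sets_gauss_law)
  have "uniform_measure (std_gauss d) A = density (std_gauss d) (\<lambda>x. ennreal (indicator A x / prob_A d A))"
    unfolding uniform_measure_def prob_A_def using p_pos
    by (intro density_cong) (auto simp: G.emeasure_eq_measure indicator_def prob_A_def divide_ennreal[symmetric])
  then have "(\<integral>y. F y \<partial>uniform_measure (std_gauss d) A) = (\<integral>y. (indicator A y / prob_A d A) * F y \<partial>std_gauss d)"
    using p_pos by (simp add: integral_density)
  then show ?thesis by simp
qed

text \<open>The conditional second moment; the mean contributes the same rank-one matrix to \<open>cond_cov\<close>
and \<open>emp_cov\<close> and drops out of their difference.\<close>
definition cond_second :: "real mat" where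
  "cond_second = mat d d (\<lambda>(i, j). \<integral>y. outer d y y $$ (i, j) \<partial>uniform_measure (std_gauss d) A)"

lemma cond_second_form:
  assumes u: "u \<in> carrier_vec d"
  shows "u \<bullet> (cond_second *\<^sub>v u) = (\<integral>y. indicator A y * (u \<bullet> y)\<^sup>2 \<partial>std_gauss d) / prob_A d A"
proof -
  have [measurable]: "A \<in> sets (std_gauss d)" using A_sets by (simp add: sets_gauss_law)
  have int: "integrable (std_gauss d) (\<lambda>y. indicator A y * (y $ i * y $ j))" if "i < d" "j < d" for i j
    using integrable_mult_indicator[OF _ integrable_coord_mult[OF that], of A] by simp
  have ent: "cond_second $$ (i, j) = (\<integral>y. indicator A y * (y $ i * y $ j) \<partial>std_gauss d) / prob_A d A" if "i < d" "j < d" for i j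
    using that by (simp add: cond_second_def outer_def integral_conditional)
  have "(\<integral>y. indicator A y * (u \<bullet> y)\<^sup>2 \<partial>std_gauss d)
      = (\<integral>y. (\<Sum>i<d. \<Sum>j<d. (u $ i * u $ j) * (indicator A y * (y $ i * y $ j))) \<partial>std_gauss d)"
  proof (intro Bochner_Integration.integral_cong refl)
    fix y assume "y \<in> space (std_gauss d)"
    then have "(u \<bullet> y)\<^sup>2 = (\<Sum>i<d. \<Sum>j<d. (u $ i * y $ i) * (u $ j * y $ j))"
      by (simp add: scalar_prod_eq_sum[of _ d] power2_eq_square sum_product)
    then show "indicator A y * (u \<bullet> y)\<^sup>2 = (\<Sum>i<d. \<Sum>j<d. (u $ i * u $ j) * (indicator A y * (y $ i * y $ j)))"
      by (simp only: sum_distrib_left) (intro sum.cong refl, simp add: algebra_simps)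
  qed
  also have "\<dots> = (\<Sum>i<d. \<integral>y. (\<Sum>j<d. (u $ i * u $ j) * (indicator A y * (y $ i * y $ j))) \<partial>std_gauss d)"
    by (intro Bochner_Integration.integral_sum Bochner_Integration.integrable_sum integrable_mult_right int) auto
  also have "\<dots> = (\<Sum>i<d. \<Sum>j<d. \<integral>y. (u $ i * u $ j) * (indicator A y * (y $ i * y $ j)) \<partial>std_gauss d)"
    by (intro sum.cong refl Bochner_Integration.integral_sum integrable_mult_right int) auto
  also have "\<dots> = (\<Sum>i<d. \<Sum>j<d. (u $ i * u $ j) * (\<integral>y. indicator A y * (y $ i * y $ j) \<partial>std_gauss d))"
    by (simp only: integral_mult_right_zero)
  finally have eq: "(\<integral>y. indicator A y * (u \<bullet> y)\<^sup>2 \<partial>std_gauss d)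
      = (\<Sum>i<d. \<Sum>j<d. (u $ i * u $ j) * (\<integral>y. indicator A y * (y $ i * y $ j) \<partial>std_gauss d))" .
  have "u \<bullet> (cond_second *\<^sub>v u) = (\<Sum>i<d. \<Sum>j<d. cond_second $$ (i, j) * (u $ i * u $ j))"
    using u by (intro quad_form_eq_sum) (auto simp: cond_second_def)
  then show ?thesis
    unfolding eq by (simp add: ent sum_divide_distrib mult.commute)
qed

lemma cond_mean_form:
  assumes u: "u \<in> carrier_vec d"
  shows "cond_mean d A \<bullet> u = (\<integral>y. indicator A y * (u \<bullet> y) \<partial>std_gauss d) / prob_A d A"
proof -
  have [measurable]: "A \<in> sets (std_gauss d)" using A_sets by (simp add: sets_gauss_law)
  have int: "integrable (std_gauss d) (\<lambda>y. indicator A y * y $ i)" if "i < d" for i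
    using integrable_mult_indicator[OF _ integrable_coord[OF that], of A] by simp
  have ent: "cond_mean d A $ i = (\<integral>y. indicator A y * y $ i \<partial>std_gauss d) / prob_A d A" if "i < d" for i
    using that by (simp add: cond_mean_def integral_conditional)
  have "(\<integral>y. indicator A y * (u \<bullet> y) \<partial>std_gauss d) = (\<integral>y. (\<Sum>i<d. u $ i * (indicator A y * y $ i)) \<partial>std_gauss d)"
    by (intro Bochner_Integration.integral_cong refl)
      (simp add: scalar_prod_eq_sum[of _ d] sum_distrib_left mult.left_commute)
  also have "\<dots> = (\<Sum>i<d. u $ i * (\<integral>y. indicator A y * y $ i \<partial>std_gauss d))"
    using int by (simp add: Bochner_Integration.integral_sum)
  finally show ?thesis
    using u by (simp add: scalar_prod_eq_sum[of _ d] ent sum_divide_distrib mult.commute)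
qed

lemma cond_mean_bound:
  assumes u: "u \<in> carrier_vec d" "u \<bullet> u \<le> 2"
  shows "(cond_mean d A \<bullet> u)\<^sup>2 \<le> (17 / prob_A d A)\<^sup>2"
proof -
  interpret G: prob_space "std_gauss d" by (rule prob_space_std_gauss)
  have [measurable]: "A \<in> sets (std_gauss d)" using A_sets by (simp add: sets_gauss_law)
  have "\<bar>\<integral>y. indicator A y * (u \<bullet> y) \<partial>std_gauss d\<bar> \<le> (\<integral>y. 1 + (u \<bullet> y)\<^sup>2 \<partial>std_gauss d)"
  proof (rule order_trans[OF integral_abs_bound integral_mono_AE'])
    show "integrable (std_gauss d) (\<lambda>y. 1 + (u \<bullet> y)\<^sup>2)"
      using integrable_square[OF u] by (intro Bochner_Integration.integrable_add) auto
    show "AE y in std_gauss d. \<bar>indicator A y * (u \<bullet> y)\<bar> \<le> 1 + (u \<bullet> y)\<^sup>2"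
      by (intro always_eventually allI) (simp add: indicator_def abs_le_one_plus_square)
  qed auto
  also have "\<dots> = 1 + (\<integral>y. (u \<bullet> y)\<^sup>2 \<partial>std_gauss d)"
    using integrable_square[OF u] by (subst Bochner_Integration.integral_add) (auto simp: G.prob_space[unfolded space_gauss_law])
  also have "\<dots> \<le> 17" using integral_square_le[OF u] by simp
  finally have "\<bar>cond_mean d A \<bullet> u\<bar> \<le> 17 / prob_A d A"
    unfolding cond_mean_form[OF u(1)] using p_pos by (simp add: divide_right_mono)
  then show ?thesis using p_pos by (subst abs_le_square_iff[symmetric]) simp
qed

lemma outer_form:
  assumes "m \<in> carrier_vec d" "u \<in> carrier_vec d"
  shows "u \<bullet> (outer d m m *\<^sub>v u) = (m \<bullet> u)\<^sup>2"
proof -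
  have "u \<bullet> (outer d m m *\<^sub>v u) = (\<Sum>i<d. \<Sum>j<d. outer d m m $$ (i, j) * (u $ i * u $ j))"
    using assms by (intro quad_form_eq_sum) (auto simp: outer_def)
  also have "\<dots> = (\<Sum>i<d. \<Sum>j<d. (m $ i * u $ i) * (m $ j * u $ j))"
    by (intro sum.cong refl) (simp add: outer_def algebra_simps)
  finally show ?thesis
    using assms by (simp add: scalar_prod_eq_sum[of _ d] power2_eq_square sum_product)
qed

lemma cond_mean_carrier: "cond_mean d A \<in> carrier_vec d"
  by (simp add: cond_mean_def)

lemma cond_cov_form:
  assumes u: "u \<in> carrier_vec d"
  shows "u \<bullet> (cond_cov d A *\<^sub>v u)
       = (\<integral>y. indicator A y * (u \<bullet> y)\<^sup>2 \<partial>std_gauss d) / prob_A d A - (cond_mean d A \<bullet> u)\<^sup>2"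
proof -
  have car: "cond_second \<in> carrier_mat d d" "outer d (cond_mean d A) (cond_mean d A) \<in> carrier_mat d d"
    by (auto simp: cond_second_def outer_def)
  have "cond_cov d A *\<^sub>v u = cond_second *\<^sub>v u - outer d (cond_mean d A) (cond_mean d A) *\<^sub>v u"
    unfolding cond_cov_def cond_second_def[symmetric]
    using minus_mult_distrib_mat_vec[OF car u] by simp
  then have "u \<bullet> (cond_cov d A *\<^sub>v u) = u \<bullet> (cond_second *\<^sub>v u) - u \<bullet> (outer d (cond_mean d A) (cond_mean d A) *\<^sub>v u)"
    using car u by (simp add: scalar_prod_minus_distrib[of _ d])
  then show ?thesis
    by (simp add: cond_second_form[OF u] outer_form[OF cond_mean_carrier u])
qed

lemma cond_cov_symmetric: "symmetric_mat d (cond_cov d A)"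
  by (auto simp: symmetric_mat_def cond_cov_def outer_def mult.commute)

lemma lambda_max_cond_cov:
  assumes "d \<ge> 1"
  shows "lambda_max (cond_cov d A) \<le> 16 / prob_A d A"
proof (rule lambda_max_le[OF assms cond_cov_symmetric])
  fix u :: "real Matrix.vec" assume u: "u \<in> carrier_vec d" "u \<bullet> u = 1"
  have "(\<integral>y. indicator A y * (u \<bullet> y)\<^sup>2 \<partial>std_gauss d) \<le> 16"
    using u by (intro integral_square_on_le A_sets) auto
  then have "(\<integral>y. indicator A y * (u \<bullet> y)\<^sup>2 \<partial>std_gauss d) / prob_A d A \<le> 16 / prob_A d A"
    using p_pos by (simp add: divide_right_mono)
  then show "u \<bullet> (cond_cov d A *\<^sub>v u) \<le> 16 / prob_A d A"
    unfolding cond_cov_form[OF u(1)] using zero_le_power2[of "cond_mean d A \<bullet> u"] by linarith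
qed

lemma emp_cov_symmetric: "symmetric_mat d (emp_cov d n S A x)"
  by (auto simp: symmetric_mat_def emp_cov_def outer_def mult.commute)

lemma emp_cov_form:
  assumes u: "u \<in> carrier_vec d" and x: "\<And>k. k \<in> {1..n} \<Longrightarrow> x k \<in> carrier_vec d"
  shows "u \<bullet> (emp_cov d n S A x *\<^sub>v u)
       = 1 / (real n * prob_A d A) * (\<Sum>k=1..n. lik_ratio d S (x k) * indicator A (x k) * (u \<bullet> x k)\<^sup>2)
         - (cond_mean d A \<bullet> u)\<^sup>2"
proof -
  define c where "c = 1 / (real n * prob_A d A)"
  define w where "w k = lik_ratio d S (x k) * indicator A (x k)" for k
  define E where "E = mat d d (\<lambda>(i, j). c * (\<Sum>k = 1..n. w k * outer d (x k) (x k) $$ (i, j)))"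
  have car: "E \<in> carrier_mat d d" "outer d (cond_mean d A) (cond_mean d A) \<in> carrier_mat d d"
    by (auto simp: E_def outer_def)
  have "u \<bullet> (E *\<^sub>v u) = (\<Sum>i<d. \<Sum>j<d. \<Sum>k=1..n. c * (w k * ((u $ i * x k $ i) * (u $ j * x k $ j))))"
    unfolding quad_form_eq_sum[OF car(1) u u]
    by (intro sum.cong refl) (simp add: E_def outer_def sum_distrib_left sum_distrib_right mult_ac)
  also have "\<dots> = (\<Sum>k=1..n. \<Sum>i<d. \<Sum>j<d. c * (w k * ((u $ i * x k $ i) * (u $ j * x k $ j))))"
    by (subst (2) sum.swap, subst sum.swap) (rule refl)
  also have "\<dots> = (\<Sum>k=1..n. c * (w k * (u \<bullet> x k)\<^sup>2))"
  proof (intro sum.cong refl)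
    fix k assume k: "k \<in> {1..n}"
    show "(\<Sum>i<d. \<Sum>j<d. c * (w k * ((u $ i * x k $ i) * (u $ j * x k $ j)))) = c * (w k * (u \<bullet> x k)\<^sup>2)"
      unfolding scalar_prod_eq_sum[OF x[OF k]] power2_eq_square sum_product by (simp only: sum_distrib_left)
  qed
  finally have "u \<bullet> (E *\<^sub>v u) = c * (\<Sum>k=1..n. w k * (u \<bullet> x k)\<^sup>2)"
    by (simp only: sum_distrib_left)
  moreover have "emp_cov d n S A x *\<^sub>v u = E *\<^sub>v u - outer d (cond_mean d A) (cond_mean d A) *\<^sub>v u"
    unfolding emp_cov_def c_def[symmetric] w_def[symmetric] E_def[symmetric]
    using minus_mult_distrib_mat_vec[OF car u] by simp
  ultimately show ?thesis
    using car u by (simp add: scalar_prod_minus_distrib[of _ d] outer_form[OF cond_mean_carrier u] c_def w_def)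
qed

lemma emp_cov_error_form:
  assumes u: "u \<in> carrier_vec d" and x: "\<And>k. k \<in> {1..n} \<Longrightarrow> x k \<in> carrier_vec d"
  shows "u \<bullet> ((emp_cov d n S A x - cond_cov d A) *\<^sub>v u)
       = (1 / real n * (\<Sum>k=1..n. lik_ratio d S (x k) * indicator A (x k) * (u \<bullet> x k)\<^sup>2)
          - (\<integral>y. indicator A y * (u \<bullet> y)\<^sup>2 \<partial>std_gauss d)) / prob_A d A"
proof -
  have car: "emp_cov d n S A x \<in> carrier_mat d d" "cond_cov d A \<in> carrier_mat d d"
    using emp_cov_symmetric cond_cov_symmetric symmetric_mat_carrier by auto
  have "(emp_cov d n S A x - cond_cov d A) *\<^sub>v u = emp_cov d n S A x *\<^sub>v u - cond_cov d A *\<^sub>v u"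
    by (rule minus_mult_distrib_mat_vec[OF car u])
  then have "u \<bullet> ((emp_cov d n S A x - cond_cov d A) *\<^sub>v u)
      = u \<bullet> (emp_cov d n S A x *\<^sub>v u) - u \<bullet> (cond_cov d A *\<^sub>v u)"
    using car u by (simp add: scalar_prod_minus_distrib[of _ d])
  moreover have "u \<bullet> (emp_cov d n S A x *\<^sub>v u)
       = 1 / (real n * prob_A d A) * (\<Sum>k=1..n. lik_ratio d S (x k) * indicator A (x k) * (u \<bullet> x k)\<^sup>2)
         - (cond_mean d A \<bullet> u)\<^sup>2"
    by (rule emp_cov_form[OF u]) (rule x)
  ultimately show ?thesis
    unfolding cond_cov_form[OF u] by (simp add: diff_divide_distrib)
qed

lemma emp_cov_error_symmetric: "symmetric_mat d (emp_cov d n S A x - cond_cov d A)"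
  using emp_cov_symmetric[of n S x] cond_cov_symmetric unfolding symmetric_mat_def by auto

end

section \<open>Truncated weights\<close>

lemma ennreal_add_le_diff:
  assumes "x + ennreal b \<le> ennreal c" "0 \<le> b"
  shows "x \<le> ennreal (c - b)"
proof (cases x)
  case (real r)
  then have "ennreal (r + b) \<le> ennreal c" using assms by (simp add: ennreal_plus)
  then have "0 \<le> c \<and> r + b \<le> c \<or> r + b \<le> 0 \<and> c \<le> 0" unfolding ennreal_le_iff2 .
  then have "0 \<le> c - b \<and> r \<le> c - b \<or> r \<le> 0 \<and> c - b \<le> 0" using real(1) assms(2) by linarith
  then show ?thesis unfolding real(2) ennreal_le_iff2 .
next
  case top
  then show ?thesis using assms(1) by (simp add: top_unique)
qed

text \<open>The number of hits is a sum of independent indicators; apply the Chernoff bound with parameter -1, where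
\<open>exp (-1) \<le> 1 / 2\<close> keeps the constants simple.\<close>
lemma (in prob_space) prob_none_hit:
  assumes indep: "indep_vars (\<lambda>_. N) X {1..n}" and B: "B \<in> sets N"
    and hit: "\<And>i. i \<in> {1..n} \<Longrightarrow> \<pi> \<le> prob {\<omega> \<in> space M. X i \<omega> \<in> B}" and \<pi>: "0 \<le> \<pi>"
  shows "prob {\<omega> \<in> space M. \<forall>i\<in>{1..n}. X i \<omega> \<notin> B} \<le> exp (- real n * \<pi> / 2)"
proof -
  have X: "i \<in> {1..n} \<Longrightarrow> X i \<in> M \<rightarrow>\<^sub>M N" for i using indep by (auto simp: indep_vars_def)
  let ?Z = "\<lambda>i \<omega>. indicator B (X i \<omega>) :: real"
  have indZ: "indep_vars (\<lambda>_. borel) ?Z {1..n}"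
    by (rule indep_vars_compose2[OF indep]) (rule borel_measurable_indicator[OF B])
  (* exp (- Z) + (1 / 2) Z \<le> 1 holds for Z = 0 and Z = 1. *)
  have e: "exp (- 1 :: real) \<le> 1 / 2" using exp_ge_add_one_self[of 1] by (simp add: exp_minus field_simps)
  have "emeasure M {\<omega> \<in> space M. 0 \<le> - 1 * (\<Sum>i=1..n. ?Z i \<omega>)} \<le> ennreal (exp (- 0 + real n * (- (\<pi> / 2))))"
  proof (rule chernoff_one_sided[OF indZ])
    fix i assume i: "i \<in> {1..n}"
    have hitset: "{\<omega> \<in> space M. X i \<omega> \<in> B} \<in> sets M"
      using measurable_sets[OF X[OF i] B] by (simp add: vimage_def Int_def conj_commute)
    have "(\<integral>\<^sup>+\<omega>. ennreal (exp (- 1 * ?Z i \<omega>)) \<partial>M) + ennreal (\<pi> / 2)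
        \<le> (\<integral>\<^sup>+\<omega>. ennreal (exp (- 1 * ?Z i \<omega>)) \<partial>M) + ennreal (1 / 2) * emeasure M {\<omega> \<in> space M. X i \<omega> \<in> B}"
      using hit[OF i] by (intro add_left_mono) (simp add: emeasure_eq_measure ennreal_mult'[symmetric] del: ennreal_half)
    also have "\<dots> = (\<integral>\<^sup>+\<omega>. ennreal (exp (- 1 * ?Z i \<omega>)) + ennreal (1 / 2) * indicator {\<omega> \<in> space M. X i \<omega> \<in> B} \<omega> \<partial>M)"
    proof -
      have "(\<lambda>\<omega>. ennreal (exp (- 1 * ?Z i \<omega>))) \<in> borel_measurable M"
        using X[OF i] B by measurable
      then show ?thesis using hitset
        by (subst nn_integral_add) (auto simp: nn_integral_cmult_indicator)
    qed
    also have "\<dots> \<le> (\<integral>\<^sup>+\<omega>. 1 \<partial>M)"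
    proof (intro nn_integral_mono)
      fix \<omega> assume "\<omega> \<in> space M"
      have "ennreal (exp (- 1)) + ennreal (1 / 2) \<le> ennreal 1"
        using e by (simp only: ennreal_plus[symmetric] exp_ge_zero) (intro ennreal_leI, simp)
      then show "ennreal (exp (- 1 * ?Z i \<omega>)) + ennreal (1 / 2) * indicator {\<omega> \<in> space M. X i \<omega> \<in> B} \<omega> \<le> 1"
        by (simp add: indicator_def)
    qed
    finally have "(\<integral>\<^sup>+\<omega>. ennreal (exp (- 1 * ?Z i \<omega>)) \<partial>M) + ennreal (\<pi> / 2) \<le> ennreal 1"
      by (simp add: emeasure_space_1)
    from ennreal_add_le_diff[OF this] \<pi>
    show "(\<integral>\<^sup>+\<omega>. ennreal (exp (- 1 * ?Z i \<omega>)) \<partial>M) \<le> ennreal (1 + - (\<pi> / 2))" by simp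
  qed
  moreover have "{\<omega> \<in> space M. 0 \<le> - 1 * (\<Sum>i=1..n. ?Z i \<omega>)} = {\<omega> \<in> space M. \<forall>i\<in>{1..n}. X i \<omega> \<notin> B}"
  proof (intro Collect_cong conj_cong refl)
    fix \<omega>
    have "0 \<le> - 1 * (\<Sum>i=1..n. ?Z i \<omega>) \<longleftrightarrow> (\<Sum>i=1..n. ?Z i \<omega>) = 0"
      using sum_nonneg[of "{1..n}" "\<lambda>i. ?Z i \<omega>"] by auto
    also have "\<dots> \<longleftrightarrow> (\<forall>i\<in>{1..n}. X i \<omega> \<notin> B)"
      by (subst sum_nonneg_eq_0_iff) (auto simp: indicator_def)
    finally show "0 \<le> - 1 * (\<Sum>i=1..n. ?Z i \<omega>) \<longleftrightarrow> (\<forall>i\<in>{1..n}. X i \<omega> \<notin> B)" .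
  qed
  ultimately show ?thesis by (simp add: emeasure_eq_measure)
qed

text \<open>Second-order expansion of the exponential. In the quadratic term \<open>l\<^sup>2 \<le> N l\<close> trades
one factor of the truncated weight for \<open>N\<close>, and the other is kept for the change of measure.\<close>
lemma trunc_exp_bounds:
  fixes l q N \<theta> i :: real
  assumes l: "0 \<le> l" and q: "0 \<le> q" and N: "0 < N" and \<theta>: "0 < \<theta>" "\<theta> \<le> 1 / 16"
    and i: "i = 0 \<or> (i = 1 \<and> l \<le> N)"
  shows "exp (\<theta> / N * (l * i * q)) \<le> 1 + l * (\<theta> / N * (i * q)) + l * (\<theta>\<^sup>2 / N * (q\<^sup>2 * exp (q / 16)))" (is ?U)
    and "exp (- (\<theta> / N) * (l * i * q)) + l * (\<theta> / N * (i * q)) \<le> 1 + l * (\<theta>\<^sup>2 / N * (q\<^sup>2 * exp (q / 16)))" (is ?L)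
proof -
  define a where "a = \<theta> / N * (l * i * q)"
  have a0: "0 \<le> a" using assms by (auto simp: a_def)
  have sq: "a\<^sup>2 \<le> l * (\<theta>\<^sup>2 / N * q\<^sup>2)" and ae: "a \<le> q / 16"
  proof -
    have "i = 0 \<or> (i = 1 \<and> l \<le> N)" by (rule i)
    then have "a\<^sup>2 \<le> l * (\<theta>\<^sup>2 / N * q\<^sup>2) \<and> a \<le> q / 16"
    proof
      assume "i = 0"
      then show ?thesis using assms by (simp add: a_def)
    next
      assume i: "i = 1 \<and> l \<le> N"
      have lN: "l / N \<le> 1" using i N by simp
      have "a\<^sup>2 = (l * (\<theta>\<^sup>2 / N * q\<^sup>2)) * (l / N)" using i N by (simp add: a_def power2_eq_square field_simps)
      also have "\<dots> \<le> (l * (\<theta>\<^sup>2 / N * q\<^sup>2)) * 1" using lN assms by (intro mult_left_mono) auto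
      finally have 1: "a\<^sup>2 \<le> l * (\<theta>\<^sup>2 / N * q\<^sup>2)" by simp
      have "a = \<theta> * (l / N) * q" using i by (simp add: a_def)
      also have "\<dots> \<le> (1 / 16) * 1 * q" using assms lN by (intro mult_right_mono mult_mono) auto
      finally show ?thesis using 1 by simp
    qed
    then show "a\<^sup>2 \<le> l * (\<theta>\<^sup>2 / N * q\<^sup>2)" "a \<le> q / 16" by auto
  qed
  have nn: "0 \<le> l * (\<theta>\<^sup>2 / N * q\<^sup>2)" using assms by simp
  have eq: "a = l * (\<theta> / N * (i * q))" by (simp add: a_def)
  (* exp a is bounded through a \<le> q / 16, which uses both l \<le> N and \<theta> \<le> 1 / 16 *)
  have "exp a \<le> 1 + a + a\<^sup>2 * exp a" by (rule exp_le_quadratic[OF a0])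
  also have "a\<^sup>2 * exp a \<le> (l * (\<theta>\<^sup>2 / N * q\<^sup>2)) * exp (q / 16)"
    using sq ae nn by (intro mult_mono) auto
  finally show ?U unfolding a_def[symmetric] by (simp add: eq mult.assoc)
  have "exp (- a) + a \<le> 1 + a\<^sup>2" by (rule exp_minus_le_quadratic[OF a0])
  also have "a\<^sup>2 \<le> (l * (\<theta>\<^sup>2 / N * q\<^sup>2)) * 1" using sq by simp
  also have "\<dots> \<le> (l * (\<theta>\<^sup>2 / N * q\<^sup>2)) * exp (q / 16)"
    using nn q by (intro mult_left_mono) auto
  finally have "exp (- a) + a \<le> 1 + l * (\<theta>\<^sup>2 / N * (q\<^sup>2 * exp (q / 16)))" by (simp add: mult.assoc)
  then show ?L unfolding mult_minus_left a_def[symmetric] eq[symmetric] .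
qed

locale spiked_conditioning = spiked d r R lam v S lam1 L + conditioning d A
  for d r R lam v S lam1 L A
begin

lemma sets_Collect_A:
  assumes "{y \<in> space (vec_borel d). P y} \<in> sets (vec_borel d)"
  shows "{y \<in> A. P y} \<in> sets (vec_borel d)"
proof -
  have "{y \<in> A. P y} = A \<inter> {y \<in> space (vec_borel d). P y}" using A_carrier by auto
  then show ?thesis using sets.Int[OF A_sets assms] by simp
qed

definition trunc_set :: "real \<Rightarrow> real Matrix.vec set" where
  "trunc_set N = {y \<in> A. lik_ratio d S y \<le> N}"

lemma trunc_set_sets [measurable]: "trunc_set N \<in> sets (vec_borel d)"
  unfolding trunc_set_def by (rule sets_Collect_A) measurable

definition trunc_mean :: "real \<Rightarrow> real Matrix.vec \<Rightarrow> real" where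
  "trunc_mean N u = (\<integral>y. indicator (trunc_set N) y * (u \<bullet> y)\<^sup>2 \<partial>std_gauss d)"

definition trunc_term :: "real \<Rightarrow> real Matrix.vec \<Rightarrow> real Matrix.vec \<Rightarrow> real" where
  "trunc_term N u y = lik_ratio d S y * indicator (trunc_set N) y * (u \<bullet> y)\<^sup>2"

lemma measurable_trunc_term [measurable]: "trunc_term N u \<in> borel_measurable (vec_borel d)"
  unfolding trunc_term_def by measurable

lemma trunc_mean_nonneg: "0 \<le> trunc_mean N u"
  unfolding trunc_mean_def by (intro integral_nonneg_AE always_eventually) auto

text \<open>After the change of measure the quadratic term is a standard Gaussian fourth moment divided by
\<open>N\<close>. The weighted squares thus behave like variables with variance proxy \<open>N\<close>, in every
direction \<open>u\<close> and every dimension.\<close>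
lemma trunc_mgf:
  assumes prob: "prob_space M"
    and dist: "distributed M (vec_lborel d) X (\<lambda>x. ennreal (gauss_density d (0\<^sub>v d) S x))"
    and u: "u \<in> carrier_vec d" "u \<bullet> u \<le> 2" and N: "0 < N" and \<theta>: "0 < \<theta>" "\<theta> \<le> 1 / 16"
  shows "(\<integral>\<^sup>+\<omega>. ennreal (exp (\<theta> / N * trunc_term N u (X \<omega>))) \<partial>M)
           \<le> ennreal (1 + (\<theta> / N * trunc_mean N u + 1024 * \<theta>\<^sup>2 / N))" (is ?U)
    and "(\<integral>\<^sup>+\<omega>. ennreal (exp (- (\<theta> / N) * trunc_term N u (X \<omega>))) \<partial>M)
           \<le> ennreal (1 + (- (\<theta> / N) * trunc_mean N u + 1024 * \<theta>\<^sup>2 / N))" (is ?L)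
proof -
  interpret prob_space M by (rule prob)
  note [measurable] = sample_measurable[OF prob dist]
  let ?l = "\<lambda>\<omega>. lik_ratio d S (X \<omega>)"
  let ?q = "\<lambda>y. (u \<bullet> y)\<^sup>2"
  let ?i = "\<lambda>y. indicator (trunc_set N) y :: real"
  let ?lin = "\<lambda>y. \<theta> / N * (?i y * ?q y)"
  let ?quad = "\<lambda>y. \<theta>\<^sup>2 / N * ((?q y)\<^sup>2 * exp (?q y / 16))"
  have l: "0 \<le> ?l \<omega>" if "\<omega> \<in> space M" for \<omega>
    using lik_ratio_pos[OF sample_carrier[OF prob dist that]] by simp
  have i: "?i y = 0 \<or> (?i y = 1 \<and> lik_ratio d S y \<le> N)" for y
    by (auto simp: indicator_def trunc_set_def)
  have lin0: "0 \<le> ?lin y" and quad0: "0 \<le> ?quad y" for y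
    using \<theta> N by auto
  have lin: "(\<integral>\<^sup>+\<omega>. ennreal (?l \<omega>) * ennreal (?lin (X \<omega>)) \<partial>M) = ennreal (\<theta> / N * trunc_mean N u)"
  proof -
    have "(\<integral>\<^sup>+\<omega>. ennreal (?l \<omega>) * ennreal (?lin (X \<omega>)) \<partial>M) = (\<integral>\<^sup>+y. ennreal (?lin y) \<partial>std_gauss d)"
      by (rule sample_law_weighted[OF prob dist]) measurable
    also have "\<dots> = (\<integral>\<^sup>+y. ennreal (\<theta> / N) * ennreal (?i y * ?q y) \<partial>std_gauss d)"
      using \<theta> N by (intro nn_integral_cong ennreal_mult') auto
    also have "\<dots> = ennreal (\<theta> / N) * ennreal (trunc_mean N u)"
      unfolding trunc_mean_def nn_integral_square_on[OF u trunc_set_sets, symmetric]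
      by (rule nn_integral_cmult) measurable
    also have "\<dots> = ennreal (\<theta> / N * trunc_mean N u)"
      by (rule ennreal_mult'[symmetric]) (use \<theta> N in simp)
    finally show ?thesis .
  qed
  have quad: "(\<integral>\<^sup>+\<omega>. ennreal (?l \<omega>) * ennreal (?quad (X \<omega>)) \<partial>M) \<le> ennreal (1024 * \<theta>\<^sup>2 / N)"
  proof -
    have "(\<integral>\<^sup>+\<omega>. ennreal (?l \<omega>) * ennreal (?quad (X \<omega>)) \<partial>M) = (\<integral>\<^sup>+y. ennreal (?quad y) \<partial>std_gauss d)"
      by (rule sample_law_weighted[OF prob dist]) measurable
    also have "\<dots> \<le> ennreal (\<theta>\<^sup>2 / N * 1024)"
      using N by (intro nn_integral_ennreal_mult_left std_gauss_fourth_moment[OF u]) auto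
    finally show ?thesis by (simp add: mult.commute)
  qed
  have one: "(\<integral>\<^sup>+\<omega>. 1 \<partial>M) = 1" by (simp add: emeasure_space_1)
  have "(\<integral>\<^sup>+\<omega>. ennreal (exp (\<theta> / N * trunc_term N u (X \<omega>))) \<partial>M)
      \<le> (\<integral>\<^sup>+\<omega>. 1 + ennreal (?l \<omega>) * ennreal (?lin (X \<omega>)) + ennreal (?l \<omega>) * ennreal (?quad (X \<omega>)) \<partial>M)"
  proof (intro nn_integral_mono)
    fix \<omega> assume \<omega>: "\<omega> \<in> space M"
    have "exp (\<theta> / N * trunc_term N u (X \<omega>)) \<le> 1 + ?l \<omega> * ?lin (X \<omega>) + ?l \<omega> * ?quad (X \<omega>)"
      unfolding trunc_term_def by (rule trunc_exp_bounds(1)[OF l[OF \<omega>] _ N \<theta> i]) simp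
    then have "ennreal (exp (\<theta> / N * trunc_term N u (X \<omega>))) \<le> ennreal (1 + ?l \<omega> * ?lin (X \<omega>) + ?l \<omega> * ?quad (X \<omega>))"
      by (rule ennreal_leI)
    also have "\<dots> = 1 + ennreal (?l \<omega>) * ennreal (?lin (X \<omega>)) + ennreal (?l \<omega>) * ennreal (?quad (X \<omega>))"
      using l[OF \<omega>] lin0[of "X \<omega>"] quad0[of "X \<omega>"]
      by (simp only: ennreal_plus ennreal_mult' mult_nonneg_nonneg add_nonneg_nonneg zero_le_one ennreal_1)
    finally show "ennreal (exp (\<theta> / N * trunc_term N u (X \<omega>)))
      \<le> 1 + ennreal (?l \<omega>) * ennreal (?lin (X \<omega>)) + ennreal (?l \<omega>) * ennreal (?quad (X \<omega>))" .
  qed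
  also have "\<dots> = 1 + ennreal (\<theta> / N * trunc_mean N u) + (\<integral>\<^sup>+\<omega>. ennreal (?l \<omega>) * ennreal (?quad (X \<omega>)) \<partial>M)"
    unfolding lin[symmetric]
    by (subst nn_integral_add, measurable, subst nn_integral_add, measurable) (simp only: one)
  also have "\<dots> \<le> 1 + ennreal (\<theta> / N * trunc_mean N u) + ennreal (1024 * \<theta>\<^sup>2 / N)"
    by (rule add_left_mono[OF quad])
  also have "\<dots> = ennreal (1 + (\<theta> / N * trunc_mean N u + 1024 * \<theta>\<^sup>2 / N))"
    using trunc_mean_nonneg[of N u] \<theta> N by (simp add: ennreal_plus add.assoc)
  finally show ?U .
  have "(\<integral>\<^sup>+\<omega>. ennreal (exp (- (\<theta> / N) * trunc_term N u (X \<omega>))) \<partial>M) + ennreal (\<theta> / N * trunc_mean N u)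
      = (\<integral>\<^sup>+\<omega>. ennreal (exp (- (\<theta> / N) * trunc_term N u (X \<omega>))) + ennreal (?l \<omega>) * ennreal (?lin (X \<omega>)) \<partial>M)"
    unfolding lin[symmetric] by (rule nn_integral_add[symmetric]) measurable
  also have "\<dots> \<le> (\<integral>\<^sup>+\<omega>. 1 + ennreal (?l \<omega>) * ennreal (?quad (X \<omega>)) \<partial>M)"
  proof (intro nn_integral_mono)
    fix \<omega> assume \<omega>: "\<omega> \<in> space M"
    have "exp (- (\<theta> / N) * trunc_term N u (X \<omega>)) + ?l \<omega> * ?lin (X \<omega>) \<le> 1 + ?l \<omega> * ?quad (X \<omega>)"
      unfolding trunc_term_def by (rule trunc_exp_bounds(2)[OF l[OF \<omega>] _ N \<theta> i]) simp
    then have "ennreal (exp (- (\<theta> / N) * trunc_term N u (X \<omega>)) + ?l \<omega> * ?lin (X \<omega>)) \<le> ennreal (1 + ?l \<omega> * ?quad (X \<omega>))"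
      by (rule ennreal_leI)
    then show "ennreal (exp (- (\<theta> / N) * trunc_term N u (X \<omega>))) + ennreal (?l \<omega>) * ennreal (?lin (X \<omega>))
        \<le> 1 + ennreal (?l \<omega>) * ennreal (?quad (X \<omega>))"
      using l[OF \<omega>] lin0[of "X \<omega>"] quad0[of "X \<omega>"]
      by (simp only: ennreal_plus ennreal_mult' mult_nonneg_nonneg zero_le_one ennreal_1 exp_ge_zero)
  qed
  also have "\<dots> = 1 + (\<integral>\<^sup>+\<omega>. ennreal (?l \<omega>) * ennreal (?quad (X \<omega>)) \<partial>M)"
    by (subst nn_integral_add, measurable) (simp only: one)
  also have "\<dots> \<le> 1 + ennreal (1024 * \<theta>\<^sup>2 / N)"
    by (rule add_left_mono[OF quad])
  also have "\<dots> = ennreal (1 + 1024 * \<theta>\<^sup>2 / N)"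
    using N by (simp add: ennreal_plus)
  finally have "(\<integral>\<^sup>+\<omega>. ennreal (exp (- (\<theta> / N) * trunc_term N u (X \<omega>))) \<partial>M) \<le> ennreal (1 + 1024 * \<theta>\<^sup>2 / N - \<theta> / N * trunc_mean N u)"
    using trunc_mean_nonneg[of N u] \<theta> N by (intro ennreal_add_le_diff) auto
  then show ?L by (simp add: algebra_simps)
qed

text \<open>The mass lost by truncation is the integral of \<open>(u \<bullet> y)\<^sup>2\<close> over a set on which
\<open>lik_ratio > N\<close>. It is split by \<open>q \<le> \<delta> q\<^sup>2 / 2 + 1 / (2 \<delta>)\<close> into a
fourth moment and a moment of the likelihood ratio, with \<open>\<delta> = N powr - (\<eta> / 2)\<close> balancing the
two.\<close>
lemma trunc_bias:
  assumes u: "u \<in> carrier_vec d" "u \<bullet> u \<le> 2" and N: "0 < N"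
    and \<eta>: "0 \<le> \<eta>" "\<eta> * (1 / lam1 - 1) < 1"
  shows "\<bar>(\<integral>y. indicator A y * (u \<bullet> y)\<^sup>2 \<partial>std_gauss d) - trunc_mean N u\<bar>
       \<le> N powr - (\<eta> / 2) * (512 + moment_bound \<eta> / 2)"
proof -
  define \<delta> where "\<delta> = N powr - (\<eta> / 2)"
  have \<delta>: "0 < \<delta>" using N by (simp add: \<delta>_def)
  let ?B = "A - trunc_set N"
  have B: "?B \<in> sets (vec_borel d)" using A_sets trunc_set_sets by (rule sets.Diff)
  have "trunc_set N \<subseteq> A" by (auto simp: trunc_set_def)
  then have "(\<integral>y. indicator A y * (u \<bullet> y)\<^sup>2 \<partial>std_gauss d) - trunc_mean N u
      = (\<integral>y. indicator A y * (u \<bullet> y)\<^sup>2 - indicator (trunc_set N) y * (u \<bullet> y)\<^sup>2 \<partial>std_gauss d)"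
    unfolding trunc_mean_def
    by (intro Bochner_Integration.integral_diff[symmetric] integrable_square_on u A_sets trunc_set_sets)
  also have "\<dots> = (\<integral>y. indicator ?B y * (u \<bullet> y)\<^sup>2 \<partial>std_gauss d)"
    using \<open>trunc_set N \<subseteq> A\<close> by (intro Bochner_Integration.integral_cong refl) (auto simp: indicator_def)
  finally have eq: "(\<integral>y. indicator A y * (u \<bullet> y)\<^sup>2 \<partial>std_gauss d) - trunc_mean N u
      = (\<integral>y. indicator ?B y * (u \<bullet> y)\<^sup>2 \<partial>std_gauss d)" .
  have "ennreal (\<integral>y. indicator ?B y * (u \<bullet> y)\<^sup>2 \<partial>std_gauss d) = (\<integral>\<^sup>+y. ennreal (indicator ?B y * (u \<bullet> y)\<^sup>2) \<partial>std_gauss d)"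
    by (rule nn_integral_square_on[OF u B, symmetric])
  also have "\<dots> \<le> (\<integral>\<^sup>+y. ennreal (\<delta> / 2 * (((u \<bullet> y)\<^sup>2)\<^sup>2 * exp ((u \<bullet> y)\<^sup>2 / 16))) + ennreal (\<delta> / 2 * (lik_ratio d S y powr \<eta>)) \<partial>std_gauss d)"
  proof (intro nn_integral_mono)
    fix y
    show "ennreal (indicator ?B y * (u \<bullet> y)\<^sup>2)
      \<le> ennreal (\<delta> / 2 * (((u \<bullet> y)\<^sup>2)\<^sup>2 * exp ((u \<bullet> y)\<^sup>2 / 16))) + ennreal (\<delta> / 2 * (lik_ratio d S y powr \<eta>))"
    proof (cases "y \<in> ?B")
      case True
      define q where "q = (u \<bullet> y)\<^sup>2"
      have l: "N \<le> lik_ratio d S y" using True by (auto simp: trunc_set_def)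
      have "0 \<le> (\<delta> * q - 1)\<^sup>2" by simp
      moreover have "(\<delta> * q - 1)\<^sup>2 = \<delta> * q * (\<delta> * q) - 2 * (\<delta> * q) + 1"
        by (simp add: power2_eq_square algebra_simps)
      ultimately have "2 * (\<delta> * q) \<le> \<delta> * q * (\<delta> * q) + 1" by simp
      then have "q \<le> \<delta> / 2 * q\<^sup>2 + 1 / (2 * \<delta>)" using \<delta> by (simp add: field_simps power2_eq_square)
      also have "\<delta> / 2 * q\<^sup>2 \<le> \<delta> / 2 * (q\<^sup>2 * exp (q / 16))"
        using \<delta> by (intro mult_left_mono) (auto simp: q_def mult_le_cancel_left1)
      also have "1 / (2 * \<delta>) \<le> \<delta> / 2 * (lik_ratio d S y powr \<eta>)"
      proof -
        have "1 = \<delta> * \<delta> * N powr \<eta>" using N by (simp add: \<delta>_def powr_add[symmetric])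
        also have "\<dots> \<le> \<delta> * \<delta> * lik_ratio d S y powr \<eta>"
          using \<delta> l N \<eta> by (intro mult_left_mono powr_mono2) auto
        finally show ?thesis using \<delta> by (simp add: field_simps)
      qed
      finally have "q \<le> \<delta> / 2 * (q\<^sup>2 * exp (q / 16)) + \<delta> / 2 * (lik_ratio d S y powr \<eta>)" by simp
      then have "ennreal q \<le> ennreal (\<delta> / 2 * (q\<^sup>2 * exp (q / 16)) + \<delta> / 2 * (lik_ratio d S y powr \<eta>))" by (rule ennreal_leI)
      then show ?thesis using True \<delta> unfolding q_def[symmetric] by (simp add: ennreal_plus)
    qed simp
  qed
  also have "\<dots> = (\<integral>\<^sup>+y. ennreal (\<delta> / 2 * (((u \<bullet> y)\<^sup>2)\<^sup>2 * exp ((u \<bullet> y)\<^sup>2 / 16))) \<partial>std_gauss d)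
     + (\<integral>\<^sup>+y. ennreal (\<delta> / 2 * (lik_ratio d S y powr \<eta>)) \<partial>std_gauss d)"
    by (rule nn_integral_add) measurable
  also have "\<dots> \<le> ennreal (\<delta> / 2 * 1024) + ennreal (\<delta> / 2 * moment_bound \<eta>)"
    using \<delta> by (intro add_mono nn_integral_ennreal_mult_left std_gauss_fourth_moment[OF u] moment_lik_ratio[OF \<eta>]) auto
  also have "\<dots> = ennreal (\<delta> * (512 + moment_bound \<eta> / 2))"
    using \<delta> scale_ub_pos \<eta> by (subst ennreal_plus[symmetric]) (auto simp: moment_bound_def algebra_simps)
  finally have "(\<integral>y. indicator ?B y * (u \<bullet> y)\<^sup>2 \<partial>std_gauss d) \<le> \<delta> * (512 + moment_bound \<eta> / 2)"
    by (subst (asm) ennreal_le_iff) (use \<delta> scale_ub_pos \<eta> in \<open>auto simp: moment_bound_def\<close>)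
  moreover have "0 \<le> (\<integral>y. indicator ?B y * (u \<bullet> y)\<^sup>2 \<partial>std_gauss d)"
    by (intro integral_nonneg_AE always_eventually) auto
  ultimately show ?thesis unfolding eq \<delta>_def by simp
qed

context
  fixes M :: "'w measure" and X :: "nat \<Rightarrow> 'w \<Rightarrow> real Matrix.vec" and n :: nat
  assumes prob: "prob_space M"
    and indep: "prob_space.indep_vars M (\<lambda>_. vec_borel d) X {1..n}"
    and dist: "\<And>i. i \<in> {1..n} \<Longrightarrow>
      distributed M (vec_lborel d) (X i) (\<lambda>x. ennreal (gauss_density d (0\<^sub>v d) S x))"
    and n: "1 \<le> n"
begin

definition trunc_error :: "real \<Rightarrow> real Matrix.vec \<Rightarrow> 'w \<Rightarrow> real" where
  "trunc_error N u \<omega> = \<bar>1 / real n * (\<Sum>i=1..n. trunc_term N u (X i \<omega>)) - trunc_mean N u\<bar>"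

lemma measurable_trunc_error: "trunc_error N u \<in> borel_measurable M"
  unfolding trunc_error_def
  using sample_measurable[OF prob dist]
  by (intro borel_measurable_abs borel_measurable_diff borel_measurable_times borel_measurable_sum)
     (auto intro: measurable_compose[OF _ measurable_trunc_term])

lemma trunc_error_tail:
  assumes u: "u \<in> carrier_vec d" "u \<bullet> u \<le> 2" and N: "0 < N" and \<theta>: "0 < \<theta>" "\<theta> \<le> 1 / 16"
  shows "measure M {\<omega> \<in> space M. t \<le> trunc_error N u \<omega>} \<le> 2 * exp (- (real n / N) * (\<theta> * t - 1024 * \<theta>\<^sup>2))"
proof -
  interpret prob_space M by (rule prob)
  have "indep_vars (\<lambda>_. borel) (\<lambda>i \<omega>. trunc_term N u (X i \<omega>)) {1..n}"
    by (rule indep_vars_compose2[OF indep]) measurable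
  from chernoff_two_sided[OF this _ trunc_mgf(1)[OF prob dist u N \<theta>] trunc_mgf(2)[OF prob dist u N \<theta>], of t] N \<theta>
  have "prob {\<omega> \<in> space M. real n * t \<le> \<bar>(\<Sum>i=1..n. trunc_term N u (X i \<omega>)) - real n * trunc_mean N u\<bar>}
      \<le> 2 * exp (- real n * (\<theta> / N * t - 1024 * \<theta>\<^sup>2 / N))" by simp
  also have "- real n * (\<theta> / N * t - 1024 * \<theta>\<^sup>2 / N) = - (real n / N) * (\<theta> * t - 1024 * \<theta>\<^sup>2)"
    using N by (simp add: field_simps)
  also have "{\<omega> \<in> space M. real n * t \<le> \<bar>(\<Sum>i=1..n. trunc_term N u (X i \<omega>)) - real n * trunc_mean N u\<bar>}
      = {\<omega> \<in> space M. t \<le> trunc_error N u \<omega>}"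
  proof (intro Collect_cong conj_cong refl)
    fix \<omega>
    have "\<bar>(\<Sum>i=1..n. trunc_term N u (X i \<omega>)) - real n * trunc_mean N u\<bar> = real n * trunc_error N u \<omega>"
    proof -
      have "(\<Sum>i=1..n. trunc_term N u (X i \<omega>)) - real n * trunc_mean N u
         = real n * (1 / real n * (\<Sum>i=1..n. trunc_term N u (X i \<omega>)) - trunc_mean N u)"
        using n by (simp add: right_diff_distrib)
      then show ?thesis by (simp add: trunc_error_def abs_mult)
    qed
    then show "real n * t \<le> \<bar>(\<Sum>i=1..n. trunc_term N u (X i \<omega>)) - real n * trunc_mean N u\<bar> \<longleftrightarrow> t \<le> trunc_error N u \<omega>"
      using n by simp
  qed
  finally show ?thesis .
qed

lemma trunc_error_grid_tail:
  assumes N: "0 < N" and \<theta>: "0 < \<theta>" "\<theta> \<le> 1 / 16"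
  shows "{\<omega> \<in> space M. \<exists>u\<in>grid d. t \<le> trunc_error N u \<omega>} \<in> sets M"
    and "measure M {\<omega> \<in> space M. \<exists>u\<in>grid d. t \<le> trunc_error N u \<omega>}
      \<le> real (2 * d\<^sup>2 + 1) ^ d * (2 * exp (- (real n / N) * (\<theta> * t - 1024 * \<theta>\<^sup>2)))"
proof -
  interpret prob_space M by (rule prob)
  have eq: "{\<omega> \<in> space M. \<exists>u\<in>grid d. t \<le> trunc_error N u \<omega>} = (\<Union>u\<in>grid d. {\<omega> \<in> space M. t \<le> trunc_error N u \<omega>})"
    by auto
  have sets: "{\<omega> \<in> space M. t \<le> trunc_error N u \<omega>} \<in> sets M" for u
    using measurable_trunc_error[of N u] by measurable
  then show "{\<omega> \<in> space M. \<exists>u\<in>grid d. t \<le> trunc_error N u \<omega>} \<in> sets M"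
    unfolding eq by (intro sets.finite_UN finite_grid)
  have "measure M {\<omega> \<in> space M. \<exists>u\<in>grid d. t \<le> trunc_error N u \<omega>}
      \<le> (\<Sum>u\<in>grid d. measure M {\<omega> \<in> space M. t \<le> trunc_error N u \<omega>})"
    unfolding eq by (rule measure_UNION_le[OF finite_grid sets])
  also have "\<dots> \<le> (\<Sum>u\<in>grid d. 2 * exp (- (real n / N) * (\<theta> * t - 1024 * \<theta>\<^sup>2)))"
    by (intro sum_mono trunc_error_tail N \<theta>) (auto simp: grid_def)
  also have "\<dots> = real (card (grid d)) * (2 * exp (- (real n / N) * (\<theta> * t - 1024 * \<theta>\<^sup>2)))" by simp
  also have "\<dots> \<le> real ((2 * d\<^sup>2 + 1) ^ d) * (2 * exp (- (real n / N) * (\<theta> * t - 1024 * \<theta>\<^sup>2)))"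
    using card_grid[of d] by (intro mult_right_mono) (simp_all only: of_nat_le_iff, auto)
  finally show "measure M {\<omega> \<in> space M. \<exists>u\<in>grid d. t \<le> trunc_error N u \<omega>}
      \<le> real (2 * d\<^sup>2 + 1) ^ d * (2 * exp (- (real n / N) * (\<theta> * t - 1024 * \<theta>\<^sup>2)))" by simp
qed

text \<open>When no weight exceeds \<open>N\<close>, truncation does not change the sample, so the error in each grid
direction is the truncated error plus the truncation bias.\<close>
lemma op_norm_error_le:
  assumes d: "d \<ge> 1" and \<omega>: "\<omega> \<in> space M"
    and N: "0 < N" "\<And>i. i \<in> {1..n} \<Longrightarrow> indicator A (X i \<omega>) * lik_ratio d S (X i \<omega>) \<le> N"
    and err: "\<And>u. u \<in> grid d \<Longrightarrow> trunc_error N u \<omega> \<le> t"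
    and \<eta>: "0 \<le> \<eta>" "\<eta> * (1 / lam1 - 1) < 1"
  shows "op_norm d (emp_cov d n S A (\<lambda>i. X i \<omega>) - cond_cov d A)
       \<le> 4 * ((t + N powr - (\<eta> / 2) * (512 + moment_bound \<eta> / 2)) / prob_A d A)"
proof (rule op_norm_le[OF d])
  fix x :: "real Matrix.vec" assume x: "x \<in> carrier_vec d" "x \<bullet> x = 1"
  show "\<bar>x \<bullet> ((emp_cov d n S A (\<lambda>i. X i \<omega>) - cond_cov d A) *\<^sub>v x)\<bar>
      \<le> 4 * ((t + N powr - (\<eta> / 2) * (512 + moment_bound \<eta> / 2)) / prob_A d A)"
  proof (rule quad_form_le_of_grid[OF d emp_cov_error_symmetric _ x])
    fix u assume g: "u \<in> grid d"
    then have u: "u \<in> carrier_vec d" "u \<bullet> u \<le> 2" by (auto simp: grid_def)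
    have eq: "u \<bullet> ((emp_cov d n S A (\<lambda>i. X i \<omega>) - cond_cov d A) *\<^sub>v u)
       = (1 / real n * (\<Sum>k=1..n. lik_ratio d S (X k \<omega>) * indicator A (X k \<omega>) * (u \<bullet> X k \<omega>)\<^sup>2)
          - (\<integral>y. indicator A y * (u \<bullet> y)\<^sup>2 \<partial>std_gauss d)) / prob_A d A"
      by (rule emp_cov_error_form[OF u(1)]) (rule sample_carrier[OF prob dist \<omega>])
    have "lik_ratio d S (X k \<omega>) * indicator A (X k \<omega>) * (u \<bullet> X k \<omega>)\<^sup>2 = trunc_term N u (X k \<omega>)" if "k \<in> {1..n}" for k
      using N(2)[OF that] by (auto simp: trunc_term_def trunc_set_def indicator_def)
    then have sums: "(\<Sum>k=1..n. lik_ratio d S (X k \<omega>) * indicator A (X k \<omega>) * (u \<bullet> X k \<omega>)\<^sup>2) = (\<Sum>k=1..n. trunc_term N u (X k \<omega>))"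
      by (intro sum.cong refl)
    have "\<bar>1 / real n * (\<Sum>k=1..n. trunc_term N u (X k \<omega>)) - (\<integral>y. indicator A y * (u \<bullet> y)\<^sup>2 \<partial>std_gauss d)\<bar>
        \<le> t + N powr - (\<eta> / 2) * (512 + moment_bound \<eta> / 2)"
      using err[OF g] trunc_bias[OF u N(1) \<eta>] unfolding trunc_error_def by linarith
    then show "\<bar>u \<bullet> ((emp_cov d n S A (\<lambda>i. X i \<omega>) - cond_cov d A) *\<^sub>v u)\<bar>
        \<le> (t + N powr - (\<eta> / 2) * (512 + moment_bound \<eta> / 2)) / prob_A d A"
      unfolding eq sums using p_pos by (simp add: divide_right_mono)
  qed
qed

text \<open>A single point of large weight forces a large eigenvalue: test with the unit vector in the direction of
that point, and discard all other points, whose contributions are nonnegative.\<close>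
lemma emp_cov_large:
  assumes d: "d \<ge> 1" and \<omega>: "\<omega> \<in> space M" and i: "i \<in> {1..n}"
    and m: "0 \<le> m" "m \<le> indicator A (X i \<omega>) * lik_ratio d S (X i \<omega>)"
    and norm: "real d / 8 \<le> X i \<omega> \<bullet> X i \<omega>"
  shows "m * real d / (8 * real n) - (17 / prob_A d A)\<^sup>2 \<le> lambda_max (emp_cov d n S A (\<lambda>i. X i \<omega>))"
    and "m * real d / (8 * real n) - (17 / prob_A d A)\<^sup>2 - 16 / prob_A d A
       \<le> op_norm d (emp_cov d n S A (\<lambda>i. X i \<omega>) - cond_cov d A)"
proof -
  interpret G: prob_space "std_gauss d" by (rule prob_space_std_gauss)
  have carrier: "X k \<omega> \<in> carrier_vec d" if "k \<in> {1..n}" for k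
    by (rule sample_carrier[OF prob dist[OF that] \<omega>])
  have "X i \<omega> \<noteq> 0\<^sub>v d" using norm d by auto
  from normalize_vec[OF carrier[OF i] this] obtain u where u: "u \<in> carrier_vec d" "u \<bullet> u = 1"
    and Xu: "X i \<omega> = sqrt (X i \<omega> \<bullet> X i \<omega>) \<cdot>\<^sub>v u" .
  have "u \<bullet> X i \<omega> = sqrt (X i \<omega> \<bullet> X i \<omega>)"
    by (subst Xu) (use u in simp)
  then have sq: "(u \<bullet> X i \<omega>)\<^sup>2 = X i \<omega> \<bullet> X i \<omega>"
    using scalar_prod_self_nonneg[of "X i \<omega>"] by simp
  let ?w = "\<lambda>k. lik_ratio d S (X k \<omega>) * indicator A (X k \<omega>) * (u \<bullet> X k \<omega>)\<^sup>2"
  have "m * (real d / 8) \<le> (indicator A (X i \<omega>) * lik_ratio d S (X i \<omega>)) * (X i \<omega> \<bullet> X i \<omega>)"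
    using m norm by (intro mult_mono) auto
  also have "\<dots> = ?w i" by (simp add: sq)
  also have "\<dots> \<le> (\<Sum>k=1..n. ?w k)"
    using i by (intro member_le_sum) (auto simp: less_imp_le[OF lik_ratio_pos[OF carrier]])
  finally have sum: "m * (real d / 8) \<le> (\<Sum>k=1..n. ?w k)" .
  have p1: "prob_A d A \<le> 1" unfolding prob_A_def by simp
  have "m * real d / (8 * real n) = 1 / real n * (m * (real d / 8))" by simp
  also have "\<dots> \<le> 1 / (real n * prob_A d A) * (\<Sum>k=1..n. ?w k)"
  proof (rule mult_mono)
    have "real n * prob_A d A \<le> real n * 1" by (intro mult_left_mono p1) simp
    then show "1 / real n \<le> 1 / (real n * prob_A d A)"
      using n p_pos by (intro divide_left_mono) auto
  qed (use sum m p_pos in auto)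
  finally have main: "m * real d / (8 * real n) \<le> 1 / (real n * prob_A d A) * (\<Sum>k=1..n. ?w k)" .
  have "u \<bullet> (emp_cov d n S A (\<lambda>i. X i \<omega>) *\<^sub>v u) = 1 / (real n * prob_A d A) * (\<Sum>k=1..n. ?w k) - (cond_mean d A \<bullet> u)\<^sup>2"
    by (rule emp_cov_form[OF u(1)]) (rule carrier)
  moreover have "(cond_mean d A \<bullet> u)\<^sup>2 \<le> (17 / prob_A d A)\<^sup>2" using u by (intro cond_mean_bound) auto
  ultimately have emp: "m * real d / (8 * real n) - (17 / prob_A d A)\<^sup>2 \<le> u \<bullet> (emp_cov d n S A (\<lambda>i. X i \<omega>) *\<^sub>v u)"
    using main by linarith
  then show "m * real d / (8 * real n) - (17 / prob_A d A)\<^sup>2 \<le> lambda_max (emp_cov d n S A (\<lambda>i. X i \<omega>))"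
    using lambda_max_ge[OF d emp_cov_symmetric u(1), of n S "\<lambda>i. X i \<omega>"] u(2) by simp
  have car: "emp_cov d n S A (\<lambda>i. X i \<omega>) \<in> carrier_mat d d" "cond_cov d A \<in> carrier_mat d d"
    using emp_cov_symmetric cond_cov_symmetric symmetric_mat_carrier by auto
  have "u \<bullet> (cond_cov d A *\<^sub>v u) \<le> 16 / prob_A d A"
    using lambda_max_ge[OF d cond_cov_symmetric u(1)] lambda_max_cond_cov[OF d] u(2) by simp
  moreover have "u \<bullet> ((emp_cov d n S A (\<lambda>i. X i \<omega>) - cond_cov d A) *\<^sub>v u)
      = u \<bullet> (emp_cov d n S A (\<lambda>i. X i \<omega>) *\<^sub>v u) - u \<bullet> (cond_cov d A *\<^sub>v u)"
    using minus_mult_distrib_mat_vec[OF car u(1)] car u(1) by (simp add: scalar_prod_minus_distrib[of _ d])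
  moreover have "\<bar>u \<bullet> ((emp_cov d n S A (\<lambda>i. X i \<omega>) - cond_cov d A) *\<^sub>v u)\<bar> \<le> op_norm d (emp_cov d n S A (\<lambda>i. X i \<omega>) - cond_cov d A)"
    using car u by (intro op_norm_ge) auto
  ultimately show "m * real d / (8 * real n) - (17 / prob_A d A)\<^sup>2 - 16 / prob_A d A
       \<le> op_norm d (emp_cov d n S A (\<lambda>i. X i \<omega>) - cond_cov d A)"
    using emp by linarith
qed

end

text \<open>Let \<open>B\<close> be the part of \<open>A\<close> on which the squares of the spike coordinates sum to
less than \<open>c\<^sup>2\<close>; it carries at least half of the mass of \<open>A\<close>. Translating by
\<open>T v 1\<close> keeps it inside \<open>A\<close> and makes the first spike coordinate about \<open>T\<close>,
hence the likelihood ratio about \<open>exp ((1 / lam1 - 1) T\<^sup>2 / 2)\<close>. The Cameron-Martin factor costs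
\<open>exp (- T\<^sup>2 / 2)\<close> and the change of law costs the inverse of the likelihood ratio.\<close>
lemma weighted_tail_lower:
  assumes prob: "prob_space M"
    and dist: "distributed M (vec_lborel d) X (\<lambda>x. ennreal (gauss_density d (0\<^sub>v d) S x))"
    and inv: "\<And>y t. y \<in> carrier_vec d \<Longrightarrow> y + t \<cdot>\<^sub>v v 1 \<in> A \<longleftrightarrow> y \<in> A"
    and c: "0 < c" "c \<le> T" "2 * (exp (- c\<^sup>2 / 4) * sqrt 2 ^ R) \<le> prob_A d A"
  shows "prob_A d A / (2 * scale_ub) * exp (- T * c - T\<^sup>2 / 2 - (1 / lam1 - 1) / 2 * ((T + c)\<^sup>2 + c\<^sup>2))
    \<le> measure M {\<omega> \<in> space M. X \<omega> \<in> {y \<in> A. scale_lb * exp (((1 / lam1 - 1) * (T - c)\<^sup>2 - c\<^sup>2) / 2) \<le> lik_ratio d S y}}"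
proof -
  interpret prob_space M by (rule prob)
  interpret G: prob_space "std_gauss d" by (rule prob_space_std_gauss)
  note [measurable] = sample_measurable[OF prob dist]
  have [measurable]: "A \<in> sets (vec_borel d)" by (rule A_sets)
  have AG: "A \<in> sets (std_gauss d)" using A_sets by (simp add: sets_gauss_law)
  define a where "a = 1 / lam1 - 1"
  have a: "0 \<le> a" using lam1 by (simp add: a_def)
  have k1: "1 \<in> {1..r}" using rank by simp
  have v1: "v 1 \<in> carrier_vec d" by (rule v_carrier[OF k1])
  define u where "u = T \<cdot>\<^sub>v v 1"
  have u: "u \<in> carrier_vec d" using v1 by (simp add: u_def)
  have uu: "u \<bullet> u = T\<^sup>2" using v1 orthonormal[OF k1 k1] by (simp add: u_def power2_eq_square)
  define B where "B = {y \<in> A. spike_sq y < c\<^sup>2}"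
  have B_sets: "B \<in> sets (vec_borel d)"
    unfolding B_def by (rule sets_Collect_A) measurable
  have BG: "B \<in> sets (std_gauss d)" using B_sets by (simp add: sets_gauss_law)
  have vk: "v k \<bullet> (y + u) = v k \<bullet> y + (if k = 1 then T else 0)" if "k \<in> {1..r}" "y \<in> carrier_vec d" for k y
    using that v_carrier[OF that(1)] v1 orthonormal[OF that(1) k1]
    by (simp add: u_def scalar_prod_add_distrib[of _ d])
  have split1: "(\<Sum>k=1..r. f k) = f 1 + (\<Sum>k\<in>{2..r}. f k)" for f :: "nat \<Rightarrow> real"
  proof -
    have "{1..r} = insert 1 {2..r}" using rank by auto
    then show ?thesis by simp
  qed
  have B_facts: "\<bar>v 1 \<bullet> y\<bar> \<le> c" "(\<Sum>k\<in>{2..r}. (v k \<bullet> y)\<^sup>2) \<le> c\<^sup>2" if "y \<in> B" for y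
  proof -
    have s: "(v 1 \<bullet> y)\<^sup>2 + (\<Sum>k\<in>{2..r}. (v k \<bullet> y)\<^sup>2) \<le> c\<^sup>2"
      using that unfolding B_def spike_sq_def split1 by simp
    have "0 \<le> (\<Sum>k\<in>{2..r}. (v k \<bullet> y)\<^sup>2)" by (simp add: sum_nonneg)
    with s have "\<bar>v 1 \<bullet> y\<bar>\<^sup>2 \<le> c\<^sup>2" by simp
    then show "\<bar>v 1 \<bullet> y\<bar> \<le> c" by (rule power2_le_imp_le) (use c in simp)
    show "(\<Sum>k\<in>{2..r}. (v k \<bullet> y)\<^sup>2) \<le> c\<^sup>2" using s zero_le_power2[of "v 1 \<bullet> y"] by linarith
  qed
  have form: "spike_form (y + u) = a * (v 1 \<bullet> y + T)\<^sup>2 + (\<Sum>k\<in>{2..r}. (1 / lam k - 1) * (v k \<bullet> y)\<^sup>2)"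
    if "y \<in> carrier_vec d" for y
    unfolding spike_form_def split1 using vk[OF k1 that] vk[OF _ that]
    by (simp add: a_def lam_first[unfolded One_nat_def])
  have rest_upper: "(\<Sum>k\<in>{2..r}. (1 / lam k - 1) * (v k \<bullet> y)\<^sup>2) \<le> a * c\<^sup>2" if "y \<in> B" for y
  proof -
    have "(\<Sum>k\<in>{2..r}. (1 / lam k - 1) * (v k \<bullet> y)\<^sup>2) \<le> (\<Sum>k\<in>{2..r}. a * (v k \<bullet> y)\<^sup>2)"
      unfolding a_def by (intro sum_mono mult_right_mono inverse_lam_le) auto
    also have "\<dots> \<le> a * c\<^sup>2"
      unfolding sum_distrib_left[symmetric] using a B_facts(2)[OF that] by (rule mult_left_mono[rotated])
    finally show ?thesis .
  qed
  have rest_lower: "- (c\<^sup>2) \<le> (\<Sum>k\<in>{2..r}. (1 / lam k - 1) * (v k \<bullet> y)\<^sup>2)" if "y \<in> B" for y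
  proof -
    have "- (c\<^sup>2) \<le> (\<Sum>k\<in>{2..r}. - 1 * (v k \<bullet> y)\<^sup>2)" using B_facts(2)[OF that] by (simp add: sum_negf)
    also have "\<dots> \<le> (\<Sum>k\<in>{2..r}. (1 / lam k - 1) * (v k \<bullet> y)\<^sup>2)"
    proof (intro sum_mono mult_right_mono)
      fix k assume "k \<in> {2..r}"
      then have "0 < lam k" by (intro lam_pos) auto
      then show "- 1 \<le> 1 / lam k - 1" by simp
    qed simp
    finally show ?thesis .
  qed
  define hi where "hi = scale_ub * exp (a / 2 * ((T + c)\<^sup>2 + c\<^sup>2))"
  define lo where "lo = scale_lb * exp ((a * (T - c)\<^sup>2 - c\<^sup>2) / 2)"
  have hi_pos: "0 < hi" using scale_ub_pos by (simp add: hi_def)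
  have lik_bounds: "lo \<le> lik_ratio d S (y + u)" "lik_ratio d S (y + u) \<le> hi" if y: "y \<in> B" for y
  proof -
    have yc: "y \<in> carrier_vec d" using y A_carrier by (auto simp: B_def)
    have yu: "y + u \<in> carrier_vec d" using yc u by simp
    have s1: "- c \<le> v 1 \<bullet> y" "v 1 \<bullet> y \<le> c" using B_facts(1)[OF y] by auto
    have "(v 1 \<bullet> y + T)\<^sup>2 \<le> (T + c)\<^sup>2" using s1 c by (intro power_mono) auto
    then have "a * (v 1 \<bullet> y + T)\<^sup>2 \<le> a * (T + c)\<^sup>2" using a by (rule mult_left_mono)
    then have "spike_form (y + u) \<le> a * ((T + c)\<^sup>2 + c\<^sup>2)"
      unfolding form[OF yc] using rest_upper[OF y] by (simp add: distrib_left)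
    then have "exp (spike_form (y + u) / 2) \<le> exp (a / 2 * ((T + c)\<^sup>2 + c\<^sup>2))" by simp
    then show "lik_ratio d S (y + u) \<le> hi"
      unfolding lik_ratio_eq[OF yu] hi_def using scale_upper scale_ub_pos by (intro mult_mono) auto
    have "(T - c)\<^sup>2 \<le> (v 1 \<bullet> y + T)\<^sup>2" using s1 c by (intro power_mono) auto
    then have "a * (T - c)\<^sup>2 \<le> a * (v 1 \<bullet> y + T)\<^sup>2" using a by (rule mult_left_mono)
    then have "a * (T - c)\<^sup>2 - c\<^sup>2 \<le> spike_form (y + u)"
      unfolding form[OF yc] using rest_lower[OF y] by simp
    then have "exp ((a * (T - c)\<^sup>2 - c\<^sup>2) / 2) \<le> exp (spike_form (y + u) / 2)" by simp
    then show "lo \<le> lik_ratio d S (y + u)"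
      unfolding lik_ratio_eq[OF yu] lo_def using scale_lower scale_pos by (intro mult_mono) auto
  qed
  have PB: "prob_A d A / 2 \<le> measure (std_gauss d) B"
  proof -
    let ?C = "{y \<in> carrier_vec d. c\<^sup>2 \<le> spike_sq y}"
    have C: "?C \<in> sets (std_gauss d)" by (rule sets_std_gauss_Collect) measurable
    have "A \<subseteq> B \<union> ?C" using A_carrier by (auto simp: B_def)
    then have "prob_A d A \<le> G.prob (B \<union> ?C)"
      unfolding prob_A_def using BG C by (intro G.finite_measure_mono) auto
    also have "\<dots> \<le> G.prob B + G.prob ?C" using BG C by (rule measure_Un_le)
    also have "G.prob ?C \<le> exp (- c\<^sup>2 / 4) * sqrt 2 ^ R"
      using spike_sq_tail[of "c\<^sup>2"] unfolding G.emeasure_eq_measure by (subst (asm) ennreal_le_iff) auto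
    finally show ?thesis using c(3) by simp
  qed
  let ?H = "{y \<in> A. lo \<le> lik_ratio d S y}"
  have H: "?H \<in> sets (vec_borel d)"
    by (rule sets_Collect_A) measurable
  (* F cancels the Cameron-Martin factor, so that its translate integrates to the probability wanted. *)
  define F :: "real Matrix.vec \<Rightarrow> ennreal" where
    "F y = ennreal (exp (T\<^sup>2 / 2 - u \<bullet> y)) * (ennreal (1 / lik_ratio d S y) * indicator ?H y)" for y
  have F [measurable]: "F \<in> borel_measurable (vec_borel d)"
    unfolding F_def using H by measurable
  have "exp (- T * c - T\<^sup>2 / 2) / hi * (prob_A d A / 2) \<le> exp (- T * c - T\<^sup>2 / 2) / hi * G.prob B"
    by (intro mult_left_mono PB) (use hi_pos in simp)
  then have "ennreal (exp (- T * c - T\<^sup>2 / 2) / hi * (prob_A d A / 2)) \<le> ennreal (exp (- T * c - T\<^sup>2 / 2) / hi * G.prob B)"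
    by (rule ennreal_leI)
  also have "\<dots> = ennreal (exp (- T * c - T\<^sup>2 / 2) / hi) * emeasure (std_gauss d) B"
    unfolding G.emeasure_eq_measure by (rule ennreal_mult') (use hi_pos in simp)
  also have "\<dots> = (\<integral>\<^sup>+y. ennreal (exp (- T * c - T\<^sup>2 / 2) / hi) * indicator B y \<partial>std_gauss d)"
    using BG by (simp add: nn_integral_cmult_indicator)
  also have "\<dots> \<le> (\<integral>\<^sup>+y. F (y + u) \<partial>std_gauss d)"
  proof (intro nn_integral_mono)
    fix y
    show "ennreal (exp (- T * c - T\<^sup>2 / 2) / hi) * indicator B y \<le> F (y + u)"
    proof (cases "y \<in> B")
      case True
      then have y: "y \<in> carrier_vec d" "y \<in> A" using A_carrier by (auto simp: B_def)
      have yu: "y + u \<in> carrier_vec d" using y u by simp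
      have "y + u \<in> ?H" using lik_bounds(1)[OF True] inv[OF y(1), of T] y(2) by (simp add: u_def)
      then have Fy: "F (y + u) = ennreal (exp (T\<^sup>2 / 2 - u \<bullet> (y + u)) * (1 / lik_ratio d S (y + u)))"
        by (simp add: F_def ennreal_mult'[symmetric])
      have uy: "u \<bullet> (y + u) = T * (v 1 \<bullet> y) + T\<^sup>2"
        using u y v1 uu by (simp add: scalar_prod_add_distrib[of _ d]) (simp add: u_def)
      have "T * (v 1 \<bullet> y) \<le> T * c" using B_facts(1)[OF True] c by (intro mult_left_mono) auto
      then have "exp (- T * c - T\<^sup>2 / 2) \<le> exp (T\<^sup>2 / 2 - u \<bullet> (y + u))" unfolding uy by simp
      moreover have "1 / hi \<le> 1 / lik_ratio d S (y + u)"
        using lik_bounds(2)[OF True] lik_ratio_pos[OF yu] hi_pos by (intro divide_left_mono) auto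
      ultimately have "exp (- T * c - T\<^sup>2 / 2) * (1 / hi) \<le> exp (T\<^sup>2 / 2 - u \<bullet> (y + u)) * (1 / lik_ratio d S (y + u))"
        using hi_pos by (intro mult_mono) auto
      then show ?thesis unfolding Fy using True by (simp add: ennreal_leI)
    qed simp
  qed
  also have "\<dots> = (\<integral>\<^sup>+y. ennreal (exp (u \<bullet> y - (u \<bullet> u) / 2)) * F y \<partial>std_gauss d)"
    by (rule cameron_martin[OF u F])
  also have "\<dots> = (\<integral>\<^sup>+y. ennreal (1 / lik_ratio d S y) * indicator ?H y \<partial>std_gauss d)"
  proof (intro nn_integral_cong)
    fix y
    have "exp (u \<bullet> y - (u \<bullet> u) / 2) * exp (T\<^sup>2 / 2 - u \<bullet> y) = 1" unfolding uu exp_add[symmetric] by simp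
    then show "ennreal (exp (u \<bullet> y - (u \<bullet> u) / 2)) * F y = ennreal (1 / lik_ratio d S y) * indicator ?H y"
      unfolding F_def mult.assoc[symmetric] by (simp add: ennreal_mult'[symmetric])
  qed
  also have "\<dots> = (\<integral>\<^sup>+\<omega>. indicator ?H (X \<omega>) \<partial>M)"
    by (rule sample_law[OF prob dist, symmetric]) (use H in measurable)
  also have "\<dots> = (\<integral>\<^sup>+\<omega>. indicator {\<omega> \<in> space M. X \<omega> \<in> ?H} \<omega> \<partial>M)"
    by (intro nn_integral_cong) (auto simp: indicator_def)
  also have "\<dots> = emeasure M {\<omega> \<in> space M. X \<omega> \<in> ?H}"
    by (rule nn_integral_indicator) (use H in measurable)
  finally have "exp (- T * c - T\<^sup>2 / 2) / hi * (prob_A d A / 2) \<le> measure M {\<omega> \<in> space M. X \<omega> \<in> ?H}"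
    unfolding emeasure_eq_measure by (subst (asm) ennreal_le_iff) auto
  moreover have "exp (- T * c - T\<^sup>2 / 2) / hi * (prob_A d A / 2)
      = prob_A d A / (2 * scale_ub) * exp (- T * c - T\<^sup>2 / 2 - a / 2 * ((T + c)\<^sup>2 + c\<^sup>2))"
    unfolding hi_def exp_diff by (simp add: field_simps)
  ultimately show ?thesis unfolding lo_def a_def by simp
qed

end

section \<open>Convergence in distribution to a constant\<close>

text \<open>The distribution function of the limit 0 is a step, continuous except at 0; convergence in distribution to
0 of nonnegative variables is therefore convergence in probability.\<close>
lemma cdf_return_zero: "cdf (return borel (0::real)) x = (if 0 \<le> x then 1 else 0)"
  by (simp add: cdf_def measure_return indicator_def)

lemma isCont_cdf_return_zero_pos:
  assumes "0 < x"
  shows "isCont (cdf (return borel (0::real))) x"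
proof -
  have "eventually (\<lambda>y. y \<in> {0<..}) (nhds x)"
    using assms by (intro eventually_nhds_in_open) auto
  then have "eventually (\<lambda>y. cdf (return borel (0::real)) y = 1) (nhds x)"
    by eventually_elim (simp add: cdf_return_zero)
  then show ?thesis by (subst isCont_cong[where g = "\<lambda>_. 1"]) auto
qed

lemma not_isCont_cdf_return_zero: "\<not> isCont (cdf (return borel (0::real))) 0"
proof
  assume "isCont (cdf (return borel (0::real))) 0"
  moreover have "(\<lambda>m. - inverse (real (Suc m))) \<longlonglongrightarrow> 0"
    using tendsto_minus[OF LIMSEQ_inverse_real_of_nat] by simp
  ultimately have "(\<lambda>m. cdf (return borel (0::real)) (- inverse (real (Suc m)))) \<longlonglongrightarrow> cdf (return borel 0) 0"
    by (rule isCont_tendsto_compose)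
  then have "(\<lambda>m::nat. 0::real) \<longlonglongrightarrow> 1"
    by (simp add: cdf_return_zero del: of_nat_Suc)
  then show False using LIMSEQ_unique[OF _ tendsto_const] by fastforce
qed

lemma conv_distr_zeroD:
  assumes conv: "conv_distr_const M Z 0" and \<epsilon>: "0 < \<epsilon>"
    and Z: "\<And>d. d \<ge> 1 \<Longrightarrow> Z d \<in> borel_measurable (M d)"
  shows "(\<lambda>d. measure (M d) {\<omega> \<in> space (M d). Z d \<omega> \<le> \<epsilon>}) \<longlonglongrightarrow> 1"
proof -
  have "(\<lambda>d. cdf (distr (M d) borel (Z d)) \<epsilon>) \<longlonglongrightarrow> cdf (return borel 0) \<epsilon>"
    using conv isCont_cdf_return_zero_pos[OF \<epsilon>]
    by (auto simp: conv_distr_const_def weak_conv_m_def weak_conv_def)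
  then have "(\<lambda>d. cdf (distr (M d) borel (Z d)) \<epsilon>) \<longlonglongrightarrow> 1" using \<epsilon> by (simp add: cdf_return_zero)
  moreover have "eventually (\<lambda>d. cdf (distr (M d) borel (Z d)) \<epsilon> = measure (M d) {\<omega> \<in> space (M d). Z d \<omega> \<le> \<epsilon>}) sequentially"
    using eventually_ge_at_top[of 1]
    by eventually_elim (simp add: cdf_def measure_distr[OF Z] vimage_def Int_def conj_commute)
  ultimately show ?thesis by (rule Lim_transform_eventually)
qed

lemma conv_distr_zeroI:
  assumes prob: "\<And>d. d \<ge> 1 \<Longrightarrow> prob_space (M d)"
    and Z: "\<And>d. d \<ge> 1 \<Longrightarrow> Z d \<in> borel_measurable (M d)"
    and nonneg: "\<And>d \<omega>. d \<ge> 1 \<Longrightarrow> \<omega> \<in> space (M d) \<Longrightarrow> 0 \<le> Z d \<omega>"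
    and tail: "\<And>\<epsilon>. 0 < \<epsilon> \<Longrightarrow> (\<lambda>d. measure (M d) {\<omega> \<in> space (M d). \<epsilon> < Z d \<omega>}) \<longlonglongrightarrow> 0"
  shows "conv_distr_const M Z 0"
  unfolding conv_distr_const_def weak_conv_m_def weak_conv_def
proof (intro allI impI)
  fix x :: real assume x: "isCont (cdf (return borel 0)) x"
  have cdf: "cdf (distr (M d) borel (Z d)) x = measure (M d) {\<omega> \<in> space (M d). Z d \<omega> \<le> x}" if "d \<ge> 1" for d
    by (simp add: cdf_def measure_distr[OF Z[OF that]] vimage_def Int_def conj_commute)
  consider "x < 0" | "x = 0" | "0 < x" by linarith
  then show "(\<lambda>d. cdf (distr (M d) borel (Z d)) x) \<longlonglongrightarrow> cdf (return borel 0) x"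
  proof cases
    case 1
    have "eventually (\<lambda>d. cdf (distr (M d) borel (Z d)) x = 0) sequentially"
      using eventually_ge_at_top[of 1]
    proof eventually_elim
      case (elim d)
      have "{\<omega> \<in> space (M d). Z d \<omega> \<le> x} = {}" using nonneg[OF elim] 1 by fastforce
      then show ?case by (simp only: cdf[OF elim] measure_empty)
    qed
    then show ?thesis using 1 by (simp add: cdf_return_zero tendsto_eventually)
  next
    case 2
    then show ?thesis using x not_isCont_cdf_return_zero by simp
  next
    case 3
    have "(\<lambda>d. 1 - measure (M d) {\<omega> \<in> space (M d). x < Z d \<omega>}) \<longlonglongrightarrow> 1 - 0"
      by (intro tendsto_intros tail 3)
    moreover have "eventually (\<lambda>d. 1 - measure (M d) {\<omega> \<in> space (M d). x < Z d \<omega>} = cdf (distr (M d) borel (Z d)) x) sequentially"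
      using eventually_ge_at_top[of 1]
    proof eventually_elim
      case (elim d)
      interpret prob_space "M d" by (rule prob[OF elim])
      have [measurable]: "Z d \<in> borel_measurable (M d)" by (rule Z[OF elim])
      have s: "{\<omega> \<in> space (M d). x < Z d \<omega>} \<in> sets (M d)" by measurable
      have "{\<omega> \<in> space (M d). Z d \<omega> \<le> x} = space (M d) - {\<omega> \<in> space (M d). x < Z d \<omega>}" by auto
      then show ?case using prob_compl[OF s] by (simp add: cdf[OF elim])
    qed
    ultimately show ?thesis using 3 by (simp add: cdf_return_zero) (rule Lim_transform_eventually)
  qed
qed

lemma filterlim_powr_at_top:
  assumes "0 < a"
  shows "filterlim (\<lambda>x::real. x powr a) at_top at_top"
proof -
  have "filterlim (\<lambda>x::real. exp (a * ln x)) at_top at_top"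
    by (intro filterlim_compose[OF exp_at_top] filterlim_tendsto_pos_mult_at_top[OF tendsto_const assms] ln_at_top)
  then show ?thesis
    by (rule filterlim_at_top_mono)
       (use eventually_gt_at_top[of 0] in \<open>eventually_elim, simp add: powr_def\<close>)
qed

lemma filterlim_quadratic_at_top:
  fixes A B C :: real
  assumes A: "0 < A"
  shows "filterlim (\<lambda>T. A * T\<^sup>2 + B * T + C) at_top at_top"
proof -
  have "filterlim (\<lambda>T::real. A * T) at_top at_top"
    by (rule filterlim_tendsto_pos_mult_at_top[OF tendsto_const A filterlim_ident])
  then have "filterlim (\<lambda>T::real. B + A * T) at_top at_top"
    by (rule filterlim_tendsto_add_at_top[OF tendsto_const])
  then have "filterlim (\<lambda>T::real. T * (B + A * T)) at_top at_top"
    by (rule filterlim_at_top_mult_at_top[OF filterlim_ident])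
  then have "filterlim (\<lambda>T::real. C + T * (B + A * T)) at_top at_top"
    by (rule filterlim_tendsto_add_at_top[OF tendsto_const])
  then show ?thesis by (simp add: power2_eq_square algebra_simps)
qed

text \<open>Adding a vector orthogonal to \<open>U\<close> does not change the condition that defines the orthogonal
projection on \<open>U\<close>, so both vectors have the same projection.\<close>
lemma spike_invariance:
  assumes U: "is_subspace d U" and v: "v \<in> carrier_vec d" "v \<in> orth_compl d U"
    and A_U: "\<And>x. x \<in> carrier_vec d \<Longrightarrow> x \<in> A \<longleftrightarrow> orth_proj d U x \<in> A"
    and y: "y \<in> carrier_vec d"
  shows "y + t \<cdot>\<^sub>v v \<in> A \<longleftrightarrow> y \<in> A"
proof -
  have sub: "U \<subseteq> carrier_vec d"
    using U unfolding VectorSpace.subspace_def submodule_def by (auto simp: module_vec_simps)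
  have "(u \<in> U \<and> (y + t \<cdot>\<^sub>v v) - u \<in> orth_compl d U) \<longleftrightarrow> (u \<in> U \<and> y - u \<in> orth_compl d U)" for u
  proof (rule conj_cong[OF refl])
    assume "u \<in> U"
    then have u: "u \<in> carrier_vec d" using sub by auto
    have "((y + t \<cdot>\<^sub>v v) - u) \<bullet> w = (y - u) \<bullet> w" if w: "w \<in> U" for w
    proof -
      have wc: "w \<in> carrier_vec d" using w sub by auto
      have "(y + t \<cdot>\<^sub>v v) - u = (y - u) + t \<cdot>\<^sub>v v" using y u v by (intro eq_vecI) auto
      moreover have "v \<bullet> w = 0" using v(2) w by (simp add: orth_compl_def)
      ultimately show ?thesis
        using y u v wc by (simp add: add_scalar_prod_distrib[of _ d])
    qed
    then show "(y + t \<cdot>\<^sub>v v) - u \<in> orth_compl d U \<longleftrightarrow> y - u \<in> orth_compl d U"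
      using y u v(1) by (simp add: orth_compl_def)
  qed
  then have "orth_proj d U (y + t \<cdot>\<^sub>v v) = orth_proj d U y" by (simp add: orth_proj_def)
  then show ?thesis using A_U[of y] A_U[of "y + t \<cdot>\<^sub>v v"] y v(1) by simp
qed

lemma in_vec_span:
  assumes "B \<subseteq> carrier_vec d" "x \<in> B"
  shows "x \<in> vec_span d B"
proof -
  have "Module.module (class_ring :: real ring) (module_vec TYPE(real) d)"
    using vec_vs[where 'a = real and n = d] by (simp add: vectorspace_def)
  from module.in_own_span[OF this, of B] assms show ?thesis
    by (auto simp: vec_span_def module_vec_simps)
qed

section \<open>The critical exponent of the maximal weight\<close>

text \<open>The hypotheses on the sample, the spikes and the weights. What the orthogonality of \<open>U\<close> and
\<open>V\<close> contributes is the translation invariance assumed in \<open>gamma_lower\<close> below.\<close>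
locale importance_sampling =
  fixes \<kappa> lam1 \<gamma>s :: real
    and n r :: "nat \<Rightarrow> nat"
    and A :: "nat \<Rightarrow> real Matrix.vec set"
    and S :: "nat \<Rightarrow> real Matrix.mat"
    and lam :: "nat \<Rightarrow> nat \<Rightarrow> real"
    and v :: "nat \<Rightarrow> nat \<Rightarrow> real Matrix.vec"
    and M :: "nat \<Rightarrow> 'w measure"
    and X :: "nat \<Rightarrow> nat \<Rightarrow> 'w \<Rightarrow> real Matrix.vec"
  assumes kappa: "\<kappa> > 0"
    and n: "\<And>d. d \<ge> 1 \<Longrightarrow> \<bar>real (n d) - real d powr \<kappa>\<bar> < 1"
    and A: "\<And>d. d \<ge> 1 \<Longrightarrow> A d \<in> sets (vec_borel d)"
    and M: "\<And>d. d \<ge> 1 \<Longrightarrow> prob_space (M d)"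
    and X_indep: "\<And>d. d \<ge> 1 \<Longrightarrow>
          prob_space.indep_vars (M d) (\<lambda>_. vec_borel d) (X d) {1..n d}"
    and X_law: "\<And>d i. d \<ge> 1 \<Longrightarrow> i \<in> {1..n d} \<Longrightarrow>
          distributed (M d) (vec_lborel d) (X d i)
            (\<lambda>x. ennreal (gauss_density d (0\<^sub>v d) (S d) x))"
    and S: "\<And>d. d \<ge> 1 \<Longrightarrow> S d = spiked_cov d (r d) (lam d) (v d)"
    and r: "\<And>d. d \<ge> 1 \<Longrightarrow> r d \<ge> 1"
    and lam_mono: "\<And>d. d \<ge> 1 \<Longrightarrow> mono_on {1..r d} (lam d)"
    and v_carrier: "\<And>d k. d \<ge> 1 \<Longrightarrow> k \<in> {1..r d} \<Longrightarrow> v d k \<in> carrier_vec d"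
    and v_orthonormal: "\<And>d j k. d \<ge> 1 \<Longrightarrow> j \<in> {1..r d} \<Longrightarrow> k \<in> {1..r d} \<Longrightarrow>
          scalar_prod (v d j) (v d k) = (if j = k then 1 else 0)"
    and r_bdd: "bdd_above (r ` {1..})"
    and l1: "\<And>d. d \<ge> 1 \<Longrightarrow> lam d 1 = lam1"
    and l1_bounds: "0 < lam1" "lam1 \<le> 1"
    and lam_max_bdd: "bdd_above ((\<lambda>d. lambda_max (S d)) ` {1..})"
    and gamma_nonneg: "\<gamma>s \<ge> 0"
    and max_weight_0: "\<And>\<gamma>. \<gamma> > \<gamma>s \<Longrightarrow>
          conv_distr_const M
            (\<lambda>d \<omega>. 1 / real (n d) powr \<gamma> *
              Max ((\<lambda>i. indicator (A d) (X d i \<omega>) * lik_ratio d (S d) (X d i \<omega>)) ` {1..n d})) 0"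
    and max_weight_inf: "\<And>\<gamma>. \<gamma> < \<gamma>s \<Longrightarrow>
          conv_distr_infinity M
            (\<lambda>d \<omega>. 1 / real (n d) powr \<gamma> *
              Max ((\<lambda>i. indicator (A d) (X d i \<omega>) * lik_ratio d (S d) (X d i \<omega>)) ` {1..n d}))"
    and p_inf: "(INF d \<in> {1..}. prob_A d (A d)) > 0"
begin

definition "rank_bd = (SUP d\<in>{1..}. r d)"
definition "lam_bd = max 1 (SUP d\<in>{1..}. lambda_max (S d))"
definition "p_min = (INF d\<in>{1..}. prob_A d (A d))"

abbreviation "weight d i \<omega> \<equiv> indicator (A d) (X d i \<omega>) * lik_ratio d (S d) (X d i \<omega>)"

lemma p_min: "0 < p_min" "d \<ge> 1 \<Longrightarrow> p_min \<le> prob_A d (A d)"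
proof -
  show "0 < p_min" using p_inf by (simp add: p_min_def)
  show "p_min \<le> prob_A d (A d)" if "d \<ge> 1"
    unfolding p_min_def
  proof (rule cINF_lower)
    show "bdd_below ((\<lambda>d. prob_A d (A d)) ` {1..})" by (rule bdd_belowI2[of _ 0]) (simp add: prob_A_def)
  qed (use that in simp)
qed

lemma n_lower: "d \<ge> 1 \<Longrightarrow> real d powr \<kappa> / 2 \<le> real (n d)"
  and n_upper: "d \<ge> 1 \<Longrightarrow> real (n d) \<le> 2 * real d powr \<kappa>"
  and n_ge_1: "d \<ge> 1 \<Longrightarrow> 1 \<le> n d"
proof -
  assume d: "d \<ge> 1"
  have p: "1 \<le> real d powr \<kappa>" using d kappa by (intro ge_one_powr_ge_zero) auto
  then show n1: "1 \<le> n d" using n[OF d] by (cases "n d") auto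
  show "real (n d) \<le> 2 * real d powr \<kappa>" using n[OF d] p by linarith
  show "real d powr \<kappa> / 2 \<le> real (n d)"
  proof (cases "real d powr \<kappa> \<le> 2")
    case True
    then show ?thesis using n1 by linarith
  next
    case False
    then show ?thesis using n[OF d] by linarith
  qed
qed

lemma filterlim_dim_powr: "0 < a \<Longrightarrow> filterlim (\<lambda>d. real d powr a) at_top sequentially"
  by (rule filterlim_compose[OF filterlim_powr_at_top filterlim_real_sequentially])

lemma filterlim_n: "filterlim (\<lambda>d. real (n d)) at_top sequentially"
proof (rule filterlim_at_top_mono)
  show "filterlim (\<lambda>d. 1 / 2 * real d powr \<kappa>) at_top sequentially"
    by (rule filterlim_tendsto_pos_mult_at_top[OF tendsto_const _ filterlim_dim_powr[OF kappa]]) simp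
  show "eventually (\<lambda>d. 1 / 2 * real d powr \<kappa> \<le> real (n d)) sequentially"
    using eventually_ge_at_top[of 1] by eventually_elim (use n_lower in auto)
qed

lemma normalized:
  assumes d: "d \<ge> 1"
  shows "(\<integral>\<^sup>+x. ennreal (gauss_density d (0\<^sub>v d) (S d) x) \<partial>vec_lborel d) = 1"
proof -
  interpret prob_space "M d" by (rule M[OF d])
  have "(\<integral>\<^sup>+x. ennreal (gauss_density d (0\<^sub>v d) (S d) x) * 1 \<partial>vec_lborel d) = (\<integral>\<^sup>+\<omega>. 1 \<partial>M d)"
    using n_ge_1[OF d] by (intro distributed_nn_integral[OF X_law[OF d, of 1]]) auto
  then show ?thesis by (simp add: emeasure_space_1)
qed

lemma lam_lower: "d \<ge> 1 \<Longrightarrow> k \<in> {1..r d} \<Longrightarrow> lam1 \<le> lam d k"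
  using mono_onD[OF lam_mono, of d 1 k] l1[of d] r[of d] by auto

lemma spiked_any:
  assumes d: "d \<ge> 1" and R: "r d \<le> R" and L: "1 \<le> L" "\<And>k. k \<in> {1..r d} \<Longrightarrow> lam d k \<le> L"
  shows "spiked d (r d) R (lam d) (v d) (S d) lam1 L"
  by unfold_locales
     (use S[OF d] r[OF d] R v_carrier[OF d] v_orthonormal[OF d] lam_lower[OF d] L l1[OF d] l1_bounds normalized[OF d] in auto)

text \<open>The eigenvalue bound has to be uniform in \<open>d\<close>, but \<open>lam k \<le> lambda_max S\<close> is
available only once some bound is fixed; so the maximum of the \<open>lam k\<close> is used first.\<close>
lemma spiked_uniform:
  assumes d: "d \<ge> 1"
  shows "spiked_conditioning d (r d) rank_bd (lam d) (v d) (S d) lam1 lam_bd (A d)"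
proof -
  have rR: "r d \<le> rank_bd" unfolding rank_bd_def using r_bdd d by (intro cSUP_upper) auto
  define L' where "L' = Max (insert 1 (lam d ` {1..r d}))"
  have "spiked d (r d) rank_bd (lam d) (v d) (S d) lam1 L'"
    unfolding L'_def by (rule spiked_any[OF d rR]) (rule Max_ge; auto)+
  then have "lam d k \<le> lambda_max (S d)" if "k \<in> {1..r d}" for k
    using spiked.lam_le_lambda_max d that by blast
  moreover have "lambda_max (S d) \<le> lam_bd"
    unfolding lam_bd_def using lam_max_bdd d by (intro max.coboundedI2 cSUP_upper) auto
  ultimately have sp: "spiked d (r d) rank_bd (lam d) (v d) (S d) lam1 lam_bd"
    by (intro spiked_any[OF d rR]) (fastforce simp: lam_bd_def)+
  have "conditioning d (A d)"
    using A[OF d] p_min(1) p_min(2)[OF d] by unfold_locales auto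
  with sp show ?thesis by (rule spiked_conditioning.intro)
qed

lemma X_measurable: "d \<ge> 1 \<Longrightarrow> i \<in> {1..n d} \<Longrightarrow> X d i \<in> M d \<rightarrow>\<^sub>M vec_borel d"
  using spiked.sample_measurable[OF spiked_conditioning.axioms(1)[OF spiked_uniform] M X_law] .

lemma lik_ratio_measurable: "d \<ge> 1 \<Longrightarrow> lik_ratio d (S d) \<in> borel_measurable (vec_borel d)"
  using spiked.measurable_lik_ratio[OF spiked_conditioning.axioms(1)[OF spiked_uniform]] .

lemma weight_measurable: "d \<ge> 1 \<Longrightarrow> i \<in> {1..n d} \<Longrightarrow> weight d i \<in> borel_measurable (M d)"
proof -
  assume d: "d \<ge> 1" and i: "i \<in> {1..n d}"
  have [measurable]: "X d i \<in> M d \<rightarrow>\<^sub>M vec_borel d" by (rule X_measurable[OF d i])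
  have [measurable]: "lik_ratio d (S d) \<in> borel_measurable (vec_borel d)" by (rule lik_ratio_measurable[OF d])
  have [measurable]: "A d \<in> sets (vec_borel d)" by (rule A[OF d])
  show "weight d i \<in> borel_measurable (M d)" by measurable
qed

definition max_weight :: "nat \<Rightarrow> 'w \<Rightarrow> real" where
  "max_weight d \<omega> = Max ((\<lambda>i. weight d i \<omega>) ` {1..n d})"

lemma max_weight_measurable: "d \<ge> 1 \<Longrightarrow> max_weight d \<in> borel_measurable (M d)"
  unfolding max_weight_def by (intro borel_measurable_Max weight_measurable) auto

lemma max_weight_le_iff: "d \<ge> 1 \<Longrightarrow> max_weight d \<omega> \<le> b \<longleftrightarrow> (\<forall>i\<in>{1..n d}. weight d i \<omega> \<le> b)"
  unfolding max_weight_def using n_ge_1[of d] by (subst Max_le_iff) auto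

lemma scaled_max_weight_le_iff:
  assumes "d \<ge> 1"
  shows "1 / real (n d) powr \<gamma> * max_weight d \<omega> \<le> 1 \<longleftrightarrow> max_weight d \<omega> \<le> real (n d) powr \<gamma>"
  using n_ge_1[OF assms] by (simp add: divide_le_eq)

lemma max_weight_small:
  assumes "\<gamma>s < \<gamma>"
  shows "(\<lambda>d. measure (M d) {\<omega> \<in> space (M d). max_weight d \<omega> \<le> real (n d) powr \<gamma>}) \<longlonglongrightarrow> 1"
proof -
  have "(\<lambda>d. measure (M d) {\<omega> \<in> space (M d). 1 / real (n d) powr \<gamma> * max_weight d \<omega> \<le> 1}) \<longlonglongrightarrow> 1"
    using max_weight_0[OF assms, folded max_weight_def] max_weight_measurable
    by (intro conv_distr_zeroD) auto
  then show ?thesis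
    by (rule Lim_transform_eventually)
       (use eventually_ge_at_top[of 1] in \<open>eventually_elim, simp only: scaled_max_weight_le_iff\<close>)
qed

lemma max_weight_large:
  assumes "\<gamma> < \<gamma>s"
  shows "(\<lambda>d. measure (M d) {\<omega> \<in> space (M d). max_weight d \<omega> \<le> real (n d) powr \<gamma>}) \<longlonglongrightarrow> 0"
proof -
  have "(\<lambda>d. measure (M d) {\<omega> \<in> space (M d). 1 / real (n d) powr \<gamma> * max_weight d \<omega> \<le> 1}) \<longlonglongrightarrow> 0"
    using max_weight_inf[OF assms, folded max_weight_def] by (simp add: conv_distr_infinity_def)
  then show ?thesis
    by (rule Lim_transform_eventually)
       (use eventually_ge_at_top[of 1] in \<open>eventually_elim, simp only: scaled_max_weight_le_iff\<close>)
qed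

lemma measure_compl_tendsto:
  assumes "\<And>d. d \<ge> 1 \<Longrightarrow> Measurable.pred (M d) (P d)"
  shows "((\<lambda>d. measure (M d) {\<omega> \<in> space (M d). P d \<omega>}) \<longlonglongrightarrow> 1) \<longleftrightarrow>
    ((\<lambda>d. measure (M d) {\<omega> \<in> space (M d). \<not> P d \<omega>}) \<longlonglongrightarrow> 0)"
proof -
  have ev: "eventually (\<lambda>d. measure (M d) {\<omega> \<in> space (M d). \<not> P d \<omega>} = 1 - measure (M d) {\<omega> \<in> space (M d). P d \<omega>}) sequentially"
    using eventually_ge_at_top[of 1]
  proof eventually_elim
    case (elim d)
    interpret prob_space "M d" by (rule M[OF elim])
    show ?case using prob_neg[of "P d"] assms[OF elim] by (simp add: pred_def)
  qed
  then have ev': "eventually (\<lambda>d. measure (M d) {\<omega> \<in> space (M d). P d \<omega>} = 1 - measure (M d) {\<omega> \<in> space (M d). \<not> P d \<omega>}) sequentially"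
    by eventually_elim simp
  show ?thesis
  proof
    assume "(\<lambda>d. measure (M d) {\<omega> \<in> space (M d). P d \<omega>}) \<longlonglongrightarrow> 1"
    then have "(\<lambda>d. 1 - measure (M d) {\<omega> \<in> space (M d). P d \<omega>}) \<longlonglongrightarrow> 1 - 1" by (intro tendsto_intros)
    then show "(\<lambda>d. measure (M d) {\<omega> \<in> space (M d). \<not> P d \<omega>}) \<longlonglongrightarrow> 0"
      using tendsto_cong[OF ev] by simp
  next
    assume "(\<lambda>d. measure (M d) {\<omega> \<in> space (M d). \<not> P d \<omega>}) \<longlonglongrightarrow> 0"
    then have "(\<lambda>d. 1 - measure (M d) {\<omega> \<in> space (M d). \<not> P d \<omega>}) \<longlonglongrightarrow> 1 - 0" by (intro tendsto_intros)
    then show "(\<lambda>d. measure (M d) {\<omega> \<in> space (M d). P d \<omega>}) \<longlonglongrightarrow> 1"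
      using tendsto_cong[OF ev'] by simp
  qed
qed

text \<open>For \<open>1 - lam1 < \<gamma>\<close> the moments of order \<open>1 + \<eta>\<close> with
\<open>(1 + \<eta>) \<gamma> > 1\<close> are bounded, so by a union bound the maximal weight stays below
\<open>n powr \<gamma>\<close> with probability tending to 1.\<close>
lemma gamma_upper: "\<gamma>s \<le> 1 - lam1"
proof (rule ccontr)
  assume "\<not> \<gamma>s \<le> 1 - lam1"
  then have "1 - lam1 < min \<gamma>s 1" using l1_bounds by auto
  then obtain \<gamma> where \<gamma>: "1 - lam1 < \<gamma>" "\<gamma> < min \<gamma>s 1" using dense by blast
  then obtain \<beta> where \<beta>: "1 - lam1 < \<beta>" "\<beta> < \<gamma>" using dense by blast
  have \<beta>0: "0 < \<beta>" using \<beta> l1_bounds by linarith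
  (* so that (1 + \<eta>) \<gamma> = \<gamma> / \<beta> > 1 *)
  define \<eta> where "\<eta> = 1 / \<beta> - 1"
  have \<eta>: "0 \<le> \<eta>" using \<beta> \<gamma> \<beta>0 by (simp add: \<eta>_def)
  have \<eta>': "\<eta> * (1 / lam1 - 1) < 1"
  proof -
    have "(1 - \<beta>) * (1 - lam1) < \<beta> * lam1" using \<beta> by (simp add: algebra_simps)
    then have "(1 - \<beta>) * (1 - lam1) / (\<beta> * lam1) < 1" using \<beta>0 l1_bounds by (simp add: divide_less_eq)
    moreover have "\<eta> * (1 / lam1 - 1) = (1 - \<beta>) * (1 - lam1) / (\<beta> * lam1)"
      using \<beta>0 l1_bounds by (simp add: \<eta>_def field_simps)
    ultimately show ?thesis by simp
  qed
  define K where "K = spiked.moment_bound rank_bd lam1 lam_bd \<eta>"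
  have bound: "measure (M d) {\<omega> \<in> space (M d). \<not> max_weight d \<omega> \<le> real (n d) powr \<gamma>} \<le> K * real (n d) powr (1 - \<gamma> / \<beta>)"
    if d: "d \<ge> 1" for d
  proof -
    interpret spiked_conditioning d "r d" rank_bd "lam d" "v d" "S d" lam1 lam_bd "A d"
      by (rule spiked_uniform[OF d])
    interpret prob_space "M d" by (rule M[OF d])
    let ?N = "real (n d) powr \<gamma>"
    have N: "0 < ?N" using n_ge_1[OF d] by simp
    let ?E = "\<lambda>i. {\<omega> \<in> space (M d). ?N \<le> lik_ratio d (S d) (X d i \<omega>)}"
    have E: "?E i \<in> sets (M d)" if "i \<in> {1..n d}" for i
    proof -
      have [measurable]: "X d i \<in> M d \<rightarrow>\<^sub>M vec_borel d" by (rule X_measurable[OF d that])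
      show ?thesis by measurable
    qed
    have "{\<omega> \<in> space (M d). \<not> max_weight d \<omega> \<le> ?N} \<subseteq> (\<Union>i\<in>{1..n d}. ?E i)"
    proof
      fix \<omega> assume "\<omega> \<in> {\<omega> \<in> space (M d). \<not> max_weight d \<omega> \<le> ?N}"
      then have \<omega>: "\<omega> \<in> space (M d)" and "\<exists>i\<in>{1..n d}. ?N < weight d i \<omega>"
        by (auto simp: max_weight_le_iff[OF d] not_le)
      then obtain i where i: "i \<in> {1..n d}" "?N < weight d i \<omega>" by blast
      then have "?N \<le> lik_ratio d (S d) (X d i \<omega>)" using N by (cases "X d i \<omega> \<in> A d") auto
      then show "\<omega> \<in> (\<Union>i\<in>{1..n d}. ?E i)" using i \<omega> by blast
    qed
    then have "prob {\<omega> \<in> space (M d). \<not> max_weight d \<omega> \<le> ?N} \<le> prob (\<Union>i\<in>{1..n d}. ?E i)"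
    proof (rule finite_measure_mono)
      show "(\<Union>i\<in>{1..n d}. ?E i) \<in> events"
        by (rule sets.finite_UN[OF finite_atLeastAtMost E])
    qed
    also have "\<dots> \<le> (\<Sum>i\<in>{1..n d}. prob (?E i))"
      by (rule measure_UNION_le[OF finite_atLeastAtMost E])
    also have "\<dots> \<le> (\<Sum>i\<in>{1..n d}. ?N powr - (1 + \<eta>) * K)"
      unfolding K_def by (intro sum_mono sample_tail[OF M[OF d] X_law[OF d]] N \<eta> \<eta>')
    also have "\<dots> = K * (real (n d) * ?N powr - (1 + \<eta>))" by simp
    also have "real (n d) * ?N powr - (1 + \<eta>) = real (n d) powr (1 - \<gamma> / \<beta>)"
    proof -
      have "?N powr - (1 + \<eta>) = real (n d) powr (- (\<gamma> / \<beta>))"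
        unfolding powr_powr by (simp add: \<eta>_def)
      moreover have "real (n d) powr (1 - \<gamma> / \<beta>) = real (n d) powr 1 * real (n d) powr (- (\<gamma> / \<beta>))"
        unfolding powr_add[symmetric] by simp
      ultimately show ?thesis using n_ge_1[OF d] by simp
    qed
    finally show ?thesis .
  qed
  have exceed: "(\<lambda>d. measure (M d) {\<omega> \<in> space (M d). \<not> max_weight d \<omega> \<le> real (n d) powr \<gamma>}) \<longlonglongrightarrow> 0"
  proof (rule tendsto_sandwich[where f = "\<lambda>_. 0"])
    have "1 - \<gamma> / \<beta> < 0" using \<beta> \<beta>0 by simp
    then have "(\<lambda>d. real (n d) powr (1 - \<gamma> / \<beta>)) \<longlonglongrightarrow> 0"
      by (rule tendsto_neg_powr[OF _ filterlim_n])
    then show "(\<lambda>d. K * real (n d) powr (1 - \<gamma> / \<beta>)) \<longlonglongrightarrow> 0"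
      using tendsto_mult[OF tendsto_const] by fastforce
    show "eventually (\<lambda>d. measure (M d) {\<omega> \<in> space (M d). \<not> max_weight d \<omega> \<le> real (n d) powr \<gamma>} \<le> K * real (n d) powr (1 - \<gamma> / \<beta>)) sequentially"
      using eventually_ge_at_top[of 1] by eventually_elim (rule bound)
  qed auto
  have event: "Measurable.pred (M d) (\<lambda>\<omega>. max_weight d \<omega> \<le> real (n d) powr \<gamma>)" if "d \<ge> 1" for d
    using max_weight_measurable[OF that] by measurable
  have "(\<lambda>d. measure (M d) {\<omega> \<in> space (M d). max_weight d \<omega> \<le> real (n d) powr \<gamma>}) \<longlonglongrightarrow> 1"
    by (rule iffD2[OF measure_compl_tendsto[OF event] exceed])
  moreover have "(\<lambda>d. measure (M d) {\<omega> \<in> space (M d). max_weight d \<omega> \<le> real (n d) powr \<gamma>}) \<longlonglongrightarrow> 0"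
    using \<gamma> by (intro max_weight_large) auto
  ultimately show False using LIMSEQ_unique by fastforce
qed


text \<open>For \<open>\<gamma> < 1 - lam1\<close> choose \<open>T\<close> with
\<open>(1 / lam1 - 1) T\<^sup>2 / 2 = \<beta> ln n\<close>, where \<open>\<gamma> < \<beta> < 1 - lam1\<close>. The
set of \<open>weighted_tail_lower\<close> then has weights above \<open>n powr \<gamma>\<close> and probability at
least \<open>n powr (- \<beta> / (1 - lam1))\<close> up to factors \<open>exp (O T)\<close>, so that the expected
number of sample points in it tends to infinity. Both claims are statements about quadratic polynomials in
\<open>T\<close> with positive leading coefficient.\<close>
lemma gamma_lower:
  assumes inv: "\<And>d y t. d \<ge> 1 \<Longrightarrow> y \<in> carrier_vec d \<Longrightarrow> y + t \<cdot>\<^sub>v v d 1 \<in> A d \<longleftrightarrow> y \<in> A d"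
  shows "1 - lam1 \<le> \<gamma>s"
proof (rule ccontr)
  assume "\<not> 1 - lam1 \<le> \<gamma>s"
  then obtain \<gamma> where \<gamma>: "\<gamma>s < \<gamma>" "\<gamma> < 1 - lam1" using dense[of \<gamma>s "1 - lam1"] by auto
  then obtain \<beta> where \<beta>: "\<gamma> < \<beta>" "\<beta> < 1 - lam1" using dense by blast
  have \<gamma>0: "0 < \<gamma>" and \<beta>0: "0 < \<beta>" using \<gamma> \<beta> gamma_nonneg by auto
  define a where "a = 1 / lam1 - 1"
  have lam1: "lam1 < 1" using \<beta> \<beta>0 by linarith
  have a: "0 < a" using lam1 l1_bounds by (simp add: a_def)
  (* c is chosen so that the tail of the spike coordinates beyond c takes at most half of the mass
     of every A d. *)
  define K where "K = max 1 (ln (2 * sqrt 2 ^ rank_bd / p_min))"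
  define c where "c = 2 * sqrt K"
  have K: "1 \<le> K" by (simp add: K_def)
  have c: "0 < c" "c\<^sup>2 = 4 * K" using K by (auto simp: c_def power_mult_distrib)
  have cp: "2 * (exp (- c\<^sup>2 / 4) * sqrt 2 ^ rank_bd) \<le> p_min"
  proof -
    have "2 * sqrt 2 ^ rank_bd / p_min \<le> exp K"
    proof -
      have "0 < 2 * sqrt 2 ^ rank_bd / p_min" using p_min(1) by simp
      then have "2 * sqrt 2 ^ rank_bd / p_min = exp (ln (2 * sqrt 2 ^ rank_bd / p_min))" by simp
      also have "\<dots> \<le> exp K" by (simp only: exp_le_cancel_iff K_def max.cobounded2)
      finally show ?thesis .
    qed
    then have "2 * sqrt 2 ^ rank_bd \<le> p_min * exp K" using p_min(1) by (simp add: divide_le_eq mult.commute)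
    then have "exp (- K) * (2 * sqrt 2 ^ rank_bd) \<le> exp (- K) * (p_min * exp K)" by (intro mult_left_mono) auto
    also have "\<dots> = p_min" by (simp add: exp_minus)
    finally show ?thesis unfolding c(2) by (simp add: mult_ac)
  qed
  define lb where "lb = spiked.scale_lb rank_bd lam1"
  define ub where "ub = spiked.scale_ub rank_bd lam_bd"
  have lbub: "0 < lb" "0 < ub"
    using spiked.scale_lb_pos spiked.scale_ub_pos spiked_conditioning.axioms(1)[OF spiked_uniform[of 1]]
    unfolding lb_def ub_def by blast+
  define T where "T d = sqrt (2 * \<beta> / a * ln (real (n d)))" for d
  have T_lim: "filterlim T at_top sequentially"
  proof -
    have "filterlim (\<lambda>d. ln (real (n d))) at_top sequentially"
      by (rule filterlim_compose[OF ln_at_top filterlim_n])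
    then have "filterlim (\<lambda>d. 2 * \<beta> / a * ln (real (n d))) at_top sequentially"
      by (intro filterlim_tendsto_pos_mult_at_top[OF tendsto_const]) (use a \<beta>0 in auto)
    then show ?thesis unfolding T_def by (rule filterlim_compose[OF sqrt_at_top])
  qed
  have ln_n: "ln (real (n d)) = a * (T d)\<^sup>2 / (2 * \<beta>)" if "d \<ge> 1" for d
    using n_ge_1[OF that] a \<beta>0 by (simp add: T_def)
  (* E1 (T d) measures, on the logarithmic scale, how far the weights on the translated set exceed
     n powr \<gamma>; exp (E2 (T d)) is a lower bound for the expected number of sample points in it.
     In both, ln n is expressed through T d. *)
  define E1 where "E1 t = a / 2 * (1 - \<gamma> / \<beta>) * t\<^sup>2 + (- (a * c)) * t + (a * c\<^sup>2 / 2 - c\<^sup>2 / 2 + ln lb)" for t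
  define E2 where "E2 t = (a / (2 * \<beta>) - 1 / 2 - a / 2) * t\<^sup>2 + (- c - a * c) * t + (ln (p_min / (2 * ub)) - a * c\<^sup>2)" for t
  have E1_lim: "filterlim (\<lambda>d. E1 (T d)) at_top sequentially"
    unfolding E1_def using a \<beta> \<beta>0
    by (intro filterlim_compose[OF filterlim_quadratic_at_top T_lim]) simp
  have E2_lim: "filterlim (\<lambda>d. E2 (T d)) at_top sequentially"
    unfolding E2_def
  proof (intro filterlim_compose[OF filterlim_quadratic_at_top T_lim])
    have "\<beta> * (1 + a) < a"
    proof -
      have "\<beta> * (1 / lam1) < (1 - lam1) * (1 / lam1)" using \<beta> l1_bounds by (intro mult_strict_right_mono) auto
      also have "(1 - lam1) * (1 / lam1) = a" using l1_bounds by (simp add: a_def field_simps)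
      finally show ?thesis by (simp add: a_def)
    qed
    then have "(1 + a) / 2 < a / (2 * \<beta>)" using \<beta>0 by (simp add: field_simps)
    then show "0 < a / (2 * \<beta>) - 1 / 2 - a / 2" by (simp add: add_divide_distrib)
  qed
  have "(\<lambda>d. measure (M d) {\<omega> \<in> space (M d). max_weight d \<omega> \<le> real (n d) powr \<gamma>}) \<longlonglongrightarrow> 0"
  proof (rule tendsto_sandwich[where f = "\<lambda>_. 0"])
    have "filterlim (\<lambda>d. exp (E2 (T d))) at_top sequentially"
      by (rule filterlim_compose[OF exp_at_top E2_lim])
    then have "filterlim (\<lambda>d. 1 / 2 * exp (E2 (T d))) at_top sequentially"
      by (intro filterlim_tendsto_pos_mult_at_top[OF tendsto_const]) auto
    then have "filterlim (\<lambda>d. - (1 / 2 * exp (E2 (T d)))) at_bot sequentially"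
      by (simp add: filterlim_uminus_at_bot)
    then show "(\<lambda>d. exp (- (1 / 2 * exp (E2 (T d))))) \<longlonglongrightarrow> 0"
      by (rule filterlim_compose[OF exp_at_bot])
    have "eventually (\<lambda>d. 0 < E1 (T d)) sequentially"
      using E1_lim by (simp add: filterlim_at_top_dense)
    moreover have "eventually (\<lambda>d. c \<le> T d) sequentially"
      using T_lim by (simp add: filterlim_at_top)
    ultimately show "eventually (\<lambda>d. measure (M d) {\<omega> \<in> space (M d). max_weight d \<omega> \<le> real (n d) powr \<gamma>} \<le> exp (- (1 / 2 * exp (E2 (T d))))) sequentially"
      using eventually_ge_at_top[of 1]
    proof eventually_elim
      case (elim d)
      note d = elim(3)
      interpret spiked_conditioning d "r d" rank_bd "lam d" "v d" "S d" lam1 lam_bd "A d"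
        by (rule spiked_uniform[OF d])
      interpret prob_space "M d" by (rule M[OF d])
      define lo where "lo = scale_lb * exp ((a * (T d - c)\<^sup>2 - c\<^sup>2) / 2)"
      define \<pi> where "\<pi> = prob_A d (A d) / (2 * scale_ub) * exp (- T d * c - (T d)\<^sup>2 / 2 - a / 2 * ((T d + c)\<^sup>2 + c\<^sup>2))"
      let ?H = "{y \<in> A d. lo \<le> lik_ratio d (S d) y}"
      have H: "?H \<in> sets (vec_borel d)" by (rule sets_Collect_A) measurable
      have cp': "2 * (exp (- c\<^sup>2 / 4) * sqrt 2 ^ rank_bd) \<le> prob_A d (A d)"
        using cp p_min(2)[OF d] by linarith
      have hit: "\<pi> \<le> prob {\<omega> \<in> space (M d). X d i \<omega> \<in> ?H}" if "i \<in> {1..n d}" for i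
        unfolding \<pi>_def lo_def a_def
        by (rule weighted_tail_lower[OF M[OF d] X_law[OF d that] inv[OF d] c(1) elim(2) cp'])
      have \<pi>0: "0 \<le> \<pi>" using p_pos scale_ub_pos by (simp add: \<pi>_def)
      have lo: "real (n d) powr \<gamma> < lo"
      proof -
        have "real (n d) powr \<gamma> = exp (\<gamma> * (a * (T d)\<^sup>2 / (2 * \<beta>)))"
          using n_ge_1[OF d] by (simp add: powr_def ln_n[OF d])
        also have "\<dots> < exp (\<gamma> * (a * (T d)\<^sup>2 / (2 * \<beta>)) + E1 (T d))" using elim(1) by simp
        also have "\<gamma> * (a * (T d)\<^sup>2 / (2 * \<beta>)) + E1 (T d) = ln lb + (a * (T d - c)\<^sup>2 - c\<^sup>2) / 2"
          unfolding E1_def by (simp add: power2_eq_square field_simps)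
        also have "exp \<dots> = lo" using lbub unfolding exp_add by (simp add: lo_def lb_def)
        finally show ?thesis .
      qed
      have "prob {\<omega> \<in> space (M d). max_weight d \<omega> \<le> real (n d) powr \<gamma>}
          \<le> prob {\<omega> \<in> space (M d). \<forall>i\<in>{1..n d}. X d i \<omega> \<notin> ?H}"
      proof (rule finite_measure_mono)
        show "{\<omega> \<in> space (M d). max_weight d \<omega> \<le> real (n d) powr \<gamma>} \<subseteq> {\<omega> \<in> space (M d). \<forall>i\<in>{1..n d}. X d i \<omega> \<notin> ?H}"
        proof (intro subsetI CollectI conjI ballI)
          fix \<omega> i assume \<omega>: "\<omega> \<in> {\<omega> \<in> space (M d). max_weight d \<omega> \<le> real (n d) powr \<gamma>}"
            and i: "i \<in> {1..n d}"
          then have "weight d i \<omega> \<le> real (n d) powr \<gamma>" by (auto simp: max_weight_le_iff[OF d])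
          then show "X d i \<omega> \<notin> ?H" using lo by auto
        qed simp
        have "{\<omega> \<in> space (M d). X d i \<omega> \<notin> ?H} \<in> sets (M d)" if "i \<in> {1..n d}" for i
        proof -
          have [measurable]: "X d i \<in> M d \<rightarrow>\<^sub>M vec_borel d" by (rule X_measurable[OF d that])
          show ?thesis using H by measurable
        qed
        then show "{\<omega> \<in> space (M d). \<forall>i\<in>{1..n d}. X d i \<omega> \<notin> ?H} \<in> sets (M d)"
          by (intro sets.sets_Collect_finite_All') (use n_ge_1[OF d] in auto)
      qed
      also have "\<dots> \<le> exp (- real (n d) * \<pi> / 2)"
        by (rule prob_none_hit[OF X_indep[OF d] H hit \<pi>0])
      also have "\<dots> \<le> exp (- (1 / 2 * exp (E2 (T d))))"
      proof -
        have "exp (E2 (T d)) \<le> real (n d) * \<pi>"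
        proof -
          have "E2 (T d) = ln (real (n d)) + (ln (p_min / (2 * ub)) + (- T d * c - (T d)\<^sup>2 / 2 - a / 2 * ((T d + c)\<^sup>2 + c\<^sup>2)))"
            unfolding ln_n[OF d] E2_def by (simp add: power2_eq_square field_simps)
          then have "exp (E2 (T d)) = real (n d) * (p_min / (2 * ub) * exp (- T d * c - (T d)\<^sup>2 / 2 - a / 2 * ((T d + c)\<^sup>2 + c\<^sup>2)))"
            using n_ge_1[OF d] p_min(1) lbub by (simp only: exp_add) simp
          also have "\<dots> \<le> real (n d) * \<pi>"
            unfolding \<pi>_def ub_def using p_min(2)[OF d] scale_ub_pos
            by (intro mult_left_mono mult_right_mono divide_right_mono) auto
          finally show ?thesis .
        qed
        then show ?thesis by simp
      qed
      finally show ?case .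
    qed
  qed auto
  with max_weight_small[OF \<gamma>(1)] show False using LIMSEQ_unique by fastforce
qed

abbreviation "sample_cov d \<omega> \<equiv> emp_cov d (n d) (S d) (A d) (\<lambda>i. X d i \<omega>)"
abbreviation "error_norm d \<omega> \<equiv> op_norm d (sample_cov d \<omega> - cond_cov d (A d))"

lemma error_norm_measurable:
  assumes d: "d \<ge> 1"
  shows "error_norm d \<in> borel_measurable (M d)"
proof (rule borel_measurable_op_norm[OF d])
  interpret spiked_conditioning d "r d" rank_bd "lam d" "v d" "S d" lam1 lam_bd "A d"
    by (rule spiked_uniform[OF d])
  fix i j assume ij: "i < d" "j < d"
  have summand: "(\<lambda>\<omega>. lik_ratio d (S d) (X d k \<omega>) * indicator (A d) (X d k \<omega>) * (X d k \<omega> $ i * X d k \<omega> $ j)) \<in> borel_measurable (M d)"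
    if "k \<in> {1..n d}" for k
  proof -
    have [measurable]: "X d k \<in> M d \<rightarrow>\<^sub>M vec_borel d" by (rule X_measurable[OF d that])
    have [measurable]: "A d \<in> sets (vec_borel d)" by (rule A[OF d])
    show ?thesis using ij by measurable
  qed
  have "(\<lambda>\<omega>. 1 / (real (n d) * prob_A d (A d)) * (\<Sum>k=1..n d. lik_ratio d (S d) (X d k \<omega>) * indicator (A d) (X d k \<omega>) * (X d k \<omega> $ i * X d k \<omega> $ j))
     - outer d (cond_mean d (A d)) (cond_mean d (A d)) $$ (i, j) - cond_cov d (A d) $$ (i, j)) \<in> borel_measurable (M d)"
    by (intro borel_measurable_diff borel_measurable_times borel_measurable_sum summand) auto
  moreover have "(sample_cov d \<omega> - cond_cov d (A d)) $$ (i, j)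
     = 1 / (real (n d) * prob_A d (A d)) * (\<Sum>k=1..n d. lik_ratio d (S d) (X d k \<omega>) * indicator (A d) (X d k \<omega>) * (X d k \<omega> $ i * X d k \<omega> $ j))
     - outer d (cond_mean d (A d)) (cond_mean d (A d)) $$ (i, j) - cond_cov d (A d) $$ (i, j)" for \<omega>
    using ij symmetric_mat_carrier[OF cond_cov_symmetric] by (simp add: emp_cov_def outer_def)
  ultimately show "(\<lambda>\<omega>. (sample_cov d \<omega> - cond_cov d (A d)) $$ (i, j)) \<in> borel_measurable (M d)"
    by simp
next
  interpret spiked_conditioning d "r d" rank_bd "lam d" "v d" "S d" lam1 lam_bd "A d"
    by (rule spiked_uniform[OF d])
  show "sample_cov d \<omega> - cond_cov d (A d) \<in> carrier_mat d d" for \<omega>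
    by (rule symmetric_mat_carrier[OF emp_cov_error_symmetric])
qed

lemma error_norm_nonneg: "d \<ge> 1 \<Longrightarrow> 0 \<le> error_norm d \<omega>"
  using op_norm_nonneg symmetric_mat_carrier[OF conditioning.emp_cov_error_symmetric]
    spiked_conditioning.axioms(2)[OF spiked_uniform] by blast

end

section \<open>The phase transition\<close>

text \<open>The cardinality of the grid is \<open>exp (O (d ln d))\<close>, which is dominated by
\<open>exp (- c d powr \<delta>)\<close> because \<open>\<delta> > 1\<close>.\<close>
lemma net_union_bound_limit:
  fixes \<delta> c :: real
  assumes \<delta>: "1 < \<delta>" and c: "0 < c"
  shows "(\<lambda>d. real (2 * d\<^sup>2 + 1) ^ d * (2 * exp (- c * real d powr \<delta>))) \<longlonglongrightarrow> 0"
proof (rule tendsto_sandwich[where f = "\<lambda>_. 0"])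
  have "filterlim (\<lambda>d. c / 2 * real d) at_top sequentially"
    by (rule filterlim_tendsto_pos_mult_at_top[OF tendsto_const _ filterlim_real_sequentially]) (use c in simp)
  then have "filterlim (\<lambda>d. - (c / 2 * real d)) at_bot sequentially"
    by (simp add: filterlim_uminus_at_bot)
  then have "(\<lambda>d. exp (- (c / 2 * real d))) \<longlonglongrightarrow> 0"
    by (rule filterlim_compose[OF exp_at_bot])
  then show "(\<lambda>d. 2 * exp (- (c / 2 * real d))) \<longlonglongrightarrow> 0"
    using tendsto_mult[OF tendsto_const] by fastforce
  have "(\<lambda>d. ln (real d) / real d powr (\<delta> - 1)) \<longlonglongrightarrow> 0"
    by (rule lim_ln_over_power) (use \<delta> in simp)
  then have "eventually (\<lambda>d. ln (real d) / real d powr (\<delta> - 1) < c / 6) sequentially"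
    by (rule order_tendstoD) (use c in simp)
  then show "eventually (\<lambda>d. real (2 * d\<^sup>2 + 1) ^ d * (2 * exp (- c * real d powr \<delta>)) \<le> 2 * exp (- (c / 2 * real d))) sequentially"
    using eventually_ge_at_top[of 3]
  proof eventually_elim
    case (elim d)
    have d: "3 \<le> real d" using elim(2) by simp
    have pd: "real d powr \<delta> = real d * real d powr (\<delta> - 1)"
      using d by (simp add: powr_diff)
    have "real (2 * d\<^sup>2 + 1) \<le> real d ^ 3"
    proof -
      have "1 \<le> real d * real d" using mult_mono[of 1 "real d" 1 "real d"] d by simp
      then have "real (2 * d\<^sup>2 + 1) \<le> 3 * (real d * real d)" by (simp add: power2_eq_square)
      also have "\<dots> \<le> real d * (real d * real d)" using d by (intro mult_right_mono) auto
      finally show ?thesis by (simp add: power3_eq_cube mult.assoc)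
    qed
    also have "real d ^ 3 = exp (3 * ln (real d))"
      using d exp_of_nat_mult[of 3 "ln (real d)"] by simp
    finally have "real (2 * d\<^sup>2 + 1) ^ d \<le> exp (3 * ln (real d)) ^ d" by (intro power_mono) auto
    also have "\<dots> = exp (real d * (3 * ln (real d)))" by (simp add: exp_of_nat_mult)
    also have "\<dots> \<le> exp (c / 2 * real d powr \<delta>)"
    proof -
      have "ln (real d) \<le> c / 6 * real d powr (\<delta> - 1)"
        using elim(1) d by (simp add: divide_less_eq)
      then have "real d * (3 * ln (real d)) \<le> real d * (3 * (c / 6 * real d powr (\<delta> - 1)))"
        by (intro mult_left_mono) auto
      then show ?thesis by (simp add: pd mult_ac)
    qed
    finally have "real (2 * d\<^sup>2 + 1) ^ d * (2 * exp (- c * real d powr \<delta>))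
        \<le> exp (c / 2 * real d powr \<delta>) * (2 * exp (- c * real d powr \<delta>))" by (intro mult_right_mono) auto
    also have "\<dots> = 2 * exp (- (c / 2 * real d powr \<delta>))" by (simp add: exp_add[symmetric])
    also have "\<dots> \<le> 2 * exp (- (c / 2 * real d))"
    proof -
      have "real d powr 1 \<le> real d powr \<delta>" using d \<delta> by (intro powr_mono) auto
      then show ?thesis using c d by simp
    qed
    finally show ?case .
  qed
qed auto

lemma powr_times_geometric_limit:
  fixes \<kappa> q :: real
  assumes \<kappa>: "0 < \<kappa>" and q: "0 < q" "q < 1"
  shows "(\<lambda>d. real d powr \<kappa> * q ^ d) \<longlonglongrightarrow> 0"
proof (rule tendsto_sandwich[where f = "\<lambda>_. 0"])
  define b where "b = - ln q / 2"
  have b: "0 < b" using q by (simp add: b_def)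
  have "filterlim (\<lambda>d. b * real d) at_top sequentially"
    by (rule filterlim_tendsto_pos_mult_at_top[OF tendsto_const b filterlim_real_sequentially])
  then have "filterlim (\<lambda>d. - (b * real d)) at_bot sequentially"
    by (simp add: filterlim_uminus_at_bot)
  then show "(\<lambda>d. exp (- (b * real d))) \<longlonglongrightarrow> 0"
    by (rule filterlim_compose[OF exp_at_bot])
  have "(\<lambda>d. ln (real d) / real d powr 1) \<longlonglongrightarrow> 0"
    by (rule lim_ln_over_power) simp
  then have "eventually (\<lambda>d. ln (real d) / real d powr 1 < b / \<kappa>) sequentially"
    by (rule order_tendstoD) (use b \<kappa> in simp)
  then show "eventually (\<lambda>d. real d powr \<kappa> * q ^ d \<le> exp (- (b * real d))) sequentially"
    using eventually_ge_at_top[of 1]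
  proof eventually_elim
    case (elim d)
    have "\<kappa> * ln (real d) \<le> b * real d" using elim \<kappa> by (simp add: field_simps)
    then have "real d powr \<kappa> \<le> exp (b * real d)" using elim(2) by (simp add: powr_def)
    moreover have "q ^ d = exp (- (2 * b * real d))"
      using q exp_of_nat_mult[of d "ln q"] by (simp add: b_def mult.commute)
    ultimately have "real d powr \<kappa> * q ^ d \<le> exp (b * real d) * exp (- (2 * b * real d))"
      by (simp add: mult_right_mono)
    then show ?case by (simp add: exp_add[symmetric])
  qed
qed (use q in auto)

context importance_sampling
begin

text \<open>The assumption leaves room for an exponent \<open>\<gamma> > \<gamma>s\<close> with
\<open>\<kappa> (1 - \<gamma>) > 1\<close>. With the truncation level \<open>N = n powr \<gamma>\<close> the Chernoff
exponent is of order \<open>n / N = d powr (\<kappa> (1 - \<gamma>))\<close>, more than the entropy of the grid, while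
with high probability no weight exceeds \<open>N\<close>.\<close>
lemma error_norm_conv:
  assumes \<kappa>: "1 < \<kappa> * (1 - \<gamma>s)"
  shows "conv_distr_const M error_norm 0"
proof (rule conv_distr_zeroI[OF M error_norm_measurable error_norm_nonneg])
  fix \<epsilon> :: real assume \<epsilon>: "0 < \<epsilon>"
  have "\<gamma>s < 1 - 1 / \<kappa>" using \<kappa> kappa by (simp add: field_simps)
  then obtain \<gamma> where \<gamma>: "\<gamma>s < \<gamma>" "\<gamma> < 1 - 1 / \<kappa>" using dense by blast
  have \<gamma>1: "1 < \<kappa> * (1 - \<gamma>)" using \<gamma>(2) kappa by (simp add: field_simps)
  have \<gamma>0: "0 < \<gamma>" "\<gamma> < 1" using \<gamma> gamma_nonneg kappa by (auto intro: less_trans[OF \<gamma>(2)])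
  define \<eta> where "\<eta> = lam1 / 2"
  have "\<eta> * (1 / lam1 - 1) = (1 - lam1) / 2" using l1_bounds by (simp add: \<eta>_def field_simps)
  then have \<eta>: "0 < \<eta>" "0 \<le> \<eta>" "\<eta> * (1 / lam1 - 1) < 1" using l1_bounds by (auto simp: \<eta>_def)
  define K where "K = spiked.moment_bound rank_bd lam1 lam_bd \<eta>"
  (* the grid costs a factor 4, and the truncation bias is eventually below t as well *)
  define t where "t = \<epsilon> * p_min / 16"
  have t: "0 < t" using \<epsilon> p_min(1) by (simp add: t_def)
  (* at \<theta> \<le> t / 2048 the quadratic term of the Chernoff exponent is at most half of the linear one *)
  define \<theta> where "\<theta> = min (1 / 16) (t / 2048)"
  have \<theta>: "0 < \<theta>" "\<theta> \<le> 1 / 16" "\<theta> \<le> t / 2048" using t by (auto simp: \<theta>_def)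
  define c where "c = \<theta> * t - 1024 * \<theta>\<^sup>2"
  have c: "0 < c"
  proof -
    have "\<theta> * (1024 * \<theta>) \<le> \<theta> * (t / 2)" using \<theta> by (intro mult_left_mono) auto
    moreover have "0 < \<theta> * (t / 2)" using \<theta> t by simp
    ultimately show ?thesis by (simp add: c_def power2_eq_square)
  qed
  define c' where "c' = c * (1 / 2) powr (1 - \<gamma>)"
  have c': "0 < c'" using c by (simp add: c'_def)
  let ?N = "\<lambda>d. real (n d) powr \<gamma>"
  let ?bias = "\<lambda>d. ?N d powr - (\<eta> / 2) * (512 + K / 2)"
  let ?net = "\<lambda>d. real (2 * d\<^sup>2 + 1) ^ d * (2 * exp (- c' * real d powr (\<kappa> * (1 - \<gamma>))))"
  have bias_lim: "?bias \<longlonglongrightarrow> 0"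
  proof -
    have "filterlim ?N at_top sequentially"
      by (rule filterlim_compose[OF filterlim_powr_at_top[OF \<gamma>0(1)] filterlim_n])
    then have "(\<lambda>d. ?N d powr - (\<eta> / 2)) \<longlonglongrightarrow> 0" using \<eta> by (intro tendsto_neg_powr) auto
    then show ?thesis using tendsto_mult[OF _ tendsto_const] by fastforce
  qed
  have bias_ev: "eventually (\<lambda>d. ?bias d < t) sequentially"
    by (rule order_tendstoD(2)[OF bias_lim t])
  have event: "Measurable.pred (M d) (\<lambda>\<omega>. max_weight d \<omega> \<le> ?N d)" if "d \<ge> 1" for d
    using max_weight_measurable[OF that] by measurable
  have exceed: "(\<lambda>d. measure (M d) {\<omega> \<in> space (M d). \<not> max_weight d \<omega> \<le> ?N d}) \<longlonglongrightarrow> 0"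
    by (rule iffD1[OF measure_compl_tendsto[OF event] max_weight_small[OF \<gamma>(1)]])
  show "(\<lambda>d. measure (M d) {\<omega> \<in> space (M d). \<epsilon> < error_norm d \<omega>}) \<longlonglongrightarrow> 0"
  proof (rule tendsto_sandwich[where f = "\<lambda>_. 0"])
    show "(\<lambda>d. measure (M d) {\<omega> \<in> space (M d). \<not> max_weight d \<omega> \<le> ?N d} + ?net d) \<longlonglongrightarrow> 0"
      using tendsto_add[OF exceed net_union_bound_limit[OF \<gamma>1 c']] by simp
    show "eventually (\<lambda>d. measure (M d) {\<omega> \<in> space (M d). \<epsilon> < error_norm d \<omega>}
        \<le> measure (M d) {\<omega> \<in> space (M d). \<not> max_weight d \<omega> \<le> ?N d} + ?net d) sequentially"
      using bias_ev eventually_ge_at_top[of 1]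
    proof eventually_elim
      case (elim d)
      note d = elim(2)
      interpret spiked_conditioning d "r d" rank_bd "lam d" "v d" "S d" lam1 lam_bd "A d"
        by (rule spiked_uniform[OF d])
      interpret prob_space "M d" by (rule M[OF d])
      have N: "0 < ?N d" using n_ge_1[OF d] by simp
      let ?err = "\<lambda>u \<omega>. trunc_error (X d) (n d) (?N d) u \<omega>"
      let ?G = "{\<omega> \<in> space (M d). \<exists>u\<in>grid d. t \<le> ?err u \<omega>}"
      let ?W = "{\<omega> \<in> space (M d). \<not> max_weight d \<omega> \<le> ?N d}"
      have G: "?G \<in> events" "prob ?G \<le> real (2 * d\<^sup>2 + 1) ^ d * (2 * exp (- (real (n d) / ?N d) * (\<theta> * t - 1024 * \<theta>\<^sup>2)))"
        using trunc_error_grid_tail[OF M[OF d] X_indep[OF d] X_law[OF d] n_ge_1[OF d] N \<theta>(1,2)] by auto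
      have W: "?W \<in> events" using max_weight_measurable[OF d] by measurable
      have "{\<omega> \<in> space (M d). \<epsilon> < error_norm d \<omega>} \<subseteq> ?W \<union> ?G"
      proof (rule subsetI, rule ccontr)
        fix \<omega> assume in_lhs: "\<omega> \<in> {\<omega> \<in> space (M d). \<epsilon> < error_norm d \<omega>}" and "\<omega> \<notin> ?W \<union> ?G"
        then have \<omega>: "\<omega> \<in> space (M d)" "\<epsilon> < error_norm d \<omega>" "max_weight d \<omega> \<le> ?N d"
          by auto
        moreover have "\<omega> \<notin> ?G" using \<open>\<omega> \<notin> ?W \<union> ?G\<close> by blast
        ultimately have small: "?err u \<omega> \<le> t" if "u \<in> grid d" for u
          using that by (auto simp: not_le less_imp_le)
        have "error_norm d \<omega> \<le> 4 * ((t + ?N d powr - (\<eta> / 2) * (512 + moment_bound \<eta> / 2)) / prob_A d (A d))"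
        proof (rule op_norm_error_le[OF M[OF d] X_indep[OF d] X_law[OF d] n_ge_1[OF d] d \<omega>(1) N _ small \<eta>(2,3)])
          show "weight d i \<omega> \<le> ?N d" if "i \<in> {1..n d}" for i
            using \<omega>(3) that by (simp add: max_weight_le_iff[OF d])
        qed
        also have "\<dots> \<le> 4 * ((t + t) / p_min)"
        proof (intro mult_left_mono frac_le)
          show "t + ?N d powr - (\<eta> / 2) * (512 + moment_bound \<eta> / 2) \<le> t + t"
            using elim(1) by (simp add: K_def)
        qed (use t p_min(1) p_min(2)[OF d] in auto)
        also have "\<dots> = \<epsilon> / 2" using p_min(1) by (simp add: t_def)
        finally show False using \<omega>(2) \<epsilon> by simp
      qed
      then have "prob {\<omega> \<in> space (M d). \<epsilon> < error_norm d \<omega>} \<le> prob (?W \<union> ?G)"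
        by (rule finite_measure_mono) (rule sets.Un[OF W G(1)])
      also have "\<dots> \<le> prob ?W + prob ?G" by (rule measure_Un_le[OF W G(1)])
      also have "prob ?G \<le> ?net d"
      proof (rule order_trans[OF G(2)], intro mult_left_mono)
        have "(1 / 2) powr (1 - \<gamma>) * real d powr (\<kappa> * (1 - \<gamma>)) = (real d powr \<kappa> / 2) powr (1 - \<gamma>)"
          using powr_mult[of "1 / 2" "real d powr \<kappa>" "1 - \<gamma>"] by (simp add: powr_powr)
        also have "\<dots> \<le> real (n d) powr (1 - \<gamma>)"
          using n_lower[OF d] \<gamma>0 by (intro powr_mono2) auto
        also have "\<dots> = real (n d) / ?N d"
          using n_ge_1[OF d] by (simp add: powr_diff)
        finally have "c * ((1 / 2) powr (1 - \<gamma>) * real d powr (\<kappa> * (1 - \<gamma>))) \<le> c * (real (n d) / ?N d)"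
          by (rule mult_left_mono) (use c in simp)
        then have "c' * real d powr (\<kappa> * (1 - \<gamma>)) \<le> real (n d) / ?N d * c"
          unfolding c'_def mult.assoc by (simp only: mult.commute[of _ c])
        then show "exp (- (real (n d) / ?N d) * (\<theta> * t - 1024 * \<theta>\<^sup>2)) \<le> exp (- c' * real d powr (\<kappa> * (1 - \<gamma>)))"
          by (simp add: c_def)
      qed auto
      finally show ?case by simp
    qed
  qed auto
qed

text \<open>Now there is \<open>\<gamma> < \<gamma>s\<close> with \<open>\<kappa> (1 - \<gamma>) < 1\<close>. The
maximal weight exceeds \<open>n powr \<gamma>\<close> with high probability, and every sample point has squared length
at least \<open>d / 8\<close>, so the heaviest point alone contributes \<open>n powr (\<gamma> - 1) d / 8\<close>,
which is at least a constant times \<open>d powr (1 - \<kappa> (1 - \<gamma>))\<close>.\<close>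
lemma divergence:
  assumes \<kappa>: "\<kappa> * (1 - \<gamma>s) < 1" "\<gamma>s < 1"
  shows "conv_distr_infinity M error_norm"
    and "conv_distr_infinity M (\<lambda>d \<omega>. lambda_max (sample_cov d \<omega>))"
proof -
  have "1 - 1 / \<kappa> < \<gamma>s" using \<kappa>(1) kappa by (simp add: field_simps)
  then obtain \<gamma> where \<gamma>: "1 - 1 / \<kappa> < \<gamma>" "\<gamma> < \<gamma>s" using dense by blast
  have \<gamma>1: "\<kappa> * (1 - \<gamma>) < 1" using \<gamma>(1) kappa by (simp add: field_simps)
  have \<gamma>0: "\<gamma> < 1" using \<gamma> \<kappa>(2) by linarith
  let ?N = "\<lambda>d. real (n d) powr \<gamma>"
  define lb where "lb = spiked.scale_lb rank_bd lam1"
  have lb: "0 < lb"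
    using spiked.scale_lb_pos spiked_conditioning.axioms(1)[OF spiked_uniform[of 1]] unfolding lb_def by blast
  define B where "B d = measure (M d) {\<omega> \<in> space (M d). max_weight d \<omega> \<le> ?N d} + 2 / lb * (real d powr \<kappa> * (3 / 4) ^ d)" for d
  have B: "B \<longlonglongrightarrow> 0"
  proof -
    have "(\<lambda>d. measure (M d) {\<omega> \<in> space (M d). max_weight d \<omega> \<le> ?N d} + 2 / lb * (real d powr \<kappa> * (3 / 4) ^ d)) \<longlonglongrightarrow> 0 + 2 / lb * 0"
      by (intro tendsto_add tendsto_mult tendsto_const max_weight_large \<gamma>(2) powr_times_geometric_limit kappa) auto
    then show ?thesis by (simp add: B_def[abs_def])
  qed
  define low where "low d = 1 / 8 * 2 powr (\<gamma> - 1) * real d powr (1 - \<kappa> * (1 - \<gamma>)) - ((17 / p_min)\<^sup>2 + 16 / p_min)" for d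
  have low_lim: "filterlim low at_top sequentially"
  proof -
    have "filterlim (\<lambda>d. real d powr (1 - \<kappa> * (1 - \<gamma>))) at_top sequentially"
      by (rule filterlim_dim_powr) (use \<gamma>1 in simp)
    then have "filterlim (\<lambda>d. 1 / 8 * 2 powr (\<gamma> - 1) * real d powr (1 - \<kappa> * (1 - \<gamma>))) at_top sequentially"
      by (rule filterlim_tendsto_pos_mult_at_top[OF tendsto_const, rotated]) simp
    from filterlim_tendsto_add_at_top[OF tendsto_const this, of "- ((17 / p_min)\<^sup>2 + 16 / p_min)"]
    show ?thesis unfolding low_def by (simp add: algebra_simps)
  qed
  define Bad where "Bad d = {\<omega> \<in> space (M d). max_weight d \<omega> \<le> ?N d} \<union>
      (\<Union>i\<in>{1..n d}. {\<omega> \<in> space (M d). X d i \<omega> \<bullet> X d i \<omega> \<le> real d / 8})" for d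
  have Bad_sets: "Bad d \<in> sets (M d)" and Bad_prob: "measure (M d) (Bad d) \<le> B d"
    and good: "\<And>\<omega>. \<omega> \<in> space (M d) \<Longrightarrow> \<omega> \<notin> Bad d \<Longrightarrow>
       low d \<le> lambda_max (sample_cov d \<omega>) \<and> low d \<le> error_norm d \<omega>"
    if d: "d \<ge> 1" for d
  proof -
    interpret spiked_conditioning d "r d" rank_bd "lam d" "v d" "S d" lam1 lam_bd "A d"
      by (rule spiked_uniform[OF d])
    interpret prob_space "M d" by (rule M[OF d])
    let ?W = "{\<omega> \<in> space (M d). max_weight d \<omega> \<le> ?N d}"
    let ?E = "\<lambda>i. {\<omega> \<in> space (M d). X d i \<omega> \<bullet> X d i \<omega> \<le> real d / 8}"
    have W: "?W \<in> events" using max_weight_measurable[OF d] by measurable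
    have E: "?E i \<in> events" if "i \<in> {1..n d}" for i
    proof -
      have [measurable]: "X d i \<in> M d \<rightarrow>\<^sub>M vec_borel d" by (rule X_measurable[OF d that])
      show ?thesis by measurable
    qed
    have EU: "(\<Union>i\<in>{1..n d}. ?E i) \<in> events" by (rule sets.finite_UN[OF finite_atLeastAtMost E])
    show "Bad d \<in> sets (M d)" unfolding Bad_def by (rule sets.Un[OF W EU])
    have "prob (Bad d) \<le> prob ?W + prob (\<Union>i\<in>{1..n d}. ?E i)"
      unfolding Bad_def by (rule measure_Un_le[OF W EU])
    also have "prob (\<Union>i\<in>{1..n d}. ?E i) \<le> (\<Sum>i\<in>{1..n d}. prob (?E i))"
      by (rule measure_UNION_le[OF finite_atLeastAtMost E])
    also have "\<dots> \<le> (\<Sum>i\<in>{1..n d}. (3 / 4) ^ d / lb)"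
      unfolding lb_def by (intro sum_mono sample_norm_small[OF M[OF d] X_law[OF d]])
    also have "\<dots> = real (n d) * ((3 / 4) ^ d / lb)" by simp
    also have "\<dots> \<le> (2 * real d powr \<kappa>) * ((3 / 4) ^ d / lb)"
      using n_upper[OF d] lb by (intro mult_right_mono) auto
    finally show "measure (M d) (Bad d) \<le> B d" by (simp add: B_def field_simps)
    fix \<omega> assume \<omega>: "\<omega> \<in> space (M d)" "\<omega> \<notin> Bad d"
    then have "\<exists>i\<in>{1..n d}. ?N d < weight d i \<omega>" by (auto simp: Bad_def max_weight_le_iff[OF d] not_le)
    then obtain i where i: "i \<in> {1..n d}" "?N d < weight d i \<omega>" by blast
    have norm: "real d / 8 \<le> X d i \<omega> \<bullet> X d i \<omega>" using \<omega> i(1) by (auto simp: Bad_def not_le less_imp_le)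
    have low: "low d \<le> ?N d * real d / (8 * real (n d)) - (17 / prob_A d (A d))\<^sup>2 - 16 / prob_A d (A d)"
    proof -
      have "2 powr (\<gamma> - 1) * real d powr (1 - \<kappa> * (1 - \<gamma>)) = (2 * real d powr \<kappa>) powr (\<gamma> - 1) * real d"
      proof -
        have "real d powr (1 - \<kappa> * (1 - \<gamma>)) = real d powr (\<kappa> * (\<gamma> - 1)) * real d powr 1"
          unfolding powr_add[symmetric] by (simp add: algebra_simps)
        then show ?thesis using d by (simp add: powr_mult powr_powr)
      qed
      also have "\<dots> \<le> real (n d) powr (\<gamma> - 1) * real d"
        using n_upper[OF d] n_ge_1[OF d] \<gamma>0 by (intro mult_right_mono powr_mono2') auto
      also have "real (n d) powr (\<gamma> - 1) = ?N d / real (n d)"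
        using n_ge_1[OF d] by (simp add: powr_diff)
      finally have "1 / 8 * 2 powr (\<gamma> - 1) * real d powr (1 - \<kappa> * (1 - \<gamma>)) \<le> ?N d * real d / (8 * real (n d))"
        by (simp add: field_simps)
      moreover have "17 / prob_A d (A d) \<le> 17 / p_min" "16 / prob_A d (A d) \<le> 16 / p_min"
        using p_min(1) p_min(2)[OF d] by (intro divide_left_mono mult_pos_pos; simp)+
      moreover from this(1) have "(17 / prob_A d (A d))\<^sup>2 \<le> (17 / p_min)\<^sup>2"
        using p_pos by (intro power_mono) auto
      ultimately show ?thesis unfolding low_def by linarith
    qed
    have N0: "0 \<le> ?N d" by simp
    have "?N d * real d / (8 * real (n d)) - (17 / prob_A d (A d))\<^sup>2 \<le> lambda_max (sample_cov d \<omega>)"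
      by (rule emp_cov_large(1)[OF M[OF d] X_indep[OF d] X_law[OF d] n_ge_1[OF d] d \<omega>(1) i(1) N0 less_imp_le[OF i(2)] norm])
    moreover have "?N d * real d / (8 * real (n d)) - (17 / prob_A d (A d))\<^sup>2 - 16 / prob_A d (A d) \<le> error_norm d \<omega>"
      by (rule emp_cov_large(2)[OF M[OF d] X_indep[OF d] X_law[OF d] n_ge_1[OF d] d \<omega>(1) i(1) N0 less_imp_le[OF i(2)] norm])
    moreover have "0 \<le> 16 / prob_A d (A d)" using p_pos by simp
    ultimately show "low d \<le> lambda_max (sample_cov d \<omega>) \<and> low d \<le> error_norm d \<omega>"
      using low by linarith
  qed
  have diverges: "conv_distr_infinity M Z"
    if Z: "\<And>d \<omega>. d \<ge> 1 \<Longrightarrow> \<omega> \<in> space (M d) \<Longrightarrow> \<omega> \<notin> Bad d \<Longrightarrow> low d \<le> Z d \<omega>" for Z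
    unfolding conv_distr_infinity_def
  proof (intro allI tendsto_sandwich[OF _ _ tendsto_const B])
    fix x
    have "eventually (\<lambda>d. x < low d) sequentially" using low_lim by (simp add: filterlim_at_top_dense)
    then show "eventually (\<lambda>d. measure (M d) {\<omega> \<in> space (M d). Z d \<omega> \<le> x} \<le> B d) sequentially"
      using eventually_ge_at_top[of 1]
    proof eventually_elim
      case (elim d)
      interpret prob_space "M d" by (rule M[OF elim(2)])
      have "{\<omega> \<in> space (M d). Z d \<omega> \<le> x} \<subseteq> Bad d" using Z[OF elim(2)] elim(1) by fastforce
      then have "prob {\<omega> \<in> space (M d). Z d \<omega> \<le> x} \<le> prob (Bad d)"
        by (rule finite_measure_mono[OF _ Bad_sets[OF elim(2)]])
      then show ?case using Bad_prob[OF elim(2)] by linarith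
    qed
  qed simp
  show "conv_distr_infinity M error_norm"
    by (rule diverges) (use good in blast)
  show "conv_distr_infinity M (\<lambda>d \<omega>. lambda_max (sample_cov d \<omega>))"
    by (rule diverges) (use good in blast)
qed

lemma lambda_max_cond_cov_bdd: "bdd_above ((\<lambda>d. lambda_max (cond_cov d (A d))) ` {1..})"
proof (rule bdd_aboveI2[where M = "16 / p_min"])
  fix d :: nat assume "d \<in> {1..}"
  then have d: "d \<ge> 1" by simp
  have "lambda_max (cond_cov d (A d)) \<le> 16 / prob_A d (A d)"
    by (rule conditioning.lambda_max_cond_cov[OF spiked_conditioning.axioms(2)[OF spiked_uniform[OF d]] d])
  also have "\<dots> \<le> 16 / p_min" using p_min(1) p_min(2)[OF d] by (intro divide_left_mono mult_pos_pos) auto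
  finally show "lambda_max (cond_cov d (A d)) \<le> 16 / p_min" .
qed

end

theorem theorem2p1:
  fixes \<kappa> lam1 \<gamma>s \<kappa>s :: real
    and n r :: "nat \<Rightarrow> nat"
    and A U V :: "nat \<Rightarrow> real Matrix.vec set"
    and S :: "nat \<Rightarrow> real Matrix.mat"
    and lam :: "nat \<Rightarrow> nat \<Rightarrow> real"
    and v :: "nat \<Rightarrow> nat \<Rightarrow> real Matrix.vec"
    and M :: "nat \<Rightarrow> 'w measure"
    and X :: "nat \<Rightarrow> nat \<Rightarrow> 'w \<Rightarrow> real Matrix.vec"
  assumes kappa: "\<kappa> > 0"
    and n: "\<And>d. d \<ge> 1 \<Longrightarrow> \<bar>real (n d) - real d powr \<kappa>\<bar> < 1"
    and A: "\<And>d. d \<ge> 1 \<Longrightarrow> A d \<in> sets (vec_borel d)"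
    and M: "\<And>d. d \<ge> 1 \<Longrightarrow> prob_space (M d)"
    and X_indep: "\<And>d. d \<ge> 1 \<Longrightarrow>
          prob_space.indep_vars (M d) (\<lambda>_. vec_borel d) (X d) {1..n d}"
    and X_law: "\<And>d i. d \<ge> 1 \<Longrightarrow> i \<in> {1..n d} \<Longrightarrow>
          distributed (M d) (vec_lborel d) (X d i)
            (\<lambda>x. ennreal (gauss_density d (0\<^sub>v d) (S d) x))"
    (* (i) spiked covariance *)
    and S: "\<And>d. d \<ge> 1 \<Longrightarrow> S d = spiked_cov d (r d) (lam d) (v d)"
    and r: "\<And>d. d \<ge> 1 \<Longrightarrow> r d \<ge> 1"
    and lam_pos: "\<And>d. d \<ge> 1 \<Longrightarrow> lam d 1 > 0"
    and lam_mono: "\<And>d. d \<ge> 1 \<Longrightarrow> mono_on {1..r d} (lam d)"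
    and v_carrier: "\<And>d k. d \<ge> 1 \<Longrightarrow> k \<in> {1..r d} \<Longrightarrow> v d k \<in> carrier_vec d"
    and v_orthonormal: "\<And>d j k. d \<ge> 1 \<Longrightarrow> j \<in> {1..r d} \<Longrightarrow> k \<in> {1..r d} \<Longrightarrow>
          scalar_prod (v d j) (v d k) = (if j = k then 1 else 0)"
    and V: "\<And>d. d \<ge> 1 \<Longrightarrow> V d = vec_span d (v d ` {1..r d})"
    and r_bdd: "bdd_above (r ` {1..})"
    and l1: "\<And>d. d \<ge> 1 \<Longrightarrow> lam d 1 = lam1"
    and l1_min: "\<And>d. d \<ge> 1 \<Longrightarrow> lam1 = lambda_min (S d)"
    and l1_bounds: "0 < lam1" "lam1 \<le> 1"
    and lam_max_bdd: "bdd_above ((\<lambda>d. lambda_max (S d)) ` {1..})"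
    (* (ii) finite intrinsic dimension *)
    and U: "\<And>d. d \<ge> 1 \<Longrightarrow> is_subspace d (U d)"
    and A_U: "\<And>d x. d \<ge> 1 \<Longrightarrow> x \<in> carrier_vec d \<Longrightarrow> x \<in> A d \<longleftrightarrow> orth_proj d (U d) x \<in> A d"
    and U_bdd: "bdd_above ((\<lambda>d. subspace_dim d (U d)) ` {1..})"
    (* (iii) maximal weight *)
    and gamma_nonneg: "\<gamma>s \<ge> 0"
    and max_weight_0: "\<And>\<gamma>. \<gamma> > \<gamma>s \<Longrightarrow>
          conv_distr_const M
            (\<lambda>d \<omega>. 1 / real (n d) powr \<gamma> *
              Max ((\<lambda>i. indicator (A d) (X d i \<omega>) * lik_ratio d (S d) (X d i \<omega>)) ` {1..n d})) 0"
    and max_weight_inf: "\<And>\<gamma>. \<gamma> < \<gamma>s \<Longrightarrow>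
          conv_distr_infinity M
            (\<lambda>d \<omega>. 1 / real (n d) powr \<gamma> *
              Max ((\<lambda>i. indicator (A d) (X d i \<omega>) * lik_ratio d (S d) (X d i \<omega>)) ` {1..n d}))"
    (* (iv) *)
    and p_inf: "(INF d \<in> {1..}. prob_A d (A d)) > 0"
    (* (v) *)
    and V_U: "(\<forall>d\<ge>1. V d \<subseteq> U d) \<or> (\<forall>d\<ge>1. V d \<subseteq> orth_compl d (U d))"
    and kappa_star: "\<kappa>s = 1 / (1 - \<gamma>s)"
  shows "(\<kappa> > \<kappa>s \<longrightarrow>
            conv_distr_const M
              (\<lambda>d \<omega>. op_norm d (emp_cov d (n d) (S d) (A d) (\<lambda>i. X d i \<omega>) - cond_cov d (A d))) 0)
       \<and> (\<kappa> < \<kappa>s \<longrightarrow>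
            conv_distr_infinity M
              (\<lambda>d \<omega>. op_norm d (emp_cov d (n d) (S d) (A d) (\<lambda>i. X d i \<omega>) - cond_cov d (A d)))
          \<and> conv_distr_infinity M
              (\<lambda>d \<omega>. lambda_max (emp_cov d (n d) (S d) (A d) (\<lambda>i. X d i \<omega>)))
          \<and> bdd_above ((\<lambda>d. lambda_max (cond_cov d (A d))) ` {1..}))
       \<and> ((\<forall>d\<ge>1. V d \<subseteq> orth_compl d (U d)) \<longrightarrow> \<kappa>s = 1 / lam1)
       \<and> ((\<forall>d\<ge>1. V d \<subseteq> U d) \<longrightarrow> 1 \<le> \<kappa>s \<and> \<kappa>s \<le> 1 / lam1)"
proof -
  interpret importance_sampling \<kappa> lam1 \<gamma>s n r A S lam v M X
    by (rule importance_sampling.intro)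
      (fact kappa n A M X_indep X_law S r lam_mono v_carrier v_orthonormal r_bdd l1 l1_bounds
        lam_max_bdd gamma_nonneg max_weight_0 max_weight_inf p_inf)+
  have \<gamma>1: "\<gamma>s < 1" using gamma_upper l1_bounds by linarith
  have above: "\<kappa> > \<kappa>s \<longleftrightarrow> 1 < \<kappa> * (1 - \<gamma>s)" and below: "\<kappa> < \<kappa>s \<longleftrightarrow> \<kappa> * (1 - \<gamma>s) < 1"
    using \<gamma>1 unfolding kappa_star by (simp_all add: divide_less_eq less_divide_eq)
  have upper: "\<kappa>s \<le> 1 / lam1"
    unfolding kappa_star using gamma_upper l1_bounds \<gamma>1 by (intro divide_left_mono) auto
  have "\<kappa>s = 1 / lam1" if perp: "\<forall>d\<ge>1. V d \<subseteq> orth_compl d (U d)"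
  proof -
    have "y + t \<cdot>\<^sub>v v d 1 \<in> A d \<longleftrightarrow> y \<in> A d" if d: "d \<ge> 1" and y: "y \<in> carrier_vec d" for d y t
    proof (rule spike_invariance[OF U[OF d] _ _ A_U[OF d] y])
      have "v d 1 \<in> V d"
        unfolding V[OF d] using v_carrier[OF d] r[OF d] by (intro in_vec_span) auto
      then show "v d 1 \<in> orth_compl d (U d)" using perp d by blast
      show "v d 1 \<in> carrier_vec d" using v_carrier[OF d] r[OF d] by auto
    qed
    then have "1 - lam1 \<le> \<gamma>s" by (rule gamma_lower)
    then show ?thesis using gamma_upper by (simp add: kappa_star)
  qed
  moreover have "1 \<le> \<kappa>s" unfolding kappa_star using \<gamma>1 gamma_nonneg by (simp add: le_divide_eq)
  ultimately show ?thesis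
    using above below upper error_norm_conv divergence[OF _ \<gamma>1] lambda_max_cond_cov_bdd by blast
qed

end
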